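(* Let $n\ge0$, let $\Gamma_0,\Gamma_1,\dots,\Gamma_{2n+1}$ be a finite choice sequence ($\Gamma_0\in\mathbf L(\mathfrak M,\mathfrak N)$) with $\mathfrak D_{\Gamma_{2n+1}}\ne\{0\}$, $\mathfrak D_{\Gamma_{2n+1}^*}\ne\{0\}$, and let $\Gamma\in\mathbf L(\mathfrak D_{\Gamma_{2n+1}},\mathfrak D_{\Gamma^*_{2n+1}})$ be a contraction. If $|z|<1$, then $$\begin{aligned}\left(I_{\mathcal K_n}-z\mathcal S_{n,\Gamma}\right)^{-1}=&\left(I_{\mathcal K_n}-z\mathcal S_{n,0}\right)^{-1}+z\left(\left(I_{\mathcal K_n}-z\mathcal S_{n,0}\right)^{-1}\upharpoonright\mathfrak D_{\Gamma^*_{2n+1}}\right)\times\\&\left(I_{\mathfrak D_{\Gamma^*_{2n+1}}}-z\Gamma\begin{bmatrix}D_{\Gamma_{2n+1}}&-\Gamma^*_{2n+1}\end{bmatrix}\left(P_{\mathcal H_{n+1}}\left(I_{\mathcal K_n}-z\mathcal S_{n,0}\right)^{-1}\upharpoonright\mathfrak D_{\Gamma^*_{2n+1}}\right)\right)^{-1}\times\\&\Gamma\begin{bmatrix}D_{\Gamma_{2n+1}}&-\Gamma^*_{2n+1}\end{bmatrix}P_{\mathcal H_{n+1}}\left(I_{\mathcal K_n}-z\mathcal S_{n,0}\right)^{-1},\end{aligned}$$ $$\begin{aligned}\left(I_{\widetilde{\mathcal K}_n}-z\widetilde{\mathcal S}_{n,\Gamma}\right)^{-1}=&\left(I_{\widetilde{\mathcal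 K}_n}-z\widetilde{\mathcal S}_{n,0}\right)^{-1}+z\left(\left(I_{\widetilde{\mathcal K}_n}-z\widetilde{\mathcal S}_{n,0}\right)^{-1}\upharpoonright\widetilde{\mathcal H}_{n+1}\right)\begin{bmatrix}D_{\Gamma^*_{2n+1}}\\-\Gamma^*_{2n+1}\end{bmatrix}\Gamma\times\\&\left(I_{\mathfrak D_{\Gamma_{2n+1}}}-z\left(P_{\mathfrak D_{\Gamma_{2n+1}}}\left(I_{\widetilde{\mathcal K}_n}-z\widetilde{\mathcal S}_{n,0}\right)^{-1}\upharpoonright\widetilde{\mathcal H}_{n+1}\right)\begin{bmatrix}D_{\Gamma^*_{2n+1}}\\-\Gamma^*_{2n+1}\end{bmatrix}\Gamma\right)^{-1}\times\\&P_{\mathfrak D_{\Gamma_{2n+1}}}\left(I_{\widetilde{\mathcal K}_n}-z\widetilde{\mathcal S}_{n,0}\right)^{-1}.\end{aligned}$$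
   Context: All Hilbert spaces are complex (infinite-dimensional ones are separable). $\mathbf L(H_1,H_2)$ denotes the bounded operators; $P_L$ is the orthogonal projection onto a subspace $L$ (regarded as a map into $L$), $X\upharpoonright L$ is restriction. For a contraction $T$: $D_T=(I-T^*T)^{1/2}$, $\mathfrak D_T=\overline{\operatorname{ran}}\,D_T$. A choice sequence consists of contractions $\Gamma_0\in\mathbf L(\mathfrak M,\mathfrak N)$, $\Gamma_k\in\mathbf L(\mathfrak D_{\Gamma_{k-1}},\mathfrak D_{\Gamma_{k-1}^*})$, $k\ge1$. Elementary rotations, for $k\ge1$, are the unitary operators $$\mathbf J_{\Gamma_k}=\begin{bmatrix}\Gamma_k&D_{\Gamma_k^*}\\ D_{\Gamma_k}&-\Gamma_k^*\end{bmatrix}:\mathfrak D_{\Gamma_{k-1}}\oplus\mathfrak D_{\Gamma_k^*}\to\mathfrak D_{\Gamma_{k-1}^*}\oplus\mathfrak D_{\Gamma_k}.$$ Put $\mathcal H_k=\mathfrak D_{\Gamma_{2k-2}}\oplus\mathfrak D_{\Gamma^*_{2k-1}}$, $\widetilde{\mathcal H}_k=\mathfrak D_{\Gamma^*_{2k-2}}\oplus\mathfrak D_{\Gamma_{2k-1}}$ ($1\le k\le n+1$), $\mathcal K_n=\bigoplus_{k=1}^{n+1}\mathcal H_k$, $\widetilde{\mathcal K}_n=\bigoplus_{k=1}^{n+1}\widetilde{\mathcal H}_k$. For a contraction $\Gamma\in\mathbf L(\mathfrak D_{\Gamma_{2n+1}},\mathfrak D_{\Gamma_{2n+1}^*})$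 put $\mathcal V_n=\bigoplus_{k=1}^{n+1}\mathbf J_{\Gamma_{2k-1}}:\mathcal K_n\to\widetilde{\mathcal K}_n$ and $\mathcal W_{n,\Gamma}=-\Gamma_0^*\oplus\bigoplus_{k=1}^n\mathbf J_{\Gamma_{2k}}\oplus\Gamma$, mapping $\widetilde{\mathcal K}_n=\mathfrak D_{\Gamma_0^*}\oplus\bigoplus_{k=1}^n(\mathfrak D_{\Gamma_{2k-1}}\oplus\mathfrak D_{\Gamma_{2k}^*})\oplus\mathfrak D_{\Gamma_{2n+1}}$ to $\mathcal K_n=\mathfrak D_{\Gamma_0}\oplus\bigoplus_{k=1}^n(\mathfrak D_{\Gamma_{2k-1}^*}\oplus\mathfrak D_{\Gamma_{2k}})\oplus\mathfrak D_{\Gamma_{2n+1}^*}$. Then $\mathcal S_{n,\Gamma}=\mathcal W_{n,\Gamma}\mathcal V_n$ on $\mathcal K_n$ and $\widetilde{\mathcal S}_{n,\Gamma}=\mathcal V_n\mathcal W_{n,\Gamma}$ on $\widetilde{\mathcal K}_n$; $\mathcal S_{n,0},\widetilde{\mathcal S}_{n,0}$ are these operators for $\Gamma=0$. The row $\begin{bmatrix}D_{\Gamma_{2n+1}}&-\Gamma^*_{2n+1}\end{bmatrix}$ acts from $\mathcal H_{n+1}=\mathfrak D_{\Gamma_{2n}}\oplus\mathfrak D_{\Gamma_{2n+1}^*}$ to $\mathfrak D_{\Gamma_{2n+1}}$; the column $\begin{bmatrix}D_{\Gamma^*_{2n+1}}\\-\Gamma^*_{2n+1}\end{bmatrix}$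 acts from $\mathfrak D_{\Gamma^*_{2n+1}}$ to $\widetilde{\mathcal H}_{n+1}=\mathfrak D_{\Gamma_{2n}^*}\oplus\mathfrak D_{\Gamma_{2n+1}}$. $\mathfrak D_{\Gamma_{2n+1}^*}\subset\mathcal H_{n+1}\subset\mathcal K_n$ and $\mathfrak D_{\Gamma_{2n+1}}\subset\widetilde{\mathcal H}_{n+1}\subset\widetilde{\mathcal K}_n$ in the natural way. *)

theory Defs
  imports "HOL-Analysis.Analysis"
begin

section \<open>Complex inner product spaces\<close>

text \<open>The inner product is linear in the first argument.  The library structure
  (norm, real inner product, topology) is that of the underlying real space.\<close>

class complex_inner = real_inner +
  fixes scaleC :: "complex \<Rightarrow> 'a \<Rightarrow> 'a"  (infixr \<open>*\<^sub>C\<close> 75)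
    and cinner :: "'a \<Rightarrow> 'a \<Rightarrow> complex"
  assumes scaleC_add_right: "c *\<^sub>C (x + y) = c *\<^sub>C x + c *\<^sub>C y"
    and scaleC_add_left: "(c + d) *\<^sub>C x = c *\<^sub>C x + d *\<^sub>C x"
    and scaleC_scaleC: "c *\<^sub>C (d *\<^sub>C x) = (c * d) *\<^sub>C x"
    and scaleC_of_real: "complex_of_real r *\<^sub>C x = r *\<^sub>R x"
    and cinner_commute: "cinner x y = cnj (cinner y x)"
    and cinner_add_left: "cinner (x + y) w = cinner x w + cinner y w"
    and cinner_scaleC_left: "cinner (c *\<^sub>C x) y = c * cinner x y"
    and Re_cinner: "Re (cinner x y) = inner x y"

text \<open>Separability is not part of this class; it is the additional sort
  \<open>second_countable_topology\<close>.\<close>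

class chilbert_space = complex_inner + complete_space

lemma cinner_self: "cinner x x = complex_of_real ((norm x)\<^sup>2)"
  for x :: "'a::complex_inner"
proof (rule complex_eqI)
  show "Re (cinner x x) = Re (complex_of_real ((norm x)\<^sup>2))"
    by (simp add: Re_cinner power2_norm_eq_inner)
  have "cinner x x = cnj (cinner x x)" by (rule cinner_commute)
  then show "Im (cinner x x) = Im (complex_of_real ((norm x)\<^sup>2))"
    by (auto simp: complex_eq_iff)
qed

lemma norm_scaleC: "norm (c *\<^sub>C x) = cmod c * norm x" for x :: "'a::complex_inner"
proof -
  have "cinner (c *\<^sub>C x) (c *\<^sub>C x) = c * cnj (c * cinner x x)"
    by (metis cinner_commute cinner_scaleC_left)
  also have "\<dots> = (c * cnj c) * complex_of_real ((norm x)\<^sup>2)"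
    by (simp add: cinner_self)
  also have "\<dots> = complex_of_real ((cmod c * norm x)\<^sup>2)"
    by (simp add: complex_mult_cnj cmod_power2 power_mult_distrib del: of_real_power)
  finally have "(norm (c *\<^sub>C x))\<^sup>2 = (cmod c * norm x)\<^sup>2"
    by (simp add: cinner_self del: of_real_power of_real_mult)
  then show ?thesis by (simp add: power2_eq_iff_nonneg)
qed

lemma cinner_eq_inner:
  "cinner x y = Complex (inner x y) (inner x (\<i> *\<^sub>C y))" for x :: "'a::complex_inner"
proof (rule complex_eqI)
  have "cinner x (\<i> *\<^sub>C y) = cnj (\<i> * cinner y x)"
    by (metis cinner_commute cinner_scaleC_left)
  then have "cinner x (\<i> *\<^sub>C y) = - \<i> * cinner x y"
    by (simp add: cinner_commute[of x y])
  then have "Re (cinner x (\<i> *\<^sub>C y)) = Im (cinner x y)" by simp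
  then show "Im (cinner x y) = Im (Complex (inner x y) (inner x (\<i> *\<^sub>C y)))"
    by (simp add: Re_cinner)
qed (simp add: Re_cinner)

instantiation complex :: chilbert_space
begin

definition scaleC_complex :: "complex \<Rightarrow> complex \<Rightarrow> complex"
  where "scaleC_complex c x = c * x"

definition cinner_complex :: "complex \<Rightarrow> complex \<Rightarrow> complex"
  where "cinner_complex x y = x * cnj y"

instance
  by standard
     (simp_all add: scaleC_complex_def cinner_complex_def algebra_simps scaleR_conv_of_real
        inner_complex_def)

end

instantiation prod :: (complex_inner, complex_inner) complex_inner
begin

definition scaleC_prod :: "complex \<Rightarrow> 'a \<times> 'b \<Rightarrow> 'a \<times> 'b"
  where "scaleC_prod c x = (c *\<^sub>C fst x, c *\<^sub>C snd x)"

definition cinner_prod :: "'a \<times> 'b \<Rightarrow> 'a \<times> 'b \<Rightarrow> complex"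
  where "cinner_prod x y = cinner (fst x) (fst y) + cinner (snd x) (snd y)"

instance
proof
  fix x y :: "'a \<times> 'b"
  show "cinner x y = cnj (cinner y x)"
    by (simp add: cinner_prod_def cinner_commute[of "fst x"] cinner_commute[of "snd x"])
qed (simp_all add: scaleC_prod_def cinner_prod_def scaleC_add_right scaleC_add_left
       scaleC_scaleC scaleC_of_real prod_eq_iff cinner_add_left cinner_scaleC_left Re_cinner
       inner_prod_def algebra_simps)

end

instance prod :: (chilbert_space, chilbert_space) chilbert_space ..


section \<open>The space of square summable sequences\<close>

text \<open>Finite orthogonal sums of closed subspaces of a Hilbert space \<open>'a\<close>, with a variable
  number of summands, are realised as closed subspaces of \<open>'a ell2\<close>.\<close>

typedef (overloaded) 'a ell2 =
  "{f :: nat \<Rightarrow> 'a::complex_inner. summable (\<lambda>i. (norm (f i))\<^sup>2)}"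
  morphisms coord Abs_ell2
  by (intro exI[of _ "\<lambda>_. 0"]) simp

lemma ell2_eq_iff: "x = y \<longleftrightarrow> (\<forall>i. coord x i = coord y i)"
  by (metis coord_inject ext)

lemma summable_coord: "summable (\<lambda>i. (norm (coord x i))\<^sup>2)"
  using coord[of x] by simp

lemma summable_sq_add:
  fixes f g :: "nat \<Rightarrow> 'a::real_inner"
  assumes "summable (\<lambda>i. (norm (f i))\<^sup>2)" "summable (\<lambda>i. (norm (g i))\<^sup>2)"
  shows "summable (\<lambda>i. (norm (f i + g i))\<^sup>2)"
proof (rule summable_comparison_test')
  show "summable (\<lambda>i. 2 * (norm (f i))\<^sup>2 + 2 * (norm (g i))\<^sup>2)"
    using assms by (intro summable_add summable_mult)
  fix i
  have "(norm (f i + g i))\<^sup>2 \<le> (norm (f i) + norm (g i))\<^sup>2"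
    by (intro power_mono norm_triangle_ineq) auto
  also have "\<dots> \<le> 2 * (norm (f i))\<^sup>2 + 2 * (norm (g i))\<^sup>2"
    using zero_le_power2[of "norm (f i) - norm (g i)"]
    by (simp add: power2_eq_square algebra_simps)
  finally show "norm ((norm (f i + g i))\<^sup>2) \<le> 2 * (norm (f i))\<^sup>2 + 2 * (norm (g i))\<^sup>2"
    by simp
qed

lemma summable_inner_coord: "summable (\<lambda>i. inner (coord x i) (coord y i))"
proof (rule summable_comparison_test')
  show "summable (\<lambda>i. (norm (coord x i))\<^sup>2 + (norm (coord y i))\<^sup>2)"
    by (intro summable_add summable_coord)
  fix i
  have "\<bar>inner (coord x i) (coord y i)\<bar> \<le> norm (coord x i) * norm (coord y i)"
    by (rule Cauchy_Schwarz_ineq2)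
  also have "\<dots> \<le> (norm (coord x i))\<^sup>2 + (norm (coord y i))\<^sup>2"
  proof -
    have "0 \<le> (norm (coord x i) - norm (coord y i))\<^sup>2" by simp
    moreover have "0 \<le> norm (coord x i) * norm (coord y i)" by simp
    ultimately show ?thesis unfolding power2_diff by linarith
  qed
  finally show "norm (inner (coord x i) (coord y i)) \<le> (norm (coord x i))\<^sup>2 + (norm (coord y i))\<^sup>2"
    by simp
qed

instantiation ell2 :: (complex_inner) real_vector
begin

definition zero_ell2 :: "'a ell2" where "zero_ell2 = Abs_ell2 (\<lambda>_. 0)"
definition plus_ell2 :: "'a ell2 \<Rightarrow> 'a ell2 \<Rightarrow> 'a ell2"
  where "plus_ell2 x y = Abs_ell2 (\<lambda>i. coord x i + coord y i)"
definition uminus_ell2 :: "'a ell2 \<Rightarrow> 'a ell2"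
  where "uminus_ell2 x = Abs_ell2 (\<lambda>i. - coord x i)"
definition minus_ell2 :: "'a ell2 \<Rightarrow> 'a ell2 \<Rightarrow> 'a ell2"
  where "minus_ell2 x y = x + - y"
definition scaleR_ell2 :: "real \<Rightarrow> 'a ell2 \<Rightarrow> 'a ell2"
  where "scaleR_ell2 r x = Abs_ell2 (\<lambda>i. r *\<^sub>R coord x i)"

lemma coord_zero [simp]: "coord (0::'a ell2) i = 0"
  by (simp add: zero_ell2_def Abs_ell2_inverse)

lemma coord_add [simp]: "coord (x + y) i = coord x i + coord y i" for x y :: "'a ell2"
  by (simp add: plus_ell2_def Abs_ell2_inverse summable_sq_add summable_coord)

lemma coord_uminus [simp]: "coord (- x) i = - coord x i" for x :: "'a ell2"
  by (simp add: uminus_ell2_def Abs_ell2_inverse summable_coord)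

lemma coord_diff [simp]: "coord (x - y) i = coord x i - coord y i" for x y :: "'a ell2"
  by (simp add: minus_ell2_def)

lemma coord_scaleR [simp]: "coord (r *\<^sub>R x) i = r *\<^sub>R coord x i" for x :: "'a ell2"
  by (simp add: scaleR_ell2_def Abs_ell2_inverse summable_coord power_mult_distrib summable_mult)

instance
  by standard (simp_all add: ell2_eq_iff algebra_simps)

end

instantiation ell2 :: (complex_inner) complex_inner
begin

definition inner_ell2 :: "'a ell2 \<Rightarrow> 'a ell2 \<Rightarrow> real"
  where "inner_ell2 x y = (\<Sum>i. inner (coord x i) (coord y i))"
definition norm_ell2 :: "'a ell2 \<Rightarrow> real" where "norm_ell2 x = sqrt (inner x x)"
definition dist_ell2 :: "'a ell2 \<Rightarrow> 'a ell2 \<Rightarrow> real" where "dist_ell2 x y = norm (x - y)"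
definition sgn_ell2 :: "'a ell2 \<Rightarrow> 'a ell2" where "sgn_ell2 x = inverse (norm x) *\<^sub>R x"
definition uniformity_ell2 :: "('a ell2 \<times> 'a ell2) filter"
  where "uniformity_ell2 = (INF e\<in>{0<..}. principal {(x, y). dist x y < e})"
definition open_ell2 :: "'a ell2 set \<Rightarrow> bool"
  where "open_ell2 U \<longleftrightarrow> (\<forall>x\<in>U. \<forall>\<^sub>F (x', y) in uniformity. x' = x \<longrightarrow> y \<in> U)"
definition scaleC_ell2 :: "complex \<Rightarrow> 'a ell2 \<Rightarrow> 'a ell2"
  where "scaleC_ell2 c x = Abs_ell2 (\<lambda>i. c *\<^sub>C coord x i)"
definition cinner_ell2 :: "'a ell2 \<Rightarrow> 'a ell2 \<Rightarrow> complex"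
  where "cinner_ell2 x y = (\<Sum>i. cinner (coord x i) (coord y i))"

lemma coord_scaleC [simp]: "coord (c *\<^sub>C x) i = c *\<^sub>C coord x i" for x :: "'a ell2"
  by (simp add: scaleC_ell2_def Abs_ell2_inverse summable_coord norm_scaleC power_mult_distrib
      summable_mult)

lemma summable_cinner_coord: "summable (\<lambda>i. cinner (coord x i) (coord y i))"
  for x y :: "'a ell2"
proof -
  have "summable (\<lambda>i. inner (coord x i) (coord (\<i> *\<^sub>C y) i))"
    by (rule summable_inner_coord)
  then show ?thesis
    by (simp add: cinner_eq_inner summable_complex_iff summable_inner_coord)
qed

instance
proof
  fix x y w :: "'a ell2" and r :: real and c d :: complex
  show "dist x y = norm (x - y)" by (rule dist_ell2_def)
  show "sgn x = inverse (norm x) *\<^sub>R x" by (rule sgn_ell2_def)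
  show "uniformity = (INF e\<in>{0<..}. principal {(x :: 'a ell2, y). dist x y < e})"
    by (rule uniformity_ell2_def)
  show "open U \<longleftrightarrow> (\<forall>x\<in>U. \<forall>\<^sub>F (x', y) in uniformity. x' = x \<longrightarrow> y \<in> U)" for U :: "'a ell2 set"
    by (rule open_ell2_def)
  show "inner x y = inner y x"
    unfolding inner_ell2_def by (subst inner_commute) (rule refl)
  show "inner (x + y) w = inner x w + inner y w"
    unfolding inner_ell2_def coord_add inner_add_left
    by (intro suminf_add[symmetric] summable_inner_coord)
  show "inner (r *\<^sub>R x) y = r * inner x y"
    unfolding inner_ell2_def coord_scaleR inner_scaleR_left
    by (intro suminf_mult summable_inner_coord)
  show "0 \<le> inner x x" by (simp add: inner_ell2_def suminf_nonneg summable_inner_coord)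
  show "inner x x = 0 \<longleftrightarrow> x = 0"
    by (simp add: inner_ell2_def suminf_eq_zero_iff summable_inner_coord ell2_eq_iff)
  show "norm x = sqrt (inner x x)" by (rule norm_ell2_def)
  show "c *\<^sub>C (x + y) = c *\<^sub>C x + c *\<^sub>C y"
    and "(c + d) *\<^sub>C x = c *\<^sub>C x + d *\<^sub>C x"
    and "c *\<^sub>C (d *\<^sub>C x) = (c * d) *\<^sub>C x"
    and "complex_of_real r *\<^sub>C x = r *\<^sub>R x"
    by (simp_all add: ell2_eq_iff scaleC_add_right scaleC_add_left scaleC_scaleC scaleC_of_real)
  have "(\<lambda>i. cinner (coord x i) (coord y i)) = (\<lambda>i. cnj (cinner (coord y i) (coord x i)))"
    by (rule ext) (rule cinner_commute)
  moreover have "(\<lambda>i. cnj (cinner (coord y i) (coord x i))) sums cnj (cinner y x)"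
    unfolding cinner_ell2_def sums_cnj using summable_cinner_coord by (rule summable_sums)
  ultimately have "(\<lambda>i. cinner (coord x i) (coord y i)) sums cnj (cinner y x)"
    by (simp only:)
  then show "cinner x y = cnj (cinner y x)"
    unfolding cinner_ell2_def[of x y] by (rule sums_unique[symmetric])
  show "cinner (x + y) w = cinner x w + cinner y w"
    unfolding cinner_ell2_def coord_add cinner_add_left
    by (intro suminf_add[symmetric] summable_cinner_coord)
  show "cinner (c *\<^sub>C x) y = c * cinner x y"
    unfolding cinner_ell2_def coord_scaleC cinner_scaleC_left
    by (intro suminf_mult summable_cinner_coord)
  show "Re (cinner x y) = inner x y"
    unfolding cinner_ell2_def inner_ell2_def Re_suminf[OF summable_cinner_coord] Re_cinner
    by (rule refl)
qed

end

lemma norm_ell2_sq: "(norm x)\<^sup>2 = (\<Sum>i. (norm (coord x i))\<^sup>2)"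
  by (simp add: power2_norm_eq_inner inner_ell2_def)

lemma sum_coord_le: "(\<Sum>i<k. (norm (coord x i))\<^sup>2) \<le> (norm x)\<^sup>2"
  unfolding norm_ell2_sq by (rule sum_le_suminf) (auto simp: summable_coord)

lemma norm_coord_le: "norm (coord x i) \<le> norm x"
proof -
  have "(norm (coord x i))\<^sup>2 \<le> (\<Sum>j<Suc i. (norm (coord x j))\<^sup>2)"
    by (simp add: sum_nonneg)
  also have "\<dots> \<le> (norm x)\<^sup>2" by (rule sum_coord_le)
  finally show ?thesis by (rule power2_le_imp_le) simp
qed

instance ell2 :: (chilbert_space) chilbert_space
proof
  fix X :: "nat \<Rightarrow> 'a ell2"
  assume X: "Cauchy X"
  have coord_Cauchy: "Cauchy (\<lambda>m. coord (X m) i)" for i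
  proof (rule metric_CauchyI)
    fix e :: real assume "0 < e"
    then obtain M where M: "\<forall>m\<ge>M. \<forall>n\<ge>M. dist (X m) (X n) < e"
      using metric_CauchyD[OF X] by blast
    have le: "dist (coord (X m) i) (coord (X n) i) \<le> dist (X m) (X n)" for m n
      using norm_coord_le[of "X m - X n" i] unfolding dist_norm coord_diff .
    have "dist (coord (X m) i) (coord (X n) i) < e" if "m \<ge> M" "n \<ge> M" for m n
      using le_less_trans[OF le] M that by blast
    then show "\<exists>M. \<forall>m\<ge>M. \<forall>n\<ge>M. dist (coord (X m) i) (coord (X n) i) < e"
      by blast
  qed
  define L where "L i = lim (\<lambda>m. coord (X m) i)" for i
  have L: "(\<lambda>m. coord (X m) i) \<longlonglongrightarrow> L i" for i
    unfolding L_def by (rule convergent_LIMSEQ_iff[THEN iffD1, OF Cauchy_convergent[OF coord_Cauchy]])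
  have tail: "\<exists>M. \<forall>m\<ge>M. \<forall>k. (\<Sum>i<k. (norm (coord (X m) i - L i))\<^sup>2) \<le> e\<^sup>2"
    if "e > 0" for e :: real
  proof -
    obtain M where M': "\<forall>m\<ge>M. \<forall>n\<ge>M. dist (X m) (X n) < e"
      using metric_CauchyD[OF X \<open>e > 0\<close>] by blast
    have M: "dist (X m) (X n) < e" if "m \<ge> M" "n \<ge> M" for m n
      using M' that by blast
    have "(\<Sum>i<k. (norm (coord (X m) i - L i))\<^sup>2) \<le> e\<^sup>2" if "m \<ge> M" for m k
    proof (rule LIMSEQ_le_const2)
      show "(\<lambda>n. \<Sum>i<k. (norm (coord (X m) i - coord (X n) i))\<^sup>2)
              \<longlonglongrightarrow> (\<Sum>i<k. (norm (coord (X m) i - L i))\<^sup>2)"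
        by (intro tendsto_sum tendsto_power tendsto_norm tendsto_diff tendsto_const L)
      have "(\<Sum>i<k. (norm (coord (X m) i - coord (X n) i))\<^sup>2) \<le> e\<^sup>2" if "n \<ge> M" for n
      proof -
        have "(\<Sum>i<k. (norm (coord (X m) i - coord (X n) i))\<^sup>2) \<le> (norm (X m - X n))\<^sup>2"
          using sum_coord_le[of "X m - X n" k] unfolding coord_diff .
        also have "\<dots> \<le> e\<^sup>2"
          using M[OF \<open>m \<ge> M\<close> that] by (intro power_mono) (simp_all add: dist_norm)
        finally show ?thesis .
      qed
      then show "\<exists>N. \<forall>n\<ge>N. (\<Sum>i<k. (norm (coord (X m) i - coord (X n) i))\<^sup>2) \<le> e\<^sup>2"
        by blast
    qed
    then show ?thesis by blast
  qed
  have summ: "summable (\<lambda>i. (norm (coord (X m) i - L i))\<^sup>2)"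
    if "\<forall>k. (\<Sum>i<k. (norm (coord (X m) i - L i))\<^sup>2) \<le> e\<^sup>2" for m e
    using that by (intro summableI_nonneg_bounded[where x = "e\<^sup>2"]) simp_all
  obtain M where "\<forall>m\<ge>M. \<forall>k. (\<Sum>i<k. (norm (coord (X m) i - L i))\<^sup>2) \<le> 1\<^sup>2"
    using tail[OF zero_less_one] by blast
  then have "summable (\<lambda>i. (norm (coord (X M) i - L i))\<^sup>2)" using summ by blast
  then have "summable (\<lambda>i. (norm (- (coord (X M) i - L i) + coord (X M) i))\<^sup>2)"
    by (intro summable_sq_add) (simp_all only: norm_minus_cancel summable_coord)
  then have "summable (\<lambda>i. (norm (L i))\<^sup>2)" by simp
  then have cL: "coord (Abs_ell2 L) = L" by (simp add: Abs_ell2_inverse)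
  have "X \<longlonglongrightarrow> Abs_ell2 L"
  proof (rule metric_LIMSEQ_I)
    fix e :: real assume "0 < e"
    then obtain M where M: "\<forall>m\<ge>M. \<forall>k. (\<Sum>i<k. (norm (coord (X m) i - L i))\<^sup>2) \<le> (e/2)\<^sup>2"
      using tail[OF half_gt_zero[OF \<open>0 < e\<close>]] by blast
    have "dist (X m) (Abs_ell2 L) < e" if "m \<ge> M" for m
    proof -
      have *: "\<forall>k. (\<Sum>i<k. (norm (coord (X m) i - L i))\<^sup>2) \<le> (e/2)\<^sup>2" using M that by blast
      have "(norm (X m - Abs_ell2 L))\<^sup>2 \<le> (e/2)\<^sup>2"
        unfolding norm_ell2_sq coord_diff cL
        using summ[OF *] by (rule suminf_le_const) (rule *[rule_format])
      then have "norm (X m - Abs_ell2 L) \<le> e/2"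
        using \<open>0 < e\<close> by (auto intro: power2_le_imp_le[where y = "e/2"])
      then show ?thesis using \<open>0 < e\<close> by (simp add: dist_norm)
    qed
    then show "\<exists>M. \<forall>m\<ge>M. dist (X m) (Abs_ell2 L) < e" by blast
  qed
  then show "convergent X" by (auto simp: convergent_def)
qed


section \<open>Bounded operators between closed subspaces\<close>

definition csubspace :: "'a::complex_inner set \<Rightarrow> bool" where
  "csubspace L \<longleftrightarrow> 0 \<in> L \<and> (\<forall>x\<in>L. \<forall>y\<in>L. x + y \<in> L) \<and> (\<forall>c. \<forall>x\<in>L. c *\<^sub>C x \<in> L)"

text \<open>An operator carries its source and target spaces; its action is normalised to be \<open>0\<close>
  outside the source, so that equality of values of type \<open>oper\<close> is equality of operators
  (including source and target).\<close>

datatype ('a, 'b) oper = Oper (src: "'a set") (tgt: "'b set") (app: "'a \<Rightarrow> 'b")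

definition mk_op :: "'a set \<Rightarrow> 'b set \<Rightarrow> ('a \<Rightarrow> 'b) \<Rightarrow> ('a, 'b::zero) oper" where
  "mk_op A B f = Oper A B (\<lambda>x. if x \<in> A then f x else 0)"

definition bounded_ops :: "'a::complex_inner set \<Rightarrow> 'b::complex_inner set \<Rightarrow> ('a, 'b) oper set"
  where "bounded_ops A B = {T. src T = A \<and> tgt T = B \<and>
     csubspace A \<and> closed A \<and> csubspace B \<and> closed B \<and>
     (\<forall>x\<in>A. app T x \<in> B) \<and> (\<forall>x. x \<notin> A \<longrightarrow> app T x = 0) \<and>
     (\<forall>x\<in>A. \<forall>y\<in>A. app T (x + y) = app T x + app T y) \<and>
     (\<forall>c. \<forall>x\<in>A. app T (c *\<^sub>C x) = c *\<^sub>C app T x) \<and>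
     (\<exists>C. \<forall>x\<in>A. norm (app T x) \<le> C * norm x)}"

definition contractions :: "'a::complex_inner set \<Rightarrow> 'b::complex_inner set \<Rightarrow> ('a, 'b) oper set"
  where "contractions A B = {T \<in> bounded_ops A B. \<forall>x\<in>A. norm (app T x) \<le> norm x}"

definition op_id :: "'a set \<Rightarrow> ('a, 'a::zero) oper" where
  "op_id A = mk_op A A (\<lambda>x. x)"

definition op_zero :: "'a set \<Rightarrow> 'b set \<Rightarrow> ('a, 'b::zero) oper" where
  "op_zero A B = mk_op A B (\<lambda>_. 0)"

definition op_comp :: "('b, 'c::zero) oper \<Rightarrow> ('a, 'b) oper \<Rightarrow> ('a, 'c) oper"
  (infixl \<open>\<circ>\<^sub>o\<close> 70)
  where "S \<circ>\<^sub>o T = mk_op (src T) (tgt S) (\<lambda>x. app S (app T x))"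

definition op_add :: "('a, 'b::complex_inner) oper \<Rightarrow> ('a, 'b) oper \<Rightarrow> ('a, 'b) oper"
  (infixl \<open>+\<^sub>o\<close> 65)
  where "S +\<^sub>o T = mk_op (src S) (tgt S) (\<lambda>x. app S x + app T x)"

definition op_diff :: "('a, 'b::complex_inner) oper \<Rightarrow> ('a, 'b) oper \<Rightarrow> ('a, 'b) oper"
  (infixl \<open>-\<^sub>o\<close> 65)
  where "S -\<^sub>o T = mk_op (src S) (tgt S) (\<lambda>x. app S x - app T x)"

definition op_scale :: "complex \<Rightarrow> ('a, 'b::complex_inner) oper \<Rightarrow> ('a, 'b) oper"
  (infixr \<open>*\<^sub>o\<close> 67)
  where "c *\<^sub>o T = mk_op (src T) (tgt T) (\<lambda>x. c *\<^sub>C app T x)"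

text \<open>The inverse is the inverse in the sense of bounded operators; it is meaningful only for
  operators satisfying \<open>op_invertible\<close>.\<close>

definition is_op_inverse ::
    "('a::complex_inner, 'b::complex_inner) oper \<Rightarrow> ('b, 'a) oper \<Rightarrow> bool" where
  "is_op_inverse T S \<longleftrightarrow> S \<in> bounded_ops (tgt T) (src T) \<and>
     S \<circ>\<^sub>o T = op_id (src T) \<and> T \<circ>\<^sub>o S = op_id (tgt T)"

definition op_invertible :: "('a::complex_inner, 'b::complex_inner) oper \<Rightarrow> bool" where
  "op_invertible T \<longleftrightarrow> T \<in> bounded_ops (src T) (tgt T) \<and> (\<exists>S. is_op_inverse T S)"

definition op_inv :: "('a::complex_inner, 'b::complex_inner) oper \<Rightarrow> ('b, 'a) oper" where
  "op_inv T = (THE S. is_op_inverse T S)"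

definition adj :: "('a::complex_inner, 'b::complex_inner) oper \<Rightarrow> ('b, 'a) oper" where
  "adj T = mk_op (tgt T) (src T)
     (\<lambda>y. THE x. x \<in> src T \<and> (\<forall>u\<in>src T. cinner (app T u) y = cinner u x))"

definition positive_op :: "('a::complex_inner, 'a) oper \<Rightarrow> bool" where
  "positive_op A \<longleftrightarrow> A \<in> bounded_ops (src A) (src A) \<and>
     (\<forall>x\<in>src A. cinner (app A x) x \<in> \<real>\<^sub>\<ge>\<^sub>0)"

definition op_sqrt :: "('a::complex_inner, 'a) oper \<Rightarrow> ('a, 'a) oper" where
  "op_sqrt A = (THE B. positive_op B \<and> B \<circ>\<^sub>o B = A)"

definition defect :: "('a::complex_inner, 'b::complex_inner) oper \<Rightarrow> ('a, 'a) oper" where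
  "defect T = op_sqrt (op_id (src T) -\<^sub>o adj T \<circ>\<^sub>o T)"

definition defect_space :: "('a::complex_inner, 'b::complex_inner) oper \<Rightarrow> 'a set" where
  "defect_space T = closure (app (defect T) ` src T)"

text \<open>For an isometric embedding \<open>\<iota>\<close> of \<open>L\<close> into \<open>H\<close>, this is the orthogonal projection of
  \<open>H\<close> onto the subspace \<open>\<iota> ` L\<close>, regarded as an operator into \<open>L\<close> via the identification of
  \<open>L\<close> with \<open>\<iota> ` L\<close>.\<close>

definition proj_onto :: "('a::complex_inner, 'b::complex_inner) oper \<Rightarrow> ('b, 'a) oper" where
  "proj_onto \<iota> = mk_op (tgt \<iota>) (src \<iota>)
     (\<lambda>x. THE p. p \<in> src \<iota> \<and> (\<forall>u\<in>src \<iota>. cinner (x - app \<iota> p) (app \<iota> u) = 0))"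


section \<open>Choice sequences, elementary rotations and the truncated operators\<close>

text \<open>The Hilbert spaces \<open>\<MM>\<close> and \<open>\<NN>\<close> are the types \<open>'m\<close> and \<open>'n\<close>; all defect spaces
  \<open>\<DD>\<^bsub>\<Gamma>\<^sub>k\<^esub>\<close> are then closed subspaces of \<open>'m\<close>, and all \<open>\<DD>\<^bsub>\<Gamma>\<^sub>k*\<^esub>\<close> closed subspaces of \<open>'n\<close>.
  Only the entries \<open>\<Gamma> 0, \<dots>, \<Gamma> N\<close> are constrained.\<close>

definition choice_sequence ::
    "nat \<Rightarrow> (nat \<Rightarrow> ('m::chilbert_space, 'n::chilbert_space) oper) \<Rightarrow> bool" where
  "choice_sequence N \<Gamma> \<longleftrightarrow> \<Gamma> 0 \<in> contractions UNIV UNIV \<and>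
     (\<forall>k\<in>{1..N}. \<Gamma> k \<in> contractions (defect_space (\<Gamma> (k - 1))) (defect_space (adj (\<Gamma> (k - 1)))))"

definition rotation ::
    "('a::complex_inner, 'b::complex_inner) oper \<Rightarrow> ('a \<times> 'b, 'b \<times> 'a) oper" where
  "rotation T = mk_op (src T \<times> defect_space (adj T)) (tgt T \<times> defect_space T)
     (\<lambda>(x, y). (app T x + app (defect (adj T)) y, app (defect T) x - app (adj T) y))"

text \<open>The second row \<open>[D\<^sub>T, -T*]\<close> and the second column \<open>[D\<^bsub>T*\<^esub>; -T*]\<close> of \<open>rotation T\<close>.\<close>

definition defect_row ::
    "('a::complex_inner, 'b::complex_inner) oper \<Rightarrow> ('a \<times> 'b, 'a) oper" where
  "defect_row T = mk_op (src T \<times> defect_space (adj T)) (defect_space T)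
     (\<lambda>(x, y). app (defect T) x - app (adj T) y)"

definition defect_col ::
    "('a::complex_inner, 'b::complex_inner) oper \<Rightarrow> ('b, 'b \<times> 'a) oper" where
  "defect_col T = mk_op (defect_space (adj T)) (tgt T \<times> defect_space T)
     (\<lambda>y. (app (defect (adj T)) y, - app (adj T) y))"

text \<open>The orthogonal sum \<open>H 1 \<oplus> \<dots> \<oplus> H N\<close>; \<open>fin_seq\<close> is the vector with given components.\<close>

definition fin_seq :: "nat \<Rightarrow> (nat \<Rightarrow> 'a) \<Rightarrow> 'a::complex_inner ell2" where
  "fin_seq N f = Abs_ell2 (\<lambda>k. if k \<in> {1..N} then f k else 0)"

lemma coord_fin_seq: "coord (fin_seq N f) k = (if k \<in> {1..N} then f k else 0)"
proof -
  have "summable (\<lambda>k. (norm (if k \<in> {1..N} then f k else 0))\<^sup>2)"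
    by (rule summable_finite[of "{1..N}"]) auto
  then show ?thesis by (simp only: fin_seq_def Abs_ell2_inverse mem_Collect_eq)
qed

definition hsum :: "nat \<Rightarrow> (nat \<Rightarrow> 'a set) \<Rightarrow> 'a::complex_inner ell2 set" where
  "hsum N H = {x. \<forall>k. if k \<in> {1..N} then coord x k \<in> H k else coord x k = 0}"

definition Hsp :: "(nat \<Rightarrow> ('m::complex_inner, 'n::complex_inner) oper) \<Rightarrow> nat \<Rightarrow> ('m \<times> 'n) set"
  where "Hsp \<Gamma> k = defect_space (\<Gamma> (2*k - 2)) \<times> defect_space (adj (\<Gamma> (2*k - 1)))"

definition Hsp' :: "(nat \<Rightarrow> ('m::complex_inner, 'n::complex_inner) oper) \<Rightarrow> nat \<Rightarrow> ('n \<times> 'm) set"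
  where "Hsp' \<Gamma> k = defect_space (adj (\<Gamma> (2*k - 2))) \<times> defect_space (\<Gamma> (2*k - 1))"

definition Ksp ::
    "(nat \<Rightarrow> ('m::complex_inner, 'n::complex_inner) oper) \<Rightarrow> nat \<Rightarrow> ('m \<times> 'n) ell2 set"
  where "Ksp \<Gamma> n = hsum (n + 1) (Hsp \<Gamma>)"

definition Ksp' ::
    "(nat \<Rightarrow> ('m::complex_inner, 'n::complex_inner) oper) \<Rightarrow> nat \<Rightarrow> ('n \<times> 'm) ell2 set"
  where "Ksp' \<Gamma> n = hsum (n + 1) (Hsp' \<Gamma>)"

definition Vop :: "(nat \<Rightarrow> ('m::complex_inner, 'n::complex_inner) oper) \<Rightarrow> nat \<Rightarrow>
    (('m \<times> 'n) ell2, ('n \<times> 'm) ell2) oper" where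
  "Vop \<Gamma> n = mk_op (Ksp \<Gamma> n) (Ksp' \<Gamma> n)
     (\<lambda>x. fin_seq (n + 1) (\<lambda>k. app (rotation (\<Gamma> (2*k - 1))) (coord x k)))"

text \<open>\<open>Wop \<Gamma> n G\<close> is \<open>-\<Gamma>\<^sub>0* \<oplus> J\<^bsub>\<Gamma>\<^sub>2\<^esub> \<oplus> J\<^bsub>\<Gamma>\<^sub>4\<^esub> \<oplus> \<dots> \<oplus> G\<close>, written in the bracketing of the
  summands used for \<open>Ksp'\<close> and \<open>Ksp\<close>: the rotation of \<open>\<Gamma> (2*k)\<close> takes the second entry of
  component \<open>k\<close> and the first entry of component \<open>k + 1\<close> of its argument to the corresponding
  entries of its value.\<close>

definition Wop :: "(nat \<Rightarrow> ('m::complex_inner, 'n::complex_inner) oper) \<Rightarrow> nat \<Rightarrow> ('m, 'n) oper \<Rightarrow>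
    (('n \<times> 'm) ell2, ('m \<times> 'n) ell2) oper" where
  "Wop \<Gamma> n G = mk_op (Ksp' \<Gamma> n) (Ksp \<Gamma> n)
     (\<lambda>x. let J = (\<lambda>k. app (rotation (\<Gamma> (2*k))) (snd (coord x k), fst (coord x (k + 1)))) in
       fin_seq (n + 1) (\<lambda>k.
         (if k = 1 then - app (adj (\<Gamma> 0)) (fst (coord x 1)) else snd (J (k - 1)),
          if k = n + 1 then app G (snd (coord x (n + 1))) else fst (J k))))"

definition Sop :: "(nat \<Rightarrow> ('m::complex_inner, 'n::complex_inner) oper) \<Rightarrow> nat \<Rightarrow> ('m, 'n) oper \<Rightarrow>
    (('m \<times> 'n) ell2, ('m \<times> 'n) ell2) oper" where
  "Sop \<Gamma> n G = Wop \<Gamma> n G \<circ>\<^sub>o Vop \<Gamma> n"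

definition Sop' :: "(nat \<Rightarrow> ('m::complex_inner, 'n::complex_inner) oper) \<Rightarrow> nat \<Rightarrow> ('m, 'n) oper \<Rightarrow>
    (('n \<times> 'm) ell2, ('n \<times> 'm) ell2) oper" where
  "Sop' \<Gamma> n G = Vop \<Gamma> n \<circ>\<^sub>o Wop \<Gamma> n G"

text \<open>The natural embeddings of \<open>Hsp \<Gamma> (n + 1)\<close> and \<open>\<DD>\<^bsub>\<Gamma>\<^sub>2\<^sub>n\<^sub>+\<^sub>1*\<^esub>\<close> into \<open>Ksp \<Gamma> n\<close>, and of
  \<open>Hsp' \<Gamma> (n + 1)\<close> and \<open>\<DD>\<^bsub>\<Gamma>\<^sub>2\<^sub>n\<^sub>+\<^sub>1\<^esub>\<close> into \<open>Ksp' \<Gamma> n\<close>.  Restriction to one of these subspaces is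
  composition with its embedding.\<close>

definition emb_H :: "(nat \<Rightarrow> ('m::complex_inner, 'n::complex_inner) oper) \<Rightarrow> nat \<Rightarrow>
    ('m \<times> 'n, ('m \<times> 'n) ell2) oper" where
  "emb_H \<Gamma> n = mk_op (Hsp \<Gamma> (n + 1)) (Ksp \<Gamma> n)
     (\<lambda>h. fin_seq (n + 1) (\<lambda>k. if k = n + 1 then h else 0))"

definition emb_D_star :: "(nat \<Rightarrow> ('m::complex_inner, 'n::complex_inner) oper) \<Rightarrow> nat \<Rightarrow>
    ('n, ('m \<times> 'n) ell2) oper" where
  "emb_D_star \<Gamma> n = mk_op (defect_space (adj (\<Gamma> (2*n + 1)))) (Ksp \<Gamma> n)
     (\<lambda>y. app (emb_H \<Gamma> n) (0, y))"

definition emb_H' :: "(nat \<Rightarrow> ('m::complex_inner, 'n::complex_inner) oper) \<Rightarrow> nat \<Rightarrow>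
    ('n \<times> 'm, ('n \<times> 'm) ell2) oper" where
  "emb_H' \<Gamma> n = mk_op (Hsp' \<Gamma> (n + 1)) (Ksp' \<Gamma> n)
     (\<lambda>h. fin_seq (n + 1) (\<lambda>k. if k = n + 1 then h else 0))"

definition emb_D :: "(nat \<Rightarrow> ('m::complex_inner, 'n::complex_inner) oper) \<Rightarrow> nat \<Rightarrow>
    ('m, ('n \<times> 'm) ell2) oper" where
  "emb_D \<Gamma> n = mk_op (defect_space (\<Gamma> (2*n + 1))) (Ksp' \<Gamma> n)
     (\<lambda>y. app (emb_H' \<Gamma> n) (0, y))"

end

theory Submission
  imports Defs
begin

text \<open>
  Writing \<open>T = \<Gamma>\<^sub>2\<^sub>n\<^sub>+\<^sub>1\<close>, the parameter \<open>G\<close> enters \<open>W\<^sub>n\<^sub>,\<^sub>G\<close> only as an operator from the last entry of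
  the argument to the last entry of the value.  With the embedding \<open>E\<close> of \<open>\<DD>\<^bsub>T*\<^esub>\<close> into
  \<open>\<K>\<^sub>n\<close> and the projection \<open>P\<close> of \<open>\<K>\<^sub>n\<close> onto its last summand this means
  \<open>S\<^sub>G = S\<^sub>0 + E F\<close>, where \<open>F = G [D\<^sub>T, -T*] P\<close>.  So \<open>I - z S\<^sub>G\<close> is the
  perturbation \<open>(I - z S\<^sub>0) - z E F\<close> of \<open>I - z S\<^sub>0\<close>.  For perturbations of this form, as soon as
  both operators are invertible, so is \<open>I - z F (I - z S\<^sub>0)\<^sup>-\<^sup>1 E\<close>, and the inverse of the perturbed
  operator is given by the formula of \<open>inverse_of_perturbation\<close>, which is the asserted one.  The
  second formula is the same identity for \<open>V W\<^sub>G = V W\<^sub>0 + E' P'\<close> with \<open>E' = [D\<^bsub>T*\<^esub>; -T*] G\<close>,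
  viewed as a map into the last summand, and \<open>P'\<close> the projection onto \<open>\<DD>\<^sub>T\<close>.

  Invertibility of \<open>I - z S\<close> for \<open>\<bar>z\<bar> < 1\<close> only needs that \<open>S\<close> is a contraction of a closed
  subspace (\<open>id_minus_contraction_invertible\<close>).  Here \<open>S\<close> is a product of \<open>V\<close> and \<open>W\<close>, and
  these are orthogonal sums of contractions because the rotations are isometric
  (\<open>rotation_isometric\<close>).

  The isometry of the rotations rests on \<open>D\<^sub>T\<^sup>2 = I - T* T\<close> and on the intertwining relation
  \<open>T D\<^sub>T = D\<^bsub>T*\<^esub> T\<close>; the latter also gives that \<open>T\<close> maps \<open>\<DD>\<^sub>T\<close> into
  \<open>\<DD>\<^bsub>T*\<^esub>\<close>.  To have these facts, adjoints are constructed from the Riesz representation theorem,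
  and positive square roots of \<open>I - X\<close> from the iteration \<open>Y\<^sub>k\<^sub>+\<^sub>1 = (X + Y\<^sub>k\<^sup>2) / 2\<close>, which
  converges in norm to an operator \<open>Y\<close> with \<open>(I - Y)\<^sup>2 = I - X\<close>.  An operator that intertwines \<open>X\<close> with
  some \<open>X'\<close> also intertwines their iterates, hence the limits; this yields both the
  intertwining relation and, by a commutation argument, uniqueness of the square root.
\<close>


section \<open>Bounded operators between closed subspaces\<close>

lemma scaleR_scaleC: "r *\<^sub>R x = complex_of_real r *\<^sub>C x" for x :: "'a::complex_inner"
  by (simp add: scaleC_of_real)

lemma scaleC_one [simp]: "1 *\<^sub>C x = x" for x :: "'a::complex_inner"
  using scaleC_of_real[of 1 x] by simp

lemma scaleC_minus_one: "(- 1) *\<^sub>C x = - x" for x :: "'a::complex_inner"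
  using scaleC_of_real[of "-1" x] by simp

lemma scaleC_zero_right [simp]: "c *\<^sub>C 0 = (0::'a::complex_inner)"
  using norm_scaleC[of c "0::'a"] by simp

lemma scaleC_minus_right: "c *\<^sub>C (- x) = - (c *\<^sub>C x)" for x :: "'a::complex_inner"
  by (metis scaleC_minus_one scaleC_scaleC mult.commute)

lemma scaleC_diff_right: "c *\<^sub>C (x - y) = c *\<^sub>C x - c *\<^sub>C y" for x y :: "'a::complex_inner"
  using scaleC_add_right[of c x "- y"] by (simp add: scaleC_minus_right)

lemma bounded_linear_scaleC: "bounded_linear ((*\<^sub>C) c :: 'a::complex_inner \<Rightarrow> 'a)"
  by (rule bounded_linear_intro[where K = "cmod c"])
     (simp_all add: scaleC_add_right scaleR_scaleC scaleC_scaleC norm_scaleC mult.commute)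

lemma Im_cinner: "Im (cinner x y) = - inner (\<i> *\<^sub>C x) y"
  by (simp add: Re_cinner[symmetric] cinner_scaleC_left)

lemma csubspaceD:
  assumes "csubspace L"
  shows csubspace_zero: "0 \<in> L"
    and csubspace_add: "x \<in> L \<Longrightarrow> y \<in> L \<Longrightarrow> x + y \<in> L"
    and csubspace_scaleC: "x \<in> L \<Longrightarrow> c *\<^sub>C x \<in> L"
    and csubspace_scaleR: "x \<in> L \<Longrightarrow> r *\<^sub>R x \<in> L"
    and csubspace_uminus: "x \<in> L \<Longrightarrow> - x \<in> L"
    and csubspace_diff: "x \<in> L \<Longrightarrow> y \<in> L \<Longrightarrow> x - y \<in> L"
proof -
  show 0: "0 \<in> L" and add: "x \<in> L \<Longrightarrow> y \<in> L \<Longrightarrow> x + y \<in> L"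
    and sc: "x \<in> L \<Longrightarrow> c *\<^sub>C x \<in> L" for x y c
    using assms by (auto simp: csubspace_def)
  show "x \<in> L \<Longrightarrow> r *\<^sub>R x \<in> L" using sc by (simp add: scaleR_scaleC)
  show um: "x \<in> L \<Longrightarrow> - x \<in> L" for x using sc[of x "-1"] by (simp add: scaleC_minus_one)
  show "x \<in> L \<Longrightarrow> y \<in> L \<Longrightarrow> x - y \<in> L" using add[of x "- y"] um[of y] by simp
qed

lemma csubspace_Times: "csubspace A \<Longrightarrow> csubspace B \<Longrightarrow> csubspace (A \<times> B)"
  by (auto simp: csubspace_def scaleC_prod_def zero_prod_def)

lemma mk_op_sel [simp]:
  "src (mk_op A B f) = A" "tgt (mk_op A B f) = B"
  "x \<in> A \<Longrightarrow> app (mk_op A B f) x = f x"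
  by (simp_all add: mk_op_def)

lemma mk_op_bounded:
  assumes "csubspace A" "closed A" "csubspace B" "closed B"
    and "\<And>x. x \<in> A \<Longrightarrow> f x \<in> B"
    and "\<And>x y. x \<in> A \<Longrightarrow> y \<in> A \<Longrightarrow> f (x + y) = f x + f y"
    and "\<And>c x. x \<in> A \<Longrightarrow> f (c *\<^sub>C x) = c *\<^sub>C f x"
    and "\<And>x. x \<in> A \<Longrightarrow> norm (f x) \<le> C * norm x"
  shows "mk_op A B f \<in> bounded_ops A B"
  using assms unfolding bounded_ops_def mk_op_def by (auto simp: csubspaceD intro!: exI[of _ C])

lemma bounded_opsD:
  assumes "T \<in> bounded_ops A B"
  shows bops_src: "src T = A" and bops_tgt: "tgt T = B"
    and bops_csub: "csubspace A" "csubspace B" and bops_closed: "closed A" "closed B"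
    and bops_in: "x \<in> A \<Longrightarrow> app T x \<in> B"
    and bops_add: "x \<in> A \<Longrightarrow> y \<in> A \<Longrightarrow> app T (x + y) = app T x + app T y"
    and bops_scaleC: "x \<in> A \<Longrightarrow> app T (c *\<^sub>C x) = c *\<^sub>C app T x"
    and bops_scaleR: "x \<in> A \<Longrightarrow> app T (r *\<^sub>R x) = r *\<^sub>R app T x"
    and bops_zero: "app T 0 = 0"
    and bops_uminus: "x \<in> A \<Longrightarrow> app T (- x) = - app T x"
    and bops_diff: "x \<in> A \<Longrightarrow> y \<in> A \<Longrightarrow> app T (x - y) = app T x - app T y"
proof -
  show "src T = A" "tgt T = B" "csubspace B" "closed A" "closed B" and A: "csubspace A"
    and "x \<in> A \<Longrightarrow> app T x \<in> B"
    and add: "x \<in> A \<Longrightarrow> y \<in> A \<Longrightarrow> app T (x + y) = app T x + app T y"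
    and sc: "x \<in> A \<Longrightarrow> app T (c *\<^sub>C x) = c *\<^sub>C app T x" for x y c
    using assms by (auto simp: bounded_ops_def)
  show "x \<in> A \<Longrightarrow> app T (r *\<^sub>R x) = r *\<^sub>R app T x"
    using sc by (simp add: scaleR_scaleC)
  show "app T 0 = 0" using add[of 0 0] csubspace_zero[OF A] by simp
  show um: "x \<in> A \<Longrightarrow> app T (- x) = - app T x" for x
    using sc[of x "-1"] by (simp add: scaleC_minus_one)
  show "x \<in> A \<Longrightarrow> y \<in> A \<Longrightarrow> app T (x - y) = app T x - app T y"
    using add[of x "- y"] um[of y] csubspace_uminus[OF A, of y] by simp
qed

lemma bops_bound:
  assumes "T \<in> bounded_ops A B"
  obtains C where "C \<ge> 0" "\<And>x. x \<in> A \<Longrightarrow> norm (app T x) \<le> C * norm x"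
proof -
  obtain C where C: "\<And>x. x \<in> A \<Longrightarrow> norm (app T x) \<le> C * norm x"
    using assms unfolding bounded_ops_def by blast
  have "norm (app T x) \<le> max C 0 * norm x" if "x \<in> A" for x
    using C[OF that] by (rule order_trans) (simp add: mult_right_mono)
  then show thesis using that[of "max C 0"] by simp
qed

lemma bops_tendsto:
  assumes T: "T \<in> bounded_ops A B" and X: "X \<longlonglongrightarrow> x" "\<And>k. X k \<in> A" "x \<in> A"
  shows "(\<lambda>k. app T (X k)) \<longlonglongrightarrow> app T x"
proof -
  obtain C where C: "C \<ge> 0" "\<And>x. x \<in> A \<Longrightarrow> norm (app T x) \<le> C * norm x"
    using bops_bound[OF T] by blast
  have "norm (app T (X k) - app T x) \<le> norm (X k - x) * C" for k
    using C(2)[of "X k - x"] X T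
    by (simp add: bops_diff[OF T] csubspace_diff[OF bops_csub(1)[OF T]] mult.commute)
  then have "(\<lambda>k. app T (X k) - app T x) \<longlonglongrightarrow> 0"
    by (intro Lim_null_comparison[OF _ tendsto_mult_left_zero[OF
          tendsto_norm_zero[OF LIM_zero[OF X(1)]], of C]]) simp
  then show ?thesis by (rule LIM_zero_cancel)
qed

lemma bops_eqI:
  assumes "S \<in> bounded_ops A B" "T \<in> bounded_ops A B" "\<And>x. x \<in> A \<Longrightarrow> app S x = app T x"
  shows "S = T"
proof (rule oper.expand, intro conjI)
  have "app S x = app T x" for x
    using assms by (cases "x \<in> A") (auto simp: bounded_ops_def)
  then show "app S = app T" by blast
qed (use assms in \<open>auto simp: bounded_ops_def\<close>)

lemma op_id_bounded: "csubspace A \<Longrightarrow> closed A \<Longrightarrow> op_id A \<in> bounded_ops A A"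
  unfolding op_id_def by (rule mk_op_bounded[where C = 1]) auto

lemma op_zero_bounded:
  "csubspace A \<Longrightarrow> closed A \<Longrightarrow> csubspace B \<Longrightarrow> closed B \<Longrightarrow> op_zero A B \<in> bounded_ops A B"
  unfolding op_zero_def by (rule mk_op_bounded[where C = 0]) (auto simp: csubspaceD)

lemma op_comp_bounded:
  assumes S: "S \<in> bounded_ops B C" and T: "T \<in> bounded_ops A B"
  shows "S \<circ>\<^sub>o T \<in> bounded_ops A C"
proof -
  obtain a where a: "a \<ge> 0" "\<And>x. x \<in> A \<Longrightarrow> norm (app T x) \<le> a * norm x"
    using bops_bound[OF T] by blast
  obtain b where b: "b \<ge> 0" "\<And>x. x \<in> B \<Longrightarrow> norm (app S x) \<le> b * norm x"
    using bops_bound[OF S] by blast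
  have "norm (app S (app T x)) \<le> b * a * norm x" if "x \<in> A" for x
    using b(2)[OF bops_in[OF T that]] mult_left_mono[OF a(2)[OF that] b(1)] by simp
  then show ?thesis
    unfolding op_comp_def bops_src[OF T] bops_tgt[OF S]
    by (intro mk_op_bounded[where C = "b * a"])
       (simp_all add: bounded_opsD[OF T] bops_in[OF S] bops_add[OF S] bops_scaleC[OF S] bops_csub[OF S]
        bops_closed[OF S])
qed

lemma op_add_bounded:
  assumes S: "S \<in> bounded_ops A B" and T: "T \<in> bounded_ops A B"
  shows "S +\<^sub>o T \<in> bounded_ops A B"
proof -
  obtain a where a: "\<And>x. x \<in> A \<Longrightarrow> norm (app T x) \<le> a * norm x"
    using bops_bound[OF T] by blast
  obtain b where b: "\<And>x. x \<in> A \<Longrightarrow> norm (app S x) \<le> b * norm x"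
    using bops_bound[OF S] by blast
  have "norm (app S x + app T x) \<le> (b + a) * norm x" if "x \<in> A" for x
    using norm_triangle_le[OF add_mono[OF b[OF that] a[OF that]]] by (simp add: algebra_simps)
  then show ?thesis
    unfolding op_add_def bops_src[OF S] bops_tgt[OF S]
    by (intro mk_op_bounded[where C = "b + a"])
       (simp_all add: bounded_opsD[OF S] bounded_opsD[OF T] csubspace_add scaleC_add_right)
qed

lemma op_scale_bounded:
  assumes T: "T \<in> bounded_ops A B"
  shows "c *\<^sub>o T \<in> bounded_ops A B"
proof -
  obtain a where a: "\<And>x. x \<in> A \<Longrightarrow> norm (app T x) \<le> a * norm x"
    using bops_bound[OF T] by blast
  have "norm (c *\<^sub>C app T x) \<le> (cmod c * a) * norm x" if "x \<in> A" for x
    using mult_left_mono[OF a[OF that], of "cmod c"] by (simp add: norm_scaleC)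
  then show ?thesis
    unfolding op_scale_def bops_src[OF T] bops_tgt[OF T]
    by (intro mk_op_bounded[where C = "cmod c * a"])
       (simp_all add: bounded_opsD[OF T] csubspace_scaleC scaleC_add_right scaleC_scaleC mult.commute)
qed

lemma op_diff_bounded:
  assumes S: "S \<in> bounded_ops A B" and T: "T \<in> bounded_ops A B"
  shows "S -\<^sub>o T \<in> bounded_ops A B"
proof -
  have "S -\<^sub>o T = S +\<^sub>o (- 1) *\<^sub>o T"
    unfolding op_diff_def op_add_def op_scale_def mk_op_def bops_src[OF S] bops_src[OF T]
    by (auto simp: scaleC_minus_one)
  then show ?thesis using op_add_bounded[OF S op_scale_bounded[OF T]] by simp
qed

lemmas bounded_ops_intros = op_id_bounded op_zero_bounded op_comp_bounded op_add_bounded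
  op_scale_bounded op_diff_bounded

context
  notes [simp] = op_id_def op_zero_def op_comp_def op_add_def op_diff_def op_scale_def
begin

lemma op_id_simps [simp]:
  "src (op_id A) = A" "tgt (op_id A) = A" "x \<in> A \<Longrightarrow> app (op_id A) x = x"
  by simp_all

lemma op_zero_simps [simp]:
  "src (op_zero A B) = A" "tgt (op_zero A B) = B" "x \<in> A \<Longrightarrow> app (op_zero A B) x = 0"
  by simp_all

lemma op_comp_simps [simp]:
  "src (S \<circ>\<^sub>o T) = src T" "tgt (S \<circ>\<^sub>o T) = tgt S"
  "x \<in> src T \<Longrightarrow> app (S \<circ>\<^sub>o T) x = app S (app T x)"
  by simp_all

lemma op_add_simps [simp]:
  "src (S +\<^sub>o T) = src S" "tgt (S +\<^sub>o T) = tgt S"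
  "x \<in> src S \<Longrightarrow> app (S +\<^sub>o T) x = app S x + app T x"
  by simp_all

lemma op_diff_simps [simp]:
  "src (S -\<^sub>o T) = src S" "tgt (S -\<^sub>o T) = tgt S"
  "x \<in> src S \<Longrightarrow> app (S -\<^sub>o T) x = app S x - app T x"
  by simp_all

lemma op_scale_simps [simp]:
  "src (c *\<^sub>o T) = src T" "tgt (c *\<^sub>o T) = tgt T"
  "x \<in> src T \<Longrightarrow> app (c *\<^sub>o T) x = c *\<^sub>C app T x"
  by simp_all

end

lemma contractionsD:
  assumes "T \<in> contractions A B"
  shows contr_bounded: "T \<in> bounded_ops A B"
    and contr_norm: "x \<in> A \<Longrightarrow> norm (app T x) \<le> norm x"
  using assms by (auto simp: contractions_def)

lemma op_comp_contraction:
  assumes S: "S \<in> contractions B C" and T: "T \<in> contractions A B"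
  shows "S \<circ>\<^sub>o T \<in> contractions A C"
proof -
  note bS = contr_bounded[OF S] and bT = contr_bounded[OF T]
  have "norm (app S (app T x)) \<le> norm x" if "x \<in> A" for x
    using contr_norm[OF S bops_in[OF bT that]] contr_norm[OF T that] by linarith
  then show ?thesis using op_comp_bounded[OF bS bT]
    by (simp add: contractions_def bops_src[OF bT])
qed


section \<open>Inverses\<close>

lemma op_inv_eqI:
  assumes T: "T \<in> bounded_ops A B" and S: "S \<in> bounded_ops B A"
    and ST: "\<And>x. x \<in> A \<Longrightarrow> app S (app T x) = x" and TS: "\<And>y. y \<in> B \<Longrightarrow> app T (app S y) = y"
  shows "op_invertible T" "op_inv T = S"
proof -
  note [simp] = bops_src[OF T] bops_tgt[OF T] bops_src[OF S] bops_tgt[OF S]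
  note sub = bops_csub[OF T] bops_closed[OF T]
  have "is_op_inverse T S"
    unfolding is_op_inverse_def using S T sub
    by (auto intro!: bops_eqI[OF op_comp_bounded op_id_bounded] simp: ST TS)
  moreover have "S' = S" if "is_op_inverse T S'" for S'
  proof (rule bops_eqI)
    show S': "S' \<in> bounded_ops B A" and "S \<in> bounded_ops B A"
      using that S by (auto simp: is_op_inverse_def)
    fix y assume y: "y \<in> B"
    have "S' \<circ>\<^sub>o T = op_id A" using that by (simp add: is_op_inverse_def)
    then have "app (S' \<circ>\<^sub>o T) (app S y) = app S y" using bops_in[OF S y] by simp
    then show "app S' y = app S y" using bops_in[OF S y] TS[OF y] by simp
  qed
  ultimately show "op_inv T = S" unfolding op_inv_def by (rule the_equality)
  show "op_invertible T" unfolding op_invertible_def using T \<open>is_op_inverse T S\<close> by auto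
qed

lemma op_invertibleD:
  assumes "op_invertible T" and T: "T \<in> bounded_ops A B"
  shows "op_inv T \<in> bounded_ops B A" "x \<in> A \<Longrightarrow> app (op_inv T) (app T x) = x"
    "y \<in> B \<Longrightarrow> app T (app (op_inv T) y) = y"
proof -
  note [simp] = bops_src[OF T] bops_tgt[OF T]
  obtain S where S: "is_op_inverse T S" using assms by (auto simp: op_invertible_def)
  then have bS: "S \<in> bounded_ops B A" by (simp add: is_op_inverse_def)
  note [simp] = bops_src[OF bS]
  have 1: "app S (app T x) = x" if "x \<in> A" for x
    using S that op_comp_simps(3)[of x T S] by (simp add: is_op_inverse_def)
  have 2: "app T (app S x) = x" if "x \<in> B" for x
    using S that op_comp_simps(3)[of x S T] by (simp add: is_op_inverse_def)
  have "op_inv T = S" by (rule op_inv_eqI(2)[OF T bS 1 2])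
  then show "op_inv T \<in> bounded_ops B A" "x \<in> A \<Longrightarrow> app (op_inv T) (app T x) = x"
    "y \<in> B \<Longrightarrow> app T (app (op_inv T) y) = y"
    using bS 1 2 by auto
qed

text \<open>For \<open>y \<in> K\<close> the map \<open>x \<mapsto> y + z S x\<close> is a strict contraction of the complete
  space \<open>K\<close>, and its fixed point is the solution of \<open>(I - z S) x = y\<close>.\<close>

lemma id_minus_contraction_invertible:
  fixes S :: "('a::chilbert_space, 'a) oper"
  assumes S: "S \<in> contractions K K" and z: "cmod z < 1"
  shows "op_invertible (op_id K -\<^sub>o z *\<^sub>o S)"
proof -
  note bS = contr_bounded[OF S]
  note K = bops_csub(1)[OF bS] bops_closed(1)[OF bS]
  note [simp] = bops_src[OF bS]
  define A where "A = op_id K -\<^sub>o z *\<^sub>o S"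
  have bA: "A \<in> bounded_ops K K"
    unfolding A_def by (rule bounded_ops_intros bS K)+
  have appA: "app A x = x - z *\<^sub>C app S x" if "x \<in> K" for x
    using that by (simp add: A_def)
  have below: "(1 - cmod z) * norm x \<le> norm (app A x)" if "x \<in> K" for x
  proof -
    have "norm (z *\<^sub>C app S x) \<le> cmod z * norm x"
      by (simp add: norm_scaleC contr_norm[OF S that] mult_left_mono)
    then show ?thesis
      using norm_triangle_ineq2[of x "z *\<^sub>C app S x"] by (simp add: appA that algebra_simps)
  qed
  have inj: "x = y" if "x \<in> K" "y \<in> K" "app A x = app A y" for x y
  proof -
    have "(1 - cmod z) * norm (x - y) \<le> 0"
      using below[of "x - y"] that by (simp add: bops_diff[OF bA] csubspace_diff[OF K(1)])
    then show ?thesis using z by (simp add: mult_le_0_iff)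
  qed
  have ex: "\<exists>x\<in>K. app A x = y" if y: "y \<in> K" for y
  proof -
    have "\<exists>!x. x \<in> K \<and> y + z *\<^sub>C app S x = x"
    proof (rule Banach_fix)
      show "complete K" using K(2) by (simp add: complete_eq_closed)
      show "K \<noteq> {}" using y by blast
      show "0 \<le> cmod z" "cmod z < 1" using z by auto
      show "(\<lambda>x. y + z *\<^sub>C app S x) ` K \<subseteq> K"
        using y by (auto simp: csubspaceD[OF K(1)] bops_in[OF bS])
      fix u v assume uv: "u \<in> K" "v \<in> K"
      have "norm (app S (u - v)) \<le> norm (u - v)"
        using uv by (intro contr_norm[OF S]) (simp add: csubspaceD[OF K(1)])
      then show "dist (y + z *\<^sub>C app S u) (y + z *\<^sub>C app S v) \<le> cmod z * dist u v"
        using uv by (simp add: dist_norm scaleC_diff_right[symmetric] bops_diff[OF bS, symmetric]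
            norm_scaleC mult_left_mono)
    qed
    then show ?thesis by (metis appA add_diff_cancel_right')
  qed
  define f where "f y = (SOME x. x \<in> K \<and> app A x = y)" for y
  have f: "f y \<in> K" "app A (f y) = y" if "y \<in> K" for y
    using someI_ex[of "\<lambda>x. x \<in> K \<and> app A x = y"] ex[OF that] unfolding f_def by blast+
  have bf: "mk_op K K f \<in> bounded_ops K K"
  proof (rule mk_op_bounded[where C = "1 / (1 - cmod z)"])
    fix x y c assume x: "x \<in> K"
    show "f x \<in> K" using f x by blast
    show "f (x + y) = f x + f y" if y: "y \<in> K"
      using x y by - (rule inj, simp_all add: f bops_add[OF bA] csubspaceD[OF K(1)])
    show "f (c *\<^sub>C x) = c *\<^sub>C f x"
      using x by - (rule inj, simp_all add: f bops_scaleC[OF bA] csubspaceD[OF K(1)])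
    show "norm (f x) \<le> 1 / (1 - cmod z) * norm x"
      using below[OF f(1)[OF x]] f(2)[OF x] z by (simp add: field_simps)
  qed (use K in auto)
  have "f (app A x) = x" if "x \<in> K" for x
    using that bops_in[OF bA that] by - (rule inj, simp_all add: f)
  then have "op_invertible A"
    using f by (intro op_inv_eqI(1)[OF bA bf]) (auto simp: bops_in[OF bA])
  then show ?thesis by (simp add: A_def)
qed

text \<open>Write \<open>R\<^sub>0\<close> and \<open>R\<close> for the inverses of \<open>A\<^sub>0\<close> and \<open>A\<close>.  The resolvent identity
  \<open>R - R\<^sub>0 = z R\<^sub>0 E F R = z R E F R\<^sub>0\<close> shows by direct multiplication that \<open>I + z F R E\<close>
  is the inverse of \<open>I - z F R\<^sub>0 E\<close>; inserting this inverse and using the identity once more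
  gives the formula for \<open>R\<close>.\<close>

lemma inverse_of_perturbation:
  assumes A0: "A\<^sub>0 \<in> bounded_ops K K" "op_invertible A\<^sub>0"
    and E: "E \<in> bounded_ops L K" and F: "F \<in> bounded_ops K L"
    and A: "op_invertible A" "A = A\<^sub>0 -\<^sub>o z *\<^sub>o (E \<circ>\<^sub>o F)"
  defines "B \<equiv> op_id L -\<^sub>o z *\<^sub>o (F \<circ>\<^sub>o op_inv A\<^sub>0 \<circ>\<^sub>o E)"
  shows "op_invertible B"
    and "op_inv A = op_inv A\<^sub>0 +\<^sub>o z *\<^sub>o (op_inv A\<^sub>0 \<circ>\<^sub>o E \<circ>\<^sub>o op_inv B \<circ>\<^sub>o (F \<circ>\<^sub>o op_inv A\<^sub>0))"
proof -
  have bA: "A \<in> bounded_ops K K"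
    unfolding A(2) by (rule bounded_ops_intros A0 E F)+
  define R0 where "R0 = op_inv A\<^sub>0"
  define R where "R = op_inv A"
  define C where "C = op_id L +\<^sub>o z *\<^sub>o (F \<circ>\<^sub>o R \<circ>\<^sub>o E)"
  note iA0 = op_invertibleD[OF A0(2,1), folded R0_def]
  note iA = op_invertibleD[OF A(1) bA, folded R_def]
  note L = bops_csub(1)[OF E] bops_closed(1)[OF E] note K = bops_csub(2)[OF E]
  have bB: "B \<in> bounded_ops L L"
    unfolding B_def R0_def[symmetric] by (rule bounded_ops_intros E F iA0 L)+
  have bC: "C \<in> bounded_ops L L"
    unfolding C_def by (rule bounded_ops_intros E F iA L)+
  note [simp] = bops_src[OF A0(1)] bops_src[OF E] bops_src[OF F] bops_src[OF iA(1)]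
    bops_src[OF iA0(1)] bops_in[OF A0(1)] bops_in[OF E] bops_in[OF F] bops_in[OF iA(1)]
    bops_in[OF iA0(1)] bops_add[OF E] bops_add[OF F] bops_scaleC[OF E] bops_scaleC[OF F]
    bops_diff[OF E] bops_diff[OF F] bops_in[OF bC] bops_src[OF bC]
    bops_scaleC[OF iA(1)] bops_scaleC[OF iA0(1)] bops_add[OF iA0(1)] bops_add[OF iA(1)]
    csubspace_add[OF K] csubspace_scaleC[OF K] csubspace_diff[OF K]
    csubspace_add[OF L(1)] csubspace_scaleC[OF L(1)] csubspace_diff[OF L(1)]
  have appA: "app A x = app A\<^sub>0 x - z *\<^sub>C app E (app F x)" if "x \<in> K" for x
    using that by (simp add: A(2))
  have appB: "app B y = y - z *\<^sub>C app F (app R0 (app E y))" if "y \<in> L" for y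
    using that by (simp add: B_def R0_def[symmetric])
  have appC: "app C y = y + z *\<^sub>C app F (app R (app E y))" if "y \<in> L" for y
    using that by (simp add: C_def)
  have res1: "app R x = app R0 x + z *\<^sub>C app R0 (app E (app F (app R x)))" if x: "x \<in> K" for x
  proof -
    have "app A\<^sub>0 (app R x) = x + z *\<^sub>C app E (app F (app R x))"
      using appA[OF bops_in[OF iA(1) x]] iA(3)[OF x] by (simp add: algebra_simps)
    then have "app R0 (app A\<^sub>0 (app R x)) = app R0 (x + z *\<^sub>C app E (app F (app R x)))"
      by simp
    then show ?thesis using x by (simp add: iA0)
  qed
  have res2: "app R x = app R0 x + z *\<^sub>C app R (app E (app F (app R0 x)))" if x: "x \<in> K" for x
  proof -
    have "x = app A (app R0 x) + z *\<^sub>C app E (app F (app R0 x))"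
      using appA[OF bops_in[OF iA0(1) x]] iA0(3)[OF x] by (simp add: algebra_simps)
    then have "app R x = app R (app A (app R0 x) + z *\<^sub>C app E (app F (app R0 x)))" by simp
    then show ?thesis using x by (simp add: iA bops_in[OF bA])
  qed
  have "app C (app B y) = y" if y: "y \<in> L" for y
  proof -
    define u where "u = app R0 (app E y)"
    have u: "u \<in> K" using y by (simp add: u_def)
    have "app R (app E y) = u + z *\<^sub>C app R (app E (app F u))"
      using res2[of "app E y"] y by (simp add: u_def)
    moreover have "app C (app B y) = y - z *\<^sub>C app F u
        + z *\<^sub>C app F (app R (app E y) - z *\<^sub>C app R (app E (app F u)))"
      using y u by (simp add: appB appC u_def[symmetric] bops_diff[OF iA(1)])
    ultimately show ?thesis by simp
  qed
  moreover have "app B (app C y) = y" if y: "y \<in> L" for y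
  proof -
    define u where "u = app R (app E y)"
    have u: "u \<in> K" using y by (simp add: u_def)
    have "app R0 (app E y) = u - z *\<^sub>C app R0 (app E (app F u))"
      using res1[of "app E y"] y by (simp add: u_def eq_diff_eq)
    moreover have "app B (app C y) = y + z *\<^sub>C app F u
        - z *\<^sub>C app F (app R0 (app E y) + z *\<^sub>C app R0 (app E (app F u)))"
      using y u by (simp add: appB appC u_def[symmetric] del: bops_add[OF F])
    ultimately show ?thesis by simp
  qed
  ultimately have "op_invertible B" and BC: "op_inv B = C"
    using op_inv_eqI[OF bB bC] by auto
  then show "op_invertible B" by simp
  show "op_inv A = op_inv A\<^sub>0 +\<^sub>o z *\<^sub>o (op_inv A\<^sub>0 \<circ>\<^sub>o E \<circ>\<^sub>o op_inv B \<circ>\<^sub>o (F \<circ>\<^sub>o op_inv A\<^sub>0))"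
    unfolding R0_def[symmetric] R_def[symmetric] BC
  proof (rule bops_eqI)
    show "R \<in> bounded_ops K K" by (rule iA)
    show "R0 +\<^sub>o z *\<^sub>o (R0 \<circ>\<^sub>o E \<circ>\<^sub>o C \<circ>\<^sub>o (F \<circ>\<^sub>o R0)) \<in> bounded_ops K K"
      by (rule bounded_ops_intros iA0 E F bC)+
    fix x assume x: "x \<in> K"
    have "app C (app F (app R0 x)) = app F (app R x)"
      using x by (subst res2) (simp_all add: appC)
    then show "app R x = app (R0 +\<^sub>o z *\<^sub>o (R0 \<circ>\<^sub>o E \<circ>\<^sub>o C \<circ>\<^sub>o (F \<circ>\<^sub>o R0))) x"
      using x res1[OF x] by simp
  qed
qed


section \<open>Adjoints\<close>

lemma cinner_scaleC_right: "cinner x (c *\<^sub>C y) = cnj c * cinner x y" for x y :: "'a::complex_inner"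
  by (subst (1 2) cinner_commute) (simp add: cinner_scaleC_left)

lemma inner_i_i: "inner (\<i> *\<^sub>C x) (\<i> *\<^sub>C y) = inner x y" for x y :: "'a::complex_inner"
  by (simp add: Re_cinner[symmetric] cinner_scaleC_left cinner_scaleC_right)

lemma vanishing_linear_coefficient:
  fixes a b :: real
  assumes "\<And>t. 0 \<le> t\<^sup>2 * a + 2 * t * b"
  shows "b = 0"
proof (rule ccontr)
  assume "b \<noteq> 0"
  have a: "0 \<le> a" using assms[of 1] assms[of "-1"] by simp
  \<comment> \<open>The denominator is \<open>a + 1\<close> instead of \<open>a\<close> because \<open>a\<close> may be \<open>0\<close>.\<close>
  define t where "t = - b / (a + 1)"
  have b: "b = - (a + 1) * t" using a by (simp add: t_def field_simps)
  then have "t \<noteq> 0" using \<open>b \<noteq> 0\<close> by auto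
  have "t\<^sup>2 * a + 2 * t * b = - (a + 2) * t\<^sup>2"
    by (simp add: b power2_eq_square algebra_simps)
  also have "\<dots> < 0" using a \<open>t \<noteq> 0\<close> by (simp add: mult_neg_pos)
  finally show False using assms[of t] by simp
qed

text \<open>The representing vector is the minimiser of \<open>\<phi> x = \<parallel>x\<parallel>\<^sup>2 - 2 f x\<close>: a minimising sequence
  is Cauchy by the parallelogram law, and at the minimum the first variation
  \<open>2 (inner x u - f u)\<close> vanishes in every direction \<open>u\<close>.\<close>

lemma riesz_representation_on_subspace:
  fixes L :: "'a::chilbert_space set"
  assumes L: "csubspace L" "closed L"
    and add: "\<And>x y. x \<in> L \<Longrightarrow> y \<in> L \<Longrightarrow> f (x + y) = f x + f y"
    and scale: "\<And>r x. x \<in> L \<Longrightarrow> f (r *\<^sub>R x) = r * f x"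
    and bound: "\<And>x. x \<in> L \<Longrightarrow> \<bar>f x\<bar> \<le> C * norm x"
  obtains p where "p \<in> L" "\<And>u. u \<in> L \<Longrightarrow> f u = inner u p"
proof -
  define \<phi> where "\<phi> x = (norm x)\<^sup>2 - 2 * f x" for x
  have lower: "- C\<^sup>2 \<le> \<phi> x" if "x \<in> L" for x
  proof -
    have "0 \<le> (norm x - C)\<^sup>2" by simp
    then show ?thesis using abs_le_D1[OF bound[OF that]] by (simp add: \<phi>_def power2_diff algebra_simps)
  qed
  define m where "m = Inf (\<phi> ` L)"
  have "L \<noteq> {}" using csubspace_zero[OF L(1)] by blast
  have m: "m \<le> \<phi> x" if "x \<in> L" for x
    unfolding m_def using that lower by (intro cInf_lower bdd_belowI2[of _ "- C\<^sup>2"]) auto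
  have "\<exists>x\<in>L. \<phi> x < m + inverse (real (Suc k))" for k
    using cInf_lessD[of "\<phi> ` L" "m + inverse (real (Suc k))"] \<open>L \<noteq> {}\<close>
    by (auto simp: m_def[symmetric])
  then obtain X where X: "\<And>k. X k \<in> L" "\<And>k. \<phi> (X k) < m + inverse (real (Suc k))"
    by metis
  have par: "(norm (x - y))\<^sup>2 \<le> 2 * (\<phi> x - m) + 2 * (\<phi> y - m)" if "x \<in> L" "y \<in> L" for x y
  proof -
    have "f ((1/2) *\<^sub>R (x + y)) = (f x + f y) / 2"
      using that by (simp only: scale add csubspace_add[OF L(1)])
    then have "\<phi> ((1/2) *\<^sub>R (x + y)) = (norm (x + y))\<^sup>2 / 4 - (f x + f y)"
      by (simp only: \<phi>_def norm_scaleR) (simp add: power_divide power_mult_distrib add_divide_distrib)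
    moreover have "m \<le> \<phi> ((1/2) *\<^sub>R (x + y))"
      using that by (intro m) (simp add: csubspaceD[OF L(1)])
    moreover have "(norm (x + y))\<^sup>2 + (norm (x - y))\<^sup>2 = 2 * (norm x)\<^sup>2 + 2 * (norm y)\<^sup>2"
      by (simp add: power2_norm_eq_inner inner_add_left inner_add_right inner_diff_left
          inner_diff_right)
    ultimately show ?thesis unfolding \<phi>_def by argo
  qed
  have "Cauchy X"
  proof (rule metric_CauchyI)
    fix e :: real assume e: "0 < e"
    obtain M where M: "inverse (real (Suc M)) < e\<^sup>2 / 4"
      using reals_Archimedean[of "e\<^sup>2 / 4"] e by auto
    have small: "\<phi> (X i) - m < e\<^sup>2 / 4" if "i \<ge> M" for i
    proof -
      have "inverse (real (Suc i)) \<le> inverse (real (Suc M))"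
        using that by (auto intro!: le_imp_inverse_le)
      then show ?thesis using X(2)[of i] M by argo
    qed
    have "dist (X i) (X j) < e" if "i \<ge> M" "j \<ge> M" for i j
    proof -
      have "(norm (X i - X j))\<^sup>2 < e\<^sup>2"
        using par[OF X(1) X(1), of i j] small[OF that(1)] small[OF that(2)] by argo
      then show ?thesis using e by (simp add: dist_norm power2_less_imp_less)
    qed
    then show "\<exists>M. \<forall>i\<ge>M. \<forall>j\<ge>M. dist (X i) (X j) < e" by blast
  qed
  then obtain p where p: "X \<longlonglongrightarrow> p" using Cauchy_convergent convergent_def by blast
  have pL: "p \<in> L" using closed_sequentially[OF L(2) _ p] X(1) by blast
  have "(\<lambda>k. f (X k)) \<longlonglongrightarrow> f p"
  proof (rule LIM_zero_cancel, rule Lim_null_comparison)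
    have "f (X k) - f p = f (X k - p)" for k
      using add[of "X k - p" p] X(1) pL by (simp add: csubspaceD[OF L(1)])
    then show "\<forall>\<^sub>F k in sequentially. norm (f (X k) - f p) \<le> C * norm (X k - p)"
      using bound X(1) pL by (simp add: csubspaceD[OF L(1)])
    show "(\<lambda>k. C * norm (X k - p)) \<longlonglongrightarrow> 0"
      using tendsto_mult_left[OF tendsto_norm[OF tendsto_diff[OF p tendsto_const[of p]]], of C] by simp
  qed
  then have "(\<lambda>k. \<phi> (X k)) \<longlonglongrightarrow> \<phi> p"
    unfolding \<phi>_def by (intro tendsto_intros p)
  moreover have "(\<lambda>k. m + inverse (real (Suc k))) \<longlonglongrightarrow> m + 0"
    by (intro tendsto_intros LIMSEQ_inverse_real_of_nat)
  ultimately have "\<phi> p \<le> m + 0"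
    by (rule LIMSEQ_le) (use X(2) less_imp_le in blast)
  have "f u = inner u p" if u: "u \<in> L" for u
  proof -
    have "0 \<le> t\<^sup>2 * (norm u)\<^sup>2 + 2 * t * (inner u p - f u)" for t
    proof -
      have "\<phi> p \<le> \<phi> (p + t *\<^sub>R u)"
        using m[of "p + t *\<^sub>R u"] \<open>\<phi> p \<le> m + 0\<close> u pL by (simp add: csubspaceD[OF L(1)])
      moreover have "f (p + t *\<^sub>R u) = f p + t * f u"
        using u pL by (simp add: add scale csubspaceD[OF L(1)])
      moreover have "(norm (p + t *\<^sub>R u))\<^sup>2 = (norm p)\<^sup>2 + 2 * t * inner u p + t\<^sup>2 * (norm u)\<^sup>2"
        unfolding power2_norm_eq_inner
        by (simp add: inner_add_left inner_add_right inner_commute power2_eq_square algebra_simps)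
      ultimately show ?thesis by (simp add: \<phi>_def algebra_simps)
    qed
    then have "inner u p - f u = 0" by (rule vanishing_linear_coefficient)
    then show ?thesis by simp
  qed
  then show thesis using that pL by blast
qed

lemma inner_eqI_on_subspace:
  assumes "csubspace L" "x \<in> L" "y \<in> L" "\<And>u. u \<in> L \<Longrightarrow> inner u x = inner u y"
  shows "x = y"
proof -
  have "inner (x - y) (x - y) = 0"
    using assms(4)[of "x - y"] assms by (simp add: inner_diff_right csubspace_diff)
  then show ?thesis by simp
qed

text \<open>It suffices to test against the real inner product: \<open>A\<close> is invariant under multiplication by
  \<open>\<i>\<close>, which turns imaginary parts into real parts.\<close>

lemma adj_eqI:
  assumes T: "T \<in> bounded_ops A B" and y: "y \<in> B" and x: "x \<in> A"
    and eq: "\<And>u. u \<in> A \<Longrightarrow> inner (app T u) y = inner u x"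
  shows "app (adj T) y = x"
proof -
  have "cinner (app T u) y = cinner u x" if u: "u \<in> A" for u
  proof (rule complex_eqI)
    show "Re (cinner (app T u) y) = Re (cinner u x)" using eq[OF u] by (simp add: Re_cinner)
    show "Im (cinner (app T u) y) = Im (cinner u x)"
      using eq[of "\<i> *\<^sub>C u"] u by (simp add: Im_cinner bops_scaleC[OF T] csubspaceD[OF bops_csub(1)[OF T]])
  qed
  moreover have "x' = x" if "x' \<in> A" "\<forall>u\<in>A. cinner (app T u) y = cinner u x'" for x'
  proof (rule inner_eqI_on_subspace[OF bops_csub(1)[OF T] that(1) x])
    show "inner u x' = inner u x" if "u \<in> A" for u
      using \<open>\<forall>u\<in>A. cinner (app T u) y = cinner u x'\<close> eq[OF that] that Re_cinner by metis
  qed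
  ultimately have "(THE x. x \<in> A \<and> (\<forall>u\<in>A. cinner (app T u) y = cinner u x)) = x"
    using x by (intro the_equality) auto
  then show ?thesis
    using y by (simp add: adj_def bops_src[OF T] bops_tgt[OF T])
qed

lemma adj_inner:
  fixes T :: "('a::chilbert_space, 'b::chilbert_space) oper"
  assumes T: "T \<in> bounded_ops A B" and y: "y \<in> B"
  shows "app (adj T) y \<in> A" "u \<in> A \<Longrightarrow> inner (app T u) y = inner u (app (adj T) y)"
proof -
  obtain C where C: "\<And>x. x \<in> A \<Longrightarrow> norm (app T x) \<le> C * norm x"
    using bops_bound[OF T] by blast
  have "\<bar>inner (app T x) y\<bar> \<le> (C * norm y) * norm x" if "x \<in> A" for x
  proof -
    have "\<bar>inner (app T x) y\<bar> \<le> norm (app T x) * norm y" by (rule Cauchy_Schwarz_ineq2)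
    also have "\<dots> \<le> C * norm x * norm y" by (intro mult_right_mono C that) auto
    finally show ?thesis by (simp add: mult_ac)
  qed
  then obtain p where p: "p \<in> A" "\<And>u. u \<in> A \<Longrightarrow> inner (app T u) y = inner u p"
    by (rule riesz_representation_on_subspace[OF bops_csub(1)[OF T] bops_closed(1)[OF T], rotated 2])
       (auto simp: bops_add[OF T] bops_scaleR[OF T] inner_add_left)
  moreover have "app (adj T) y = p" by (rule adj_eqI[OF T y p])
  ultimately show "app (adj T) y \<in> A" "u \<in> A \<Longrightarrow> inner (app T u) y = inner u (app (adj T) y)"
    by auto
qed

lemma adj_norm_le:
  fixes T :: "('a::chilbert_space, 'b::chilbert_space) oper"
  assumes T: "T \<in> bounded_ops A B" and y: "y \<in> B"
    and C: "0 \<le> C" "\<And>x. x \<in> A \<Longrightarrow> norm (app T x) \<le> C * norm x"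
  shows "norm (app (adj T) y) \<le> C * norm y"
proof (cases "app (adj T) y = 0")
  case True
  then show ?thesis using C(1) by simp
next
  case False
  let ?x = "app (adj T) y"
  note x = adj_inner(1)[OF T y]
  have "norm ?x * norm ?x = inner (app T ?x) y"
    using adj_inner(2)[OF T y x] by (simp add: power2_norm_eq_inner flip: power2_eq_square)
  also have "\<dots> \<le> norm (app T ?x) * norm y" by (rule norm_cauchy_schwarz)
  also have "\<dots> \<le> C * norm ?x * norm y" by (intro mult_right_mono C(2) x) auto
  finally have "norm ?x * norm ?x \<le> (C * norm y) * norm ?x" by (simp add: mult_ac)
  then show ?thesis using False by simp
qed


lemma adj_bounded:
  fixes T :: "('a::chilbert_space, 'b::chilbert_space) oper"
  assumes T: "T \<in> bounded_ops A B"
  shows "adj T \<in> bounded_ops B A"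
proof -
  obtain C where C: "0 \<le> C" "\<And>x. x \<in> A \<Longrightarrow> norm (app T x) \<le> C * norm x"
    using bops_bound[OF T] by blast
  note adjT = adj_inner[OF T] and sub = bops_csub[OF T] bops_closed[OF T]
  have "adj T = mk_op B A (app (adj T))"
    by (simp add: adj_def mk_op_def bops_src[OF T] bops_tgt[OF T] fun_eq_iff)
  also have "\<dots> \<in> bounded_ops B A"
  proof (rule mk_op_bounded[OF sub(2,4,1,3), where C = C])
    fix x y c assume x: "x \<in> B"
    show "app (adj T) x \<in> A" "norm (app (adj T) x) \<le> C * norm x"
      using adjT(1)[OF x] adj_norm_le[OF T x C] by auto
    show "app (adj T) (x + y) = app (adj T) x + app (adj T) y" if y: "y \<in> B"
      using x y by (intro adj_eqI[OF T]) (simp_all add: adjT csubspaceD sub inner_add_right)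
    show "app (adj T) (c *\<^sub>C x) = c *\<^sub>C app (adj T) x"
    proof (intro adj_eqI[OF T])
      fix u assume u: "u \<in> A"
      have move: "inner w (c *\<^sub>C v) = inner (cnj c *\<^sub>C w) v" for w v :: "'x::complex_inner"
        by (simp add: Re_cinner[symmetric] cinner_scaleC_left cinner_scaleC_right)
      show "inner (app T u) (c *\<^sub>C x) = inner u (c *\<^sub>C app (adj T) x)"
        using u x by (simp add: move adjT(2)[symmetric] bops_scaleC[OF T, symmetric] csubspaceD sub)
    qed (use x in \<open>simp_all add: adjT csubspaceD sub\<close>)
  qed
  finally show ?thesis .
qed

lemma adj_adj:
  fixes T :: "('a::chilbert_space, 'b::chilbert_space) oper"
  assumes T: "T \<in> bounded_ops A B"
  shows "adj (adj T) = T"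
proof (rule bops_eqI[OF adj_bounded[OF adj_bounded[OF T]] T])
  fix x assume x: "x \<in> A"
  show "app (adj (adj T)) x = app T x"
    using x by (intro adj_eqI[OF adj_bounded[OF T]])
      (simp_all add: bops_in[OF T] adj_inner(2)[OF T, symmetric] inner_commute)
qed

lemma adj_contraction:
  fixes T :: "('a::chilbert_space, 'b::chilbert_space) oper"
  assumes T: "T \<in> contractions A B"
  shows "adj T \<in> contractions B A"
  using adj_bounded[OF contr_bounded[OF T]] adj_norm_le[OF contr_bounded[OF T], where C = 1]
    contr_norm[OF T] by (auto simp: contractions_def)


section \<open>Positive square roots\<close>

definition symmetric_op :: "('a::complex_inner, 'a) oper \<Rightarrow> bool" where
  "symmetric_op A \<longleftrightarrow> (\<forall>x\<in>src A. \<forall>y\<in>src A. inner (app A x) y = inner x (app A y))"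

text \<open>In a complex space, positivity of the quadratic form forces symmetry: since
  \<open>inner (A (\<i> x)) x = - Im (cinner (A x) x)\<close> vanishes, the form \<open>inner (A (\<i> x)) y\<close> is
  skew-symmetric.\<close>

lemma positive_op_iff:
  "positive_op A \<longleftrightarrow> A \<in> bounded_ops (src A) (src A) \<and> symmetric_op A \<and>
     (\<forall>x\<in>src A. 0 \<le> inner (app A x) x)"
proof (cases "A \<in> bounded_ops (src A) (src A)")
  case bA: True
  note sub = csubspaceD[OF bops_csub(1)[OF bA]]
  have "symmetric_op A" if real: "\<And>x. x \<in> src A \<Longrightarrow> Im (cinner (app A x) x) = 0"
    unfolding symmetric_op_def
  proof (intro ballI)
    fix x y assume xy: "x \<in> src A" "y \<in> src A"
    have diag: "inner (\<i> *\<^sub>C app A u) u = 0" if "u \<in> src A" for u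
      using real[OF that] by (simp add: Im_cinner)
    define v where "v = - (\<i> *\<^sub>C x)"
    have v: "v \<in> src A" and iv: "\<i> *\<^sub>C v = x"
      using xy by (simp_all add: v_def sub scaleC_minus_right scaleC_scaleC scaleC_minus_one)
    have "inner (\<i> *\<^sub>C app A (v + y)) (v + y) = 0" using v xy by (intro diag sub)
    then have "inner (\<i> *\<^sub>C app A v) y = - inner (\<i> *\<^sub>C app A y) v"
      using v xy by (simp add: bops_add[OF bA] scaleC_add_right inner_add_left inner_add_right diag)
    also have "\<dots> = inner (\<i> *\<^sub>C app A y) (\<i> *\<^sub>C x)" by (simp add: v_def)
    finally show "inner (app A x) y = inner x (app A y)"
      using v by (simp add: bops_scaleC[OF bA, symmetric] iv inner_i_i inner_commute)
  qed
  moreover have "Im (cinner (app A x) x) = 0" if "symmetric_op A" "x \<in> src A" for x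
  proof -
    have "inner (\<i> *\<^sub>C app A x) x = inner (\<i> *\<^sub>C x) (app A x)"
      using that by (simp add: symmetric_op_def sub bops_scaleC[OF bA, symmetric])
    moreover have "Im (cinner (app A x) x) = - Im (cinner x (app A x))"
      by (subst cinner_commute) simp
    ultimately show ?thesis unfolding Im_cinner by simp
  qed
  ultimately show ?thesis
    using bA by (auto simp: positive_op_def complex_nonneg_Reals_iff Re_cinner)
qed (simp add: positive_op_def)

text \<open>Minimality of the form at \<open>x\<close>: its first variation in the direction \<open>A x\<close> is
  \<open>2 \<parallel>A x\<parallel>\<^sup>2\<close> and must vanish.\<close>

lemma positive_op_kernel:
  assumes A: "positive_op A" and x: "x \<in> src A" "inner (app A x) x = 0"
  shows "app A x = 0"
proof -
  have bA: "A \<in> bounded_ops (src A) (src A)" and sym: "symmetric_op A"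
    and pos: "\<And>x. x \<in> src A \<Longrightarrow> 0 \<le> inner (app A x) x"
    using A by (auto simp: positive_op_iff)
  define w where "w = app A x"
  have w: "w \<in> src A" using bops_in[OF bA] x by (simp add: w_def)
  note sub = csubspaceD[OF bops_csub(1)[OF bA]]
  have "0 \<le> t\<^sup>2 * inner (app A w) w + 2 * t * inner w w" for t
  proof -
    have "inner (app A w) x = inner w w" using sym x w by (simp add: symmetric_op_def w_def)
    moreover have "0 \<le> inner (app A (x + t *\<^sub>R w)) (x + t *\<^sub>R w)"
      using x w by (intro pos sub)
    ultimately show ?thesis
      using x w by (simp add: bops_add[OF bA] bops_scaleR[OF bA] sub inner_add_left inner_add_right
          w_def[symmetric] power2_eq_square algebra_simps)
  qed
  then have "inner w w = 0" by (rule vanishing_linear_coefficient)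
  then show ?thesis by (simp add: w_def)
qed

text \<open>A fixed point \<open>Y\<close> of the iteration satisfies \<open>2 Y = X + Y\<^sup>2\<close>, that is,
  \<open>(I - Y)\<^sup>2 = I - X\<close>.  Starting at \<open>0\<close>, every iterate is a polynomial in \<open>X\<close>.\<close>

primrec sqrt_approx :: "('a::complex_inner, 'a) oper \<Rightarrow> nat \<Rightarrow> ('a, 'a) oper" where
  "sqrt_approx X 0 = op_zero (src X) (src X)"
| "sqrt_approx X (Suc k) = (1/2) *\<^sub>o (X +\<^sub>o sqrt_approx X k \<circ>\<^sub>o sqrt_approx X k)"

text \<open>The same iteration for the number \<open>X = 1\<close>, which dominates the operator iteration for every
  contraction \<open>X\<close>.\<close>

primrec scalar_approx :: "nat \<Rightarrow> real" where
  "scalar_approx 0 = 0"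
| "scalar_approx (Suc k) = (1 + (scalar_approx k)\<^sup>2) / 2"

lemma scalar_approx_bounds: "0 \<le> scalar_approx k" "scalar_approx k \<le> 1"
proof -
  have "0 \<le> scalar_approx k \<and> scalar_approx k \<le> 1"
    by (induction k) (auto simp: power_le_one)
  then show "0 \<le> scalar_approx k" "scalar_approx k \<le> 1" by auto
qed

lemma scalar_approx_mono: "scalar_approx k \<le> scalar_approx (Suc k)"
  using zero_le_power2[of "scalar_approx k - 1"] by (simp add: power2_diff)

lemma scalar_approx_convergent: "convergent scalar_approx"
  by (intro Bseq_monoseq_convergent BseqI'[of _ 1] mono_SucI1 allI scalar_approx_mono)
     (auto simp: scalar_approx_bounds)

lemma sqrt_approx_bounded:
  assumes "X \<in> bounded_ops H H"
  shows "sqrt_approx X k \<in> bounded_ops H H"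
  using assms
  by (induction k) (auto simp: bops_src intro!: bounded_ops_intros bops_csub bops_closed)

lemma sqrt_approx_Suc_app:
  assumes "X \<in> bounded_ops H H" "x \<in> H"
  shows "app (sqrt_approx X (Suc k)) x =
    (1/2) *\<^sub>R (app X x + app (sqrt_approx X k) (app (sqrt_approx X k) x))"
  using assms sqrt_approx_bounded[OF assms(1), of k] scaleC_of_real[of "1/2"]
  by (simp add: bops_src)

text \<open>Since \<open>Y\<^sub>k\<^sub>+\<^sub>1\<close> is built from \<open>X\<close> and \<open>Y\<^sub>k\<close> by products and linear
  combinations, any intertwiner of \<open>X\<close> and \<open>X'\<close> passes through the whole iteration.  With \<open>X' = X\<close>
  this gives that the iterates commute with each other.\<close>

lemma sqrt_approx_intertwine:
  assumes X: "X \<in> bounded_ops H H" and X': "X' \<in> bounded_ops H' H'" and R: "R \<in> bounded_ops H H'"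
    and comm: "\<And>x. x \<in> H \<Longrightarrow> app R (app X x) = app X' (app R x)"
    and x: "x \<in> H"
  shows "app R (app (sqrt_approx X k) x) = app (sqrt_approx X' k) (app R x)"
  using x
proof (induction k arbitrary: x)
  case 0
  then show ?case
    by (simp add: bops_src[OF X] bops_src[OF X'] bops_in[OF R] bops_zero[OF R])
next
  case (Suc k)
  note Y = bops_in[OF sqrt_approx_bounded[OF X]]
  show ?case
    using Suc.prems by (simp add: sqrt_approx_Suc_app[OF X] sqrt_approx_Suc_app[OF X'] bops_in[OF R]
        Suc.IH Y bops_in[OF X] comm csubspaceD[OF bops_csub(1)[OF X]] bops_scaleR[OF R] bops_add[OF R]
        del: sqrt_approx.simps)
qed

lemma sqrt_approx_commute:
  assumes X: "X \<in> bounded_ops H H" and x: "x \<in> H"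
  shows "app (sqrt_approx X j) (app (sqrt_approx X k) x) =
    app (sqrt_approx X k) (app (sqrt_approx X j) x)"
proof (rule sqrt_approx_intertwine[OF X X sqrt_approx_bounded[OF X] _ x])
  show "app (sqrt_approx X j) (app X y) = app X (app (sqrt_approx X j) y)" if "y \<in> H" for y
    using sqrt_approx_intertwine[OF X X X _ that] by simp
qed

text \<open>In the next two lemmas the operator iteration is compared with the scalar one.  For the
  differences, the \<open>Y\<^sub>k\<close> commute, so \<open>Y\<^sub>k\<^sub>+\<^sub>2 - Y\<^sub>k\<^sub>+\<^sub>1 = (1/2) (Y\<^sub>k\<^sub>+\<^sub>1 - Y\<^sub>k) (Y\<^sub>k\<^sub>+\<^sub>1 + Y\<^sub>k)\<close>, and the scalar
  differences satisfy the same recursion.\<close>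

lemma sqrt_approx_norm:
  assumes X: "X \<in> contractions H H" and x: "x \<in> H"
  shows "norm (app (sqrt_approx X k) x) \<le> scalar_approx k * norm x"
  using x
proof (induction k arbitrary: x)
  case 0
  then show ?case by (simp add: bops_src[OF contr_bounded[OF X]])
next
  case (Suc k)
  let ?Y = "app (sqrt_approx X k)"
  note bX = contr_bounded[OF X]
  have Yx: "?Y x \<in> H" using bops_in[OF sqrt_approx_bounded[OF bX] Suc.prems] .
  have "norm (?Y (?Y x)) \<le> scalar_approx k * norm (?Y x)" by (rule Suc.IH[OF Yx])
  also have "\<dots> \<le> scalar_approx k * (scalar_approx k * norm x)"
    by (intro mult_left_mono Suc scalar_approx_bounds)
  finally have "norm (app X x + ?Y (?Y x)) \<le> norm x + scalar_approx k * (scalar_approx k * norm x)"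
    by (intro norm_triangle_le add_mono contr_norm[OF X Suc.prems])
  then show ?case
    unfolding sqrt_approx_Suc_app[OF bX Suc.prems] norm_scaleR
    by (simp add: power2_eq_square distrib_right mult.assoc)
qed

lemma sqrt_approx_step_norm:
  assumes X: "X \<in> contractions H H" and x: "x \<in> H"
  shows "norm (app (sqrt_approx X (Suc k)) x - app (sqrt_approx X k) x)
    \<le> (scalar_approx (Suc k) - scalar_approx k) * norm x"
  using x
proof (induction k arbitrary: x)
  case 0
  then show ?case using sqrt_approx_norm[OF X 0, of "Suc 0"]
    by (simp add: bops_src[OF contr_bounded[OF X]])
next
  case (Suc k)
  note bX = contr_bounded[OF X]
  note Y = sqrt_approx_bounded[OF bX] and sub = csubspaceD[OF bops_csub(1)[OF bX]]
  let ?Y = "app (sqrt_approx X k)" and ?Y1 = "app (sqrt_approx X (Suc k))"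
  let ?y = "scalar_approx k" and ?y1 = "scalar_approx (Suc k)"
  define u where "u = ?Y1 x + ?Y x"
  have mem: "?Y x \<in> H" "?Y1 x \<in> H" by (rule bops_in[OF Y Suc.prems])+
  then have u: "u \<in> H" by (simp add: u_def sub del: sqrt_approx.simps)
  have "app (sqrt_approx X (Suc (Suc k))) x - ?Y1 x =
      (1/2) *\<^sub>R (app X x + ?Y1 (?Y1 x)) - (1/2) *\<^sub>R (app X x + ?Y (?Y x))"
    using sqrt_approx_Suc_app[OF bX Suc.prems, of "Suc k"] sqrt_approx_Suc_app[OF bX Suc.prems, of k]
    by (rule arg_cong2)
  also have "\<dots> = (1/2) *\<^sub>R (?Y1 (?Y1 x) - ?Y (?Y x))"
    by (simp add: scaleR_diff_right[symmetric] del: sqrt_approx.simps)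
  also have "?Y1 (?Y1 x) - ?Y (?Y x) = ?Y1 u - ?Y u"
    using mem sqrt_approx_commute[OF bX Suc.prems, of k "Suc k"]
    by (simp add: u_def bops_add[OF Y] del: sqrt_approx.simps)
  finally have "norm (app (sqrt_approx X (Suc (Suc k))) x - ?Y1 x) = norm (?Y1 u - ?Y u) / 2"
    by simp
  also have "norm (?Y1 u - ?Y u) \<le> (?y1 - ?y) * norm u" by (rule Suc.IH[OF u])
  also have "\<dots> \<le> (?y1 - ?y) * ((?y1 + ?y) * norm x)"
  proof (intro mult_left_mono)
    show "norm u \<le> (?y1 + ?y) * norm x"
      unfolding u_def distrib_right
      by (intro norm_triangle_le add_mono sqrt_approx_norm[OF X Suc.prems])
  qed (use scalar_approx_mono[of k] in linarith)
  also have "(?y1 - ?y) * ((?y1 + ?y) * norm x) / 2 = (scalar_approx (Suc (Suc k)) - ?y1) * norm x"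
    by (simp add: power2_eq_square field_simps)
  finally show ?case by simp
qed


instance chilbert_space \<subseteq> banach ..

text \<open>Not the square root itself: for a symmetric contraction \<open>X\<close>, the positive square root of \<open>I - X\<close> is \<open>I - sqrt_limit X\<close>.\<close>

definition sqrt_limit :: "('a::complex_inner, 'a) oper \<Rightarrow> ('a, 'a) oper" where
  "sqrt_limit X = mk_op (src X) (src X) (\<lambda>x. lim (\<lambda>k. app (sqrt_approx X k) x))"

text \<open>The steps are bounded by the steps of the convergent scalar iteration, whose sum telescopes.\<close>

lemma sqrt_approx_LIMSEQ:
  fixes X :: "('a::chilbert_space, 'a) oper"
  assumes X: "X \<in> contractions H H" and x: "x \<in> H"
  shows "(\<lambda>k. app (sqrt_approx X k) x) \<longlonglongrightarrow> app (sqrt_limit X) x"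
proof -
  have "summable (\<lambda>k. app (sqrt_approx X (Suc k)) x - app (sqrt_approx X k) x)"
  proof (rule summable_comparison_test')
    obtain l where l: "scalar_approx \<longlonglongrightarrow> l" using scalar_approx_convergent convergent_def by blast
    show "summable (\<lambda>k. (scalar_approx (Suc k) - scalar_approx k) * norm x)"
      by (intro summable_mult2 sums_summable[OF telescope_sums[OF l]])
  qed (rule sqrt_approx_step_norm[OF X x])
  then have "convergent (\<lambda>n. \<Sum>k<n. app (sqrt_approx X (Suc k)) x - app (sqrt_approx X k) x)"
    by (simp add: summable_iff_convergent)
  moreover have "(\<Sum>k<n. app (sqrt_approx X (Suc k)) x - app (sqrt_approx X k) x) =
      app (sqrt_approx X n) x" for n
    unfolding sum_lessThan_telescope[of "\<lambda>k. app (sqrt_approx X k) x"]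
    using x by (simp add: bops_src[OF contr_bounded[OF X]])
  ultimately have "convergent (\<lambda>k. app (sqrt_approx X k) x)" by simp
  then show ?thesis
    using x by (simp add: sqrt_limit_def bops_src[OF contr_bounded[OF X]] convergent_LIMSEQ_iff)
qed

lemma sqrt_limit_contraction:
  fixes X :: "('a::chilbert_space, 'a) oper"
  assumes X: "X \<in> contractions H H"
  shows "sqrt_limit X \<in> contractions H H"
proof -
  note bX = contr_bounded[OF X]
  note L = sqrt_approx_LIMSEQ[OF X] and Y = sqrt_approx_bounded[OF bX]
  note sub = csubspaceD[OF bops_csub(1)[OF bX]]
  have norm: "norm (app (sqrt_limit X) x) \<le> norm x" if "x \<in> H" for x
  proof (rule LIMSEQ_le_const2[OF tendsto_norm[OF L[OF that]]])
    have "norm (app (sqrt_approx X k) x) \<le> norm x" for k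
      using sqrt_approx_norm[OF X that, of k]
        mult_right_mono[OF scalar_approx_bounds(2)[of k] norm_ge_zero[of x]] by simp
    then show "\<exists>N. \<forall>k\<ge>N. norm (app (sqrt_approx X k) x) \<le> norm x" by blast
  qed
  have "sqrt_limit X = mk_op H H (app (sqrt_limit X))"
    by (simp add: sqrt_limit_def mk_op_def bops_src[OF bX] fun_eq_iff)
  also have "\<dots> \<in> bounded_ops H H"
  proof (rule mk_op_bounded[where C = 1])
    fix x y c assume x: "x \<in> H"
    show "app (sqrt_limit X) x \<in> H"
      using closed_sequentially[OF bops_closed(1)[OF bX] _ L[OF x]] bops_in[OF Y x] by blast
    show "app (sqrt_limit X) (x + y) = app (sqrt_limit X) x + app (sqrt_limit X) y" if y: "y \<in> H"
      using LIMSEQ_unique[OF L[of "x + y"] tendsto_add[OF L[OF x] L[OF y], folded bops_add[OF Y x y]]]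
        x y by (simp add: sub bops_add[OF Y])
    from bounded_linear.tendsto[OF bounded_linear_scaleC L[OF x]]
    show "app (sqrt_limit X) (c *\<^sub>C x) = c *\<^sub>C app (sqrt_limit X) x"
      using LIMSEQ_unique[OF L[of "c *\<^sub>C x"]] x by (simp add: sub bops_scaleC[OF Y])
  qed (use norm bops_csub[OF bX] bops_closed[OF bX] in auto)
  finally show ?thesis using norm by (simp add: contractions_def)
qed

lemma sqrt_limit_symmetric:
  fixes X :: "('a::chilbert_space, 'a) oper"
  assumes X: "X \<in> contractions H H" and sym: "symmetric_op X"
  shows "symmetric_op (sqrt_limit X)"
proof -
  note bX = contr_bounded[OF X]
  note Y = sqrt_approx_bounded[OF bX] and L = sqrt_approx_LIMSEQ[OF X]
  have "inner (app (sqrt_approx X k) x) y = inner x (app (sqrt_approx X k) y)"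
    if "x \<in> H" "y \<in> H" for k x y
    using that
  proof (induction k arbitrary: x y)
    case 0
    then show ?case by (simp add: bops_src[OF bX])
  next
    case (Suc k)
    have "inner (app X x) y = inner x (app X y)"
      using sym Suc.prems by (simp add: symmetric_op_def bops_src[OF bX])
    then show ?case
      using Suc.prems Suc.IH bops_in[OF Y]
      by (simp add: sqrt_approx_Suc_app[OF bX] inner_add_left inner_add_right del: sqrt_approx.simps)
  qed
  note sym_k = this
  show ?thesis
    unfolding symmetric_op_def
  proof (intro ballI)
    fix x y assume "x \<in> src (sqrt_limit X)" "y \<in> src (sqrt_limit X)"
    then have xy: "x \<in> H" "y \<in> H" by (simp_all add: sqrt_limit_def bops_src[OF bX])
    show "inner (app (sqrt_limit X) x) y = inner x (app (sqrt_limit X) y)"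
      using tendsto_inner[OF L[OF xy(1)] tendsto_const[of y]]
        tendsto_inner[OF tendsto_const[of x] L[OF xy(2)]]
      unfolding sym_k[OF xy] by (rule LIMSEQ_unique)
  qed
qed

text \<open>This is the limit of the recursion \<open>Y\<^sub>k\<^sub>+\<^sub>1 = (1/2) (X + Y\<^sub>k\<^sup>2)\<close>, that is,
  \<open>(I - Y)\<^sup>2 = I - X\<close>.\<close>

lemma sqrt_limit_equation:
  fixes X :: "('a::chilbert_space, 'a) oper"
  assumes X: "X \<in> contractions H H" and x: "x \<in> H"
  shows "2 *\<^sub>R app (sqrt_limit X) x = app X x + app (sqrt_limit X) (app (sqrt_limit X) x)"
proof -
  note bX = contr_bounded[OF X]
  note L = sqrt_approx_LIMSEQ[OF X] and Y = sqrt_approx_bounded[OF bX]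
  note sub = csubspaceD[OF bops_csub(1)[OF bX]]
  let ?Y = "\<lambda>k. app (sqrt_approx X k)" and ?Z = "app (sqrt_limit X)"
  have Zx: "?Z x \<in> H" using bops_in[OF contr_bounded[OF sqrt_limit_contraction[OF X]] x] .
  have "(\<lambda>k. ?Y k (?Y k x) - ?Y k (?Z x)) \<longlonglongrightarrow> 0"
  proof (rule Lim_null_comparison)
    have "norm (?Y k (?Y k x) - ?Y k (?Z x)) \<le> norm (?Y k x - ?Z x)" for k
    proof -
      have w: "?Y k x - ?Z x \<in> H" using bops_in[OF Y x] Zx by (intro sub)
      show ?thesis
        using sqrt_approx_norm[OF X w, of k] bops_in[OF Y x] Zx
          mult_right_mono[OF scalar_approx_bounds(2)[of k] norm_ge_zero[of "?Y k x - ?Z x"]]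
        by (simp add: bops_diff[OF Y])
    qed
    then show "\<forall>\<^sub>F k in sequentially. norm (?Y k (?Y k x) - ?Y k (?Z x)) \<le> norm (?Y k x - ?Z x)"
      by simp
    show "(\<lambda>k. norm (?Y k x - ?Z x)) \<longlonglongrightarrow> 0"
      using tendsto_norm_zero[OF LIM_zero[OF L[OF x]]] .
  qed
  from tendsto_add[OF this L[OF Zx]]
  have "(\<lambda>k. ?Y k (?Y k x)) \<longlonglongrightarrow> ?Z (?Z x)" by simp
  then have "(\<lambda>k. (1/2) *\<^sub>R (app X x + ?Y k (?Y k x))) \<longlonglongrightarrow> (1/2) *\<^sub>R (app X x + ?Z (?Z x))"
    by (intro tendsto_intros)
  then have "(\<lambda>k. ?Y (Suc k) x) \<longlonglongrightarrow> (1/2) *\<^sub>R (app X x + ?Z (?Z x))"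
    unfolding sqrt_approx_Suc_app[OF bX x] .
  then have "?Z x = (1/2) *\<^sub>R (app X x + ?Z (?Z x))"
    using LIMSEQ_unique LIMSEQ_Suc[OF L[OF x]] by blast
  then show ?thesis by (metis (no_types) scaleR_scaleR scaleR_one nonzero_eq_divide_eq
        mult.commute zero_neq_numeral times_divide_eq_right mult_1_right)
qed

lemma sqrt_limit_intertwine:
  fixes X :: "('a::chilbert_space, 'a) oper" and X' :: "('b::chilbert_space, 'b) oper"
  assumes X: "X \<in> contractions H H" and X': "X' \<in> contractions H' H'" and R: "R \<in> bounded_ops H H'"
    and comm: "\<And>x. x \<in> H \<Longrightarrow> app R (app X x) = app X' (app R x)"
    and x: "x \<in> H"
  shows "app R (app (sqrt_limit X) x) = app (sqrt_limit X') (app R x)"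
proof -
  note bX = contr_bounded[OF X] and bX' = contr_bounded[OF X']
  have "(\<lambda>k. app R (app (sqrt_approx X k) x)) \<longlonglongrightarrow> app R (app (sqrt_limit X) x)"
    by (rule bops_tendsto[OF R sqrt_approx_LIMSEQ[OF X x] bops_in[OF sqrt_approx_bounded[OF bX] x]
          bops_in[OF contr_bounded[OF sqrt_limit_contraction[OF X]] x]])
  moreover have "(\<lambda>k. app R (app (sqrt_approx X k) x)) \<longlonglongrightarrow> app (sqrt_limit X') (app R x)"
  proof -
    have "app R (app (sqrt_approx X k) x) = app (sqrt_approx X' k) (app R x)" for k
      by (rule sqrt_approx_intertwine[OF bX bX' R _ x]) (rule comm)
    then show ?thesis using sqrt_approx_LIMSEQ[OF X' bops_in[OF R x]] by simp
  qed
  ultimately show ?thesis by (rule LIMSEQ_unique)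
qed

text \<open>Let \<open>C = I - sqrt_limit X\<close>.  A positive \<open>B\<close> with \<open>B\<^sup>2 = I - X\<close> commutes with \<open>X\<close>, hence
  with \<open>C\<close>, so \<open>(B + C) (B - C) = B\<^sup>2 - C\<^sup>2 = 0\<close>.  For \<open>v = (B - C) x\<close> the nonnegative numbers
  \<open>inner (B v) v\<close> and \<open>inner (C v) v\<close> therefore add up to zero, whence \<open>B v = C v = 0\<close> and
  \<open>\<parallel>v\<parallel>\<^sup>2 = inner ((B - C) v) x = 0\<close>.\<close>

lemma op_sqrt_id_minus:
  fixes X :: "('a::chilbert_space, 'a) oper"
  assumes X: "X \<in> contractions H H" and sym: "symmetric_op X"
  shows "op_sqrt (op_id H -\<^sub>o X) = op_id H -\<^sub>o sqrt_limit X"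
    and "positive_op (op_id H -\<^sub>o sqrt_limit X)"
    and "(op_id H -\<^sub>o sqrt_limit X) \<circ>\<^sub>o (op_id H -\<^sub>o sqrt_limit X) = op_id H -\<^sub>o X"
proof -
  note bX = contr_bounded[OF X]
  note cY = sqrt_limit_contraction[OF X]
  note bY = contr_bounded[OF cY]
  note H = bops_csub(1)[OF bX] bops_closed(1)[OF bX] and sub = csubspaceD[OF bops_csub(1)[OF bX]]
  define C where "C = op_id H -\<^sub>o sqrt_limit X"
  have bC: "C \<in> bounded_ops H H" unfolding C_def by (rule bounded_ops_intros bY H)+
  note [simp] = bops_src[OF bX] bops_src[OF bY] bops_src[OF bC] bops_in[OF bY] bops_in[OF bC]
  have appC: "app C x = x - app (sqrt_limit X) x" if "x \<in> H" for x
    using that by (simp add: C_def)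
  show posC: "positive_op C"
    unfolding positive_op_iff
  proof (intro conjI ballI)
    show "symmetric_op C"
      using sqrt_limit_symmetric[OF X sym]
      by (simp add: symmetric_op_def appC inner_diff_left inner_diff_right)
    fix x assume x: "x \<in> src C"
    have "inner (app (sqrt_limit X) x) x \<le> norm (app (sqrt_limit X) x) * norm x"
      by (rule norm_cauchy_schwarz)
    also have "\<dots> \<le> norm x * norm x" using x by (intro mult_right_mono contr_norm[OF cY]) auto
    finally show "0 \<le> inner (app C x) x"
      using x by (simp add: appC inner_diff_left power2_norm_eq_inner flip: power2_eq_square)
  qed (use bC in simp)
  have CC: "app C (app C x) = x - app X x" if "x \<in> H" for x
    using that sqrt_limit_equation[OF X that]
    by (simp add: appC sub bops_diff[OF bY] scaleR_2 algebra_simps)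
  show sq: "C \<circ>\<^sub>o C = op_id H -\<^sub>o X"
    by (rule bops_eqI[OF op_comp_bounded[OF bC bC]])
       (auto simp: CC intro!: bounded_ops_intros bX H)
  have "B = C" if B: "positive_op B" "B \<circ>\<^sub>o B = op_id H -\<^sub>o X" for B
  proof -
    have srcB [simp]: "src B = H" using arg_cong[OF B(2), of src] by simp
    have bB: "B \<in> bounded_ops H H" and symB: "symmetric_op B"
      and posB: "\<And>x. x \<in> H \<Longrightarrow> 0 \<le> inner (app B x) x"
      using B(1) by (auto simp: positive_op_iff)
    note [simp] = bops_in[OF bB]
    have BB: "app B (app B x) = x - app X x" if "x \<in> H" for x
      using arg_cong[OF B(2), of "\<lambda>S. app S x"] that by simp
    have BX: "app B (app X x) = app X (app B x)" if x: "x \<in> H" for x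
    proof -
      have "app B (app X x) = app B (x - app B (app B x))" using BB[OF x] by simp
      also have "\<dots> = app B x - app B (app B (app B x))" using x by (simp add: bops_diff[OF bB])
      also have "\<dots> = app X (app B x)" using BB[of "app B x"] x by simp
      finally show ?thesis .
    qed
    have BC: "app B (app C x) = app C (app B x)" if "x \<in> H" for x
      using sqrt_limit_intertwine[OF X X bB _ that] BX that
      by (simp add: appC bops_diff[OF bB])
    show "B = C"
    proof (rule bops_eqI[OF bB bC])
      fix x assume x: "x \<in> H"
      define v where "v = app B x - app C x"
      have v: "v \<in> H" using x by (simp add: v_def sub)
      have "app B v + app C v = 0"
        using x by (simp add: v_def bops_diff[OF bB] bops_diff[OF bC] BC BB CC)
      then have "inner (app B v) v + inner (app C v) v = 0" by (metis inner_add_left inner_zero_left)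
      moreover have "0 \<le> inner (app C v) v" using posC v by (simp add: positive_op_iff)
      ultimately have "inner (app B v) v = 0" "inner (app C v) v = 0" using posB[OF v] by auto
      then have "app B v = 0" "app C v = 0"
        using positive_op_kernel[OF B(1)] positive_op_kernel[OF posC] v by auto
      moreover have "inner v v = inner x (app B v) - inner x (app C v)"
        using symB posC x v by (simp add: v_def inner_diff_left positive_op_iff symmetric_op_def)
      ultimately show "app B x = app C x" by (simp add: v_def)
    qed
  qed
  with posC sq show "op_sqrt (op_id H -\<^sub>o X) = C"
    unfolding op_sqrt_def by (intro the_equality conjI) blast+
qed


section \<open>Defect operators and elementary rotations\<close>

lemma defect_facts:
  fixes T :: "('a::chilbert_space, 'b::chilbert_space) oper"
  assumes T: "T \<in> contractions A B"
  shows defect_eq: "defect T = op_id A -\<^sub>o sqrt_limit (adj T \<circ>\<^sub>o T)"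
    and defect_bounded: "defect T \<in> bounded_ops A A"
    and defect_symmetric: "x \<in> A \<Longrightarrow> y \<in> A \<Longrightarrow> inner (app (defect T) x) y = inner x (app (defect T) y)"
    and defect_square: "x \<in> A \<Longrightarrow> app (defect T) (app (defect T) x) = x - app (adj T) (app T x)"
proof -
  let ?X = "adj T \<circ>\<^sub>o T"
  note bT = contr_bounded[OF T]
  have X: "?X \<in> contractions A A" by (rule op_comp_contraction[OF adj_contraction[OF T] T])
  have sym: "symmetric_op ?X"
    unfolding symmetric_op_def
    by (simp add: bops_src[OF bT] bops_in[OF bT] adj_inner(2)[OF bT, symmetric])
       (metis adj_inner(2)[OF bT] bops_in[OF bT] inner_commute)
  note sqrt = op_sqrt_id_minus[OF X sym]
  show eq: "defect T = op_id A -\<^sub>o sqrt_limit ?X"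
    by (simp add: defect_def bops_src[OF bT] sqrt(1))
  have pos: "positive_op (defect T)" and sq: "defect T \<circ>\<^sub>o defect T = op_id A -\<^sub>o ?X"
    using sqrt(2,3) by (simp_all add: eq)
  have src: "src (defect T) = A" by (simp add: eq)
  show "defect T \<in> bounded_ops A A" using pos by (simp add: positive_op_iff src)
  show "x \<in> A \<Longrightarrow> y \<in> A \<Longrightarrow> inner (app (defect T) x) y = inner x (app (defect T) y)"
    using pos by (simp add: positive_op_iff symmetric_op_def src)
  show "x \<in> A \<Longrightarrow> app (defect T) (app (defect T) x) = x - app (adj T) (app T x)"
    using arg_cong[OF sq, of "\<lambda>S. app S x"] by (simp add: src bops_src[OF bT])
qed

lemma defect_norm:
  fixes T :: "('a::chilbert_space, 'b::chilbert_space) oper"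
  assumes T: "T \<in> contractions A B" and x: "x \<in> A"
  shows "(norm (app (defect T) x))\<^sup>2 = (norm x)\<^sup>2 - (norm (app T x))\<^sup>2"
proof -
  note bT = contr_bounded[OF T]
  have "(norm (app (defect T) x))\<^sup>2 = inner x (app (defect T) (app (defect T) x))"
    using defect_symmetric[OF T x bops_in[OF defect_bounded[OF T] x]] by (simp add: power2_norm_eq_inner)
  then show ?thesis
    using adj_inner(2)[OF bT bops_in[OF bT x] x]
    by (simp add: defect_square[OF T x] inner_diff_right power2_norm_eq_inner)
qed

text \<open>Since \<open>T (T* T) = (T T*) T\<close>, the operator \<open>T\<close> intertwines the square root
  approximations for \<open>T* T\<close> and \<open>T T*\<close>, and hence their limits.\<close>

lemma defect_intertwine:
  fixes T :: "('a::chilbert_space, 'b::chilbert_space) oper"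
  assumes T: "T \<in> contractions A B" and x: "x \<in> A"
  shows "app T (app (defect T) x) = app (defect (adj T)) (app T x)"
proof -
  note bT = contr_bounded[OF T] and cT' = adj_contraction[OF T]
  note bT' = contr_bounded[OF cT'] and TT = adj_adj[OF bT]
  note X = op_comp_contraction[OF cT' T] and X' = op_comp_contraction[OF T cT']
  have "app T (app (sqrt_limit (adj T \<circ>\<^sub>o T)) x) = app (sqrt_limit (T \<circ>\<^sub>o adj T)) (app T x)"
    by (rule sqrt_limit_intertwine[OF X X' bT _ x])
       (simp add: bops_src[OF bT] bops_src[OF bT'] bops_in[OF bT])
  then show ?thesis
    using x bops_in[OF contr_bounded[OF sqrt_limit_contraction[OF X]] x]
    by (simp add: defect_eq[OF T] defect_eq[OF cT'] TT bops_diff[OF bT] bops_in[OF bT])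
qed

lemma csubspace_closure:
  assumes L: "csubspace L"
  shows "csubspace (closure L)"
  unfolding csubspace_def
proof (intro conjI ballI allI)
  show "0 \<in> closure L" using csubspace_zero[OF L] closure_subset by blast
  fix x assume "x \<in> closure L"
  then obtain X where X: "\<And>k. X k \<in> L" "X \<longlonglongrightarrow> x" by (auto simp: closure_sequential)
  show "x + y \<in> closure L" if y: "y \<in> closure L" for y
  proof -
    obtain Y where Y: "\<And>k. Y k \<in> L" "Y \<longlonglongrightarrow> y" using y by (auto simp: closure_sequential)
    show ?thesis unfolding closure_sequential
      by (intro exI[of _ "\<lambda>k. X k + Y k"] conjI allI tendsto_add X Y csubspace_add[OF L])
  qed
  fix c
  from bounded_linear.tendsto[OF bounded_linear_scaleC X(2)] show "c *\<^sub>C x \<in> closure L"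
    unfolding closure_sequential
    by (intro exI[of _ "\<lambda>k. c *\<^sub>C X k"] conjI allI csubspace_scaleC[OF L] X(1))
qed

text \<open>The last statement holds on the range of \<open>D\<^sub>T\<close> because \<open>T D\<^sub>T x = D\<^bsub>T*\<^esub> (T x)\<close>, and then on the
  closure by continuity.\<close>

lemma defect_space_facts:
  fixes T :: "('a::chilbert_space, 'b::chilbert_space) oper"
  assumes T: "T \<in> contractions A B"
  shows defect_space_csubspace: "csubspace (defect_space T)"
    and defect_space_closed: "closed (defect_space T)"
    and defect_space_subset: "defect_space T \<subseteq> A"
    and defect_in_defect_space: "x \<in> A \<Longrightarrow> app (defect T) x \<in> defect_space T"
    and contraction_maps_defect_space:
      "x \<in> defect_space T \<Longrightarrow> app T x \<in> defect_space (adj T)"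
proof -
  note bT = contr_bounded[OF T] and bD = defect_bounded[OF T]
  note bD' = defect_bounded[OF adj_contraction[OF T]]
  note A = bops_csub(1)[OF bT] bops_closed(1)[OF bT]
  have eq: "defect_space T = closure (app (defect T) ` A)"
    "defect_space (adj T) = closure (app (defect (adj T)) ` B)"
    by (simp_all add: defect_space_def bops_src[OF bT] bops_src[OF adj_bounded[OF bT]])
  have "csubspace (app (defect T) ` A)"
    unfolding csubspace_def
  proof (intro conjI ballI allI)
    show "0 \<in> app (defect T) ` A"
      using imageI[OF csubspace_zero[OF A(1)], of "app (defect T)"] by (simp add: bops_zero[OF bD])
    fix u assume "u \<in> app (defect T) ` A"
    then obtain x where x: "x \<in> A" "u = app (defect T) x" by blast
    show "u + v \<in> app (defect T) ` A" if "v \<in> app (defect T) ` A" for v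
      using that x csubspace_add[OF A(1) x(1)] by (auto simp: bops_add[OF bD, symmetric])
    show "c *\<^sub>C u \<in> app (defect T) ` A" for c
      using x csubspace_scaleC[OF A(1) x(1), of c] by (auto simp: bops_scaleC[OF bD, symmetric])
  qed
  then show "csubspace (defect_space T)" unfolding eq by (rule csubspace_closure)
  show "closed (defect_space T)" by (simp add: eq)
  have sub: "app (defect T) ` A \<subseteq> A" using bops_in[OF bD] by blast
  show sub': "defect_space T \<subseteq> A"
    unfolding eq using closure_minimal[OF sub A(2)] .
  show "x \<in> A \<Longrightarrow> app (defect T) x \<in> defect_space T"
    unfolding eq by (intro subsetD[OF closure_subset] imageI)
  show "app T x \<in> defect_space (adj T)" if x: "x \<in> defect_space T" for x
  proof -
    obtain X where X: "\<And>k. X k \<in> app (defect T) ` A" "X \<longlonglongrightarrow> x"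
      using x by (auto simp: eq closure_sequential)
    have "(\<lambda>k. app T (X k)) \<longlonglongrightarrow> app T x"
      using X(1) sub sub' x by (intro bops_tendsto[OF bT X(2)]) blast+
    moreover have "app T (X k) \<in> app (defect (adj T)) ` B" for k
      using X(1)[of k] defect_intertwine[OF T] bops_in[OF bT] by auto
    ultimately show ?thesis unfolding eq closure_sequential by (intro exI conjI allI)
  qed
qed

lemma adj_maps_defect_space:
  fixes T :: "('a::chilbert_space, 'b::chilbert_space) oper"
  assumes T: "T \<in> contractions A B" and y: "y \<in> defect_space (adj T)"
  shows "app (adj T) y \<in> defect_space T"
  using contraction_maps_defect_space[OF adj_contraction[OF T] y]
  by (simp add: adj_adj[OF contr_bounded[OF T]])

text \<open>The cross terms cancel because of \<open>T D\<^sub>T = D\<^bsub>T*\<^esub> T\<close>.\<close>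

lemma rotation_isometric:
  fixes T :: "('a::chilbert_space, 'b::chilbert_space) oper"
  assumes T: "T \<in> contractions A B" and x: "x \<in> A" and y: "y \<in> B"
  shows "(norm (app T x + app (defect (adj T)) y))\<^sup>2 + (norm (app (defect T) x - app (adj T) y))\<^sup>2
    = (norm x)\<^sup>2 + (norm y)\<^sup>2"
proof -
  note bT = contr_bounded[OF T] and cT' = adj_contraction[OF T]
  have "inner (app (defect T) x) (app (adj T) y) = inner (app T (app (defect T) x)) y"
    by (rule adj_inner(2)[OF bT y bops_in[OF defect_bounded[OF T] x], symmetric])
  also have "\<dots> = inner (app T x) (app (defect (adj T)) y)"
    unfolding defect_intertwine[OF T x] by (rule defect_symmetric[OF cT' bops_in[OF bT x] y])
  finally have cross: "inner (app (defect T) x) (app (adj T) y) =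
      inner (app T x) (app (defect (adj T)) y)" .
  have plus: "(norm (a + b))\<^sup>2 = (norm a)\<^sup>2 + 2 * inner a b + (norm b)\<^sup>2" for a b :: 'b
    by (simp add: power2_norm_eq_inner inner_add_left inner_add_right inner_commute)
  have minus: "(norm (a - b))\<^sup>2 = (norm a)\<^sup>2 - 2 * inner a b + (norm b)\<^sup>2" for a b :: 'a
    by (simp add: power2_norm_eq_inner inner_diff_left inner_diff_right inner_commute)
  show ?thesis
    unfolding plus minus cross using defect_norm[OF T x] defect_norm[OF cT' y] by linarith
qed

lemma norm_Pair_sq: "(norm (x, y))\<^sup>2 = (norm x)\<^sup>2 + (norm y)\<^sup>2"
  by (simp add: norm_Pair)

lemma norm_prod_sq: "(norm p)\<^sup>2 = (norm (fst p))\<^sup>2 + (norm (snd p))\<^sup>2"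
  by (cases p) (simp add: norm_Pair)

lemma rotation_contraction:
  fixes T :: "('a::chilbert_space, 'b::chilbert_space) oper"
  assumes T: "T \<in> contractions A B"
  shows "rotation T \<in> contractions (A \<times> defect_space (adj T)) (B \<times> defect_space T)"
proof -
  note bT = contr_bounded[OF T] and cT' = adj_contraction[OF T]
  note bT' = contr_bounded[OF cT'] and bD = defect_bounded[OF T] and bD' = defect_bounded[OF cT']
  note sub = bops_csub[OF bT] bops_closed[OF bT] defect_space_csubspace[OF T]
    defect_space_closed[OF T] defect_space_csubspace[OF cT'] defect_space_closed[OF cT']
  have inB: "y \<in> B" if "y \<in> defect_space (adj T)" for y
    using that defect_space_subset[OF cT'] by blast
  define f where "f = (\<lambda>(x, y). (app T x + app (defect (adj T)) y, app (defect T) x - app (adj T) y))"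
  have norm: "norm (f p) \<le> norm p" if "p \<in> A \<times> defect_space (adj T)" for p
  proof -
    obtain x y where p: "p = (x, y)" "x \<in> A" "y \<in> defect_space (adj T)"
      using \<open>p \<in> _\<close> by (cases p) auto
    have "(norm (f p))\<^sup>2 = (norm p)\<^sup>2"
      using rotation_isometric[OF T p(2) inB[OF p(3)]] by (simp add: f_def p(1) norm_Pair_sq)
    then show ?thesis by (simp add: power2_eq_iff_nonneg)
  qed
  have "mk_op (A \<times> defect_space (adj T)) (B \<times> defect_space T) f
      \<in> bounded_ops (A \<times> defect_space (adj T)) (B \<times> defect_space T)"
  proof (rule mk_op_bounded[where C = 1])
    fix p q c assume "p \<in> A \<times> defect_space (adj T)"
    then obtain x y where p: "p = (x, y)" "x \<in> A" "y \<in> defect_space (adj T)" by blast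
    show "f p \<in> B \<times> defect_space T"
      using p inB[OF p(3)] defect_in_defect_space[OF T p(2)] adj_maps_defect_space[OF T p(3)]
      by (simp add: f_def csubspaceD sub bops_in[OF bT] bops_in[OF bD'])
    show "f (p + q) = f p + f q" if "q \<in> A \<times> defect_space (adj T)"
      using p that
      by (auto simp: f_def inB bops_add[OF bT] bops_add[OF bD] bops_add[OF bT'] bops_add[OF bD'])
    show "f (c *\<^sub>C p) = c *\<^sub>C f p"
      using p by (simp add: f_def inB scaleC_prod_def bops_scaleC[OF bT] bops_scaleC[OF bD]
          bops_scaleC[OF bT'] bops_scaleC[OF bD'] scaleC_add_right scaleC_diff_right)
  qed (use sub norm in \<open>auto intro!: csubspace_Times closed_Times\<close>)
  moreover have "rotation T = mk_op (A \<times> defect_space (adj T)) (B \<times> defect_space T) f"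
    by (simp add: rotation_def f_def bops_src[OF bT] bops_tgt[OF bT])
  ultimately show ?thesis using norm by (simp add: contractions_def)
qed

text \<open>The row and the column of the rotation inherit linearity and their bounds from the rotation.\<close>

lemma defect_row_app:
  assumes "p \<in> src T \<times> defect_space (adj T)"
  shows "app (defect_row T) p = snd (app (rotation T) p)"
  using assms by (auto simp: defect_row_def rotation_def)

lemma defect_col_app:
  fixes T :: "('a::chilbert_space, 'b::chilbert_space) oper"
  assumes T: "T \<in> contractions A B" and y: "y \<in> defect_space (adj T)"
  shows "app (defect_col T) y = app (rotation T) (0, y)"
  using y csubspace_zero[OF bops_csub(1)[OF contr_bounded[OF T]]]
  by (simp add: defect_col_def rotation_def bops_src[OF contr_bounded[OF T]]
      bops_zero[OF contr_bounded[OF T]] bops_zero[OF defect_bounded[OF T]])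

lemma defect_row_bounded:
  fixes T :: "('a::chilbert_space, 'b::chilbert_space) oper"
  assumes T: "T \<in> contractions A B"
  shows "defect_row T \<in> bounded_ops (A \<times> defect_space (adj T)) (defect_space T)"
proof -
  note J = rotation_contraction[OF T] and src = bops_src[OF contr_bounded[OF T]]
  note bJ = contr_bounded[OF J]
  have "defect_row T = mk_op (A \<times> defect_space (adj T)) (defect_space T) (app (defect_row T))"
    by (simp add: defect_row_def mk_op_def src fun_eq_iff)
  also have "\<dots> \<in> bounded_ops (A \<times> defect_space (adj T)) (defect_space T)"
  proof (rule mk_op_bounded[where C = 1])
    fix p q c assume p: "p \<in> A \<times> defect_space (adj T)"
    show "app (defect_row T) p \<in> defect_space T"
      using bops_in[OF bJ p] p by (simp add: defect_row_app src mem_Times_iff)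
    show "app (defect_row T) (p + q) = app (defect_row T) p + app (defect_row T) q"
      if q: "q \<in> A \<times> defect_space (adj T)"
      using p q csubspace_add[OF bops_csub(1)[OF bJ] p q]
      by (simp add: defect_row_app src bops_add[OF bJ])
    show "app (defect_row T) (c *\<^sub>C p) = c *\<^sub>C app (defect_row T) p"
      using p csubspace_scaleC[OF bops_csub(1)[OF bJ] p]
      bops_scaleC[OF bJ p, of c]
      by (simp add: defect_row_app src scaleC_prod_def)
    show "norm (app (defect_row T) p) \<le> 1 * norm p"
      using contr_norm[OF J p] p norm_snd_le[of "snd (app (rotation T) p)" "fst (app (rotation T) p)"]
      by (simp add: defect_row_app src)
  qed (use bops_csub[OF bJ] bops_closed[OF bJ] defect_space_csubspace[OF T] defect_space_closed[OF T]
        in auto)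
  finally show ?thesis .
qed

lemma defect_col_bounded:
  fixes T :: "('a::chilbert_space, 'b::chilbert_space) oper"
  assumes T: "T \<in> contractions A B"
  shows "defect_col T \<in> bounded_ops (defect_space (adj T)) (B \<times> defect_space T)"
proof -
  note J = rotation_contraction[OF T] and bT = contr_bounded[OF T]
  note bJ = contr_bounded[OF J] and cT' = adj_contraction[OF T]
  note D = defect_space_csubspace[OF cT'] defect_space_closed[OF cT']
  have in_src: "(0, y) \<in> A \<times> defect_space (adj T)" if "y \<in> defect_space (adj T)" for y
    using that csubspace_zero[OF bops_csub(1)[OF bT]] by simp
  have "defect_col T = mk_op (defect_space (adj T)) (B \<times> defect_space T) (app (defect_col T))"
    by (simp add: defect_col_def mk_op_def bops_tgt[OF bT] fun_eq_iff)
  also have "\<dots> \<in> bounded_ops (defect_space (adj T)) (B \<times> defect_space T)"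
  proof (rule mk_op_bounded[where C = 1])
    fix p q c assume p: "p \<in> defect_space (adj T)"
    show "app (defect_col T) p \<in> B \<times> defect_space T"
      using bops_in[OF bJ in_src[OF p]] p by (simp add: defect_col_app[OF T])
    show "app (defect_col T) (p + q) = app (defect_col T) p + app (defect_col T) q"
      if q: "q \<in> defect_space (adj T)"
      using p q bops_add[OF bJ in_src[OF p] in_src[OF q]]
      by (simp add: defect_col_app[OF T] csubspace_add[OF D(1)])
    show "app (defect_col T) (c *\<^sub>C p) = c *\<^sub>C app (defect_col T) p"
      using p bops_scaleC[OF bJ in_src[OF p], of c]
      by (simp add: defect_col_app[OF T] csubspace_scaleC[OF D(1)] scaleC_prod_def)
    show "norm (app (defect_col T) p) \<le> 1 * norm p"
      using contr_norm[OF J in_src[OF p]] p by (simp add: defect_col_app[OF T] norm_Pair)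
  qed (use bops_csub(2)[OF bJ] bops_closed(2)[OF bJ] D in auto)
  finally show ?thesis .
qed


section \<open>Finite orthogonal sums\<close>

lemma bounded_linear_coord: "bounded_linear (\<lambda>x. coord x k)"
  by (rule bounded_linear_intro[where K = 1]) (simp_all add: norm_coord_le)

lemma hsum_coord: "x \<in> hsum N H \<Longrightarrow> k \<in> {1..N} \<Longrightarrow> coord x k \<in> H k"
  by (auto simp: hsum_def dest: spec[of _ k])

lemma hsum_csubspace:
  assumes "\<And>k. k \<in> {1..N} \<Longrightarrow> csubspace (H k)"
  shows "csubspace (hsum N H)"
  unfolding csubspace_def[of "hsum N H"] using assms by (auto simp: hsum_def csubspaceD)

lemma hsum_closed:
  assumes "\<And>k. k \<in> {1..N} \<Longrightarrow> closed (H k)"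
  shows "closed (hsum N H)"
proof -
  have "hsum N H = (\<Inter>k. (\<lambda>x. coord x k) -` (if k \<in> {1..N} then H k else {0}))"
    by (auto simp: hsum_def split: if_splits)
  also have "closed \<dots>"
    using assms by (intro closed_INT ballI continuous_closed_vimage
        bounded_linear.isCont[OF bounded_linear_coord] continuous_ident) auto
  finally show ?thesis .
qed

lemma fin_seq_in_hsum: "(\<And>k. k \<in> {1..N} \<Longrightarrow> f k \<in> H k) \<Longrightarrow> fin_seq N f \<in> hsum N H"
  by (simp add: hsum_def coord_fin_seq)

lemma norm_hsum:
  assumes "x \<in> hsum N H"
  shows "(norm x)\<^sup>2 = (\<Sum>k=1..N. (norm (coord x k))\<^sup>2)"
  unfolding norm_ell2_sq
  by (rule suminf_finite) (use assms in \<open>auto simp: hsum_def split: if_splits\<close>)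

lemma norm_fin_seq: "(norm (fin_seq N f))\<^sup>2 = (\<Sum>k=1..N. (norm (f k))\<^sup>2)"
proof -
  have "fin_seq N f \<in> hsum N (\<lambda>_. UNIV)" by (rule fin_seq_in_hsum) simp
  then show ?thesis by (simp add: norm_hsum coord_fin_seq)
qed

lemma fin_seq_add: "fin_seq N (\<lambda>k. f k + g k) = fin_seq N f + fin_seq N g"
  by (simp add: ell2_eq_iff coord_fin_seq)

lemma fin_seq_scaleC: "fin_seq N (\<lambda>k. c *\<^sub>C f k) = c *\<^sub>C fin_seq N f"
  by (simp add: ell2_eq_iff coord_fin_seq)

lemma fin_seq_cong: "(\<And>k. k \<in> {1..N} \<Longrightarrow> f k = g k) \<Longrightarrow> fin_seq N f = fin_seq N g"
  by (simp add: ell2_eq_iff coord_fin_seq)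

text \<open>The norm condition concerns all components together, and not each one, because \<open>Wop\<close> moves
  entries between neighbouring components.\<close>

lemma hsum_contractionI:
  assumes K: "csubspace K" "closed K"
    and H: "\<And>k. k \<in> {1..N} \<Longrightarrow> csubspace (H k)" "\<And>k. k \<in> {1..N} \<Longrightarrow> closed (H k)"
    and into: "\<And>x k. x \<in> K \<Longrightarrow> k \<in> {1..N} \<Longrightarrow> f x k \<in> H k"
    and add: "\<And>x y k. x \<in> K \<Longrightarrow> y \<in> K \<Longrightarrow> k \<in> {1..N} \<Longrightarrow> f (x + y) k = f x k + f y k"
    and scale: "\<And>c x k. x \<in> K \<Longrightarrow> k \<in> {1..N} \<Longrightarrow> f (c *\<^sub>C x) k = c *\<^sub>C f x k"
    and norm: "\<And>x. x \<in> K \<Longrightarrow> (\<Sum>k=1..N. (norm (f x k))\<^sup>2) \<le> (norm x)\<^sup>2"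
  shows "mk_op K (hsum N H) (\<lambda>x. fin_seq N (f x)) \<in> contractions K (hsum N H)"
proof -
  have le: "norm (fin_seq N (f x)) \<le> norm x" if "x \<in> K" for x
    using norm[OF that] by - (rule power2_le_imp_le, simp_all add: norm_fin_seq)
  have "mk_op K (hsum N H) (\<lambda>x. fin_seq N (f x)) \<in> bounded_ops K (hsum N H)"
  proof (rule mk_op_bounded[OF K, where C = 1])
    show "fin_seq N (f (x + y)) = fin_seq N (f x) + fin_seq N (f y)" if "x \<in> K" "y \<in> K" for x y
      unfolding fin_seq_add[symmetric] by (rule fin_seq_cong) (rule add[OF that])
    show "fin_seq N (f (c *\<^sub>C x)) = c *\<^sub>C fin_seq N (f x)" if "x \<in> K" for x c
      unfolding fin_seq_scaleC[symmetric] by (rule fin_seq_cong) (rule scale[OF that])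
    show "csubspace (hsum N H)" by (rule hsum_csubspace[OF H(1)])
    show "closed (hsum N H)" by (rule hsum_closed[OF H(2)])
    show "fin_seq N (f x) \<in> hsum N H" "norm (fin_seq N (f x)) \<le> 1 * norm x" if "x \<in> K" for x
      using le[OF that] fin_seq_in_hsum[OF into[OF that]] by simp_all
  qed
  then show ?thesis using le by (simp add: contractions_def)
qed


section \<open>The operators of a choice sequence\<close>

text \<open>As for adjoints, orthogonality for the real inner product is enough, because the range of
  \<open>\<iota>\<close> is a complex subspace.\<close>

lemma proj_onto_eqI:
  assumes \<iota>: "\<iota> \<in> bounded_ops L H" and iso: "\<And>u. u \<in> L \<Longrightarrow> norm (app \<iota> u) = norm u"
    and x: "x \<in> H" and p: "p \<in> L"
    and orth: "\<And>u. u \<in> L \<Longrightarrow> inner (x - app \<iota> p) (app \<iota> u) = 0"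
  shows "app (proj_onto \<iota>) x = p"
proof -
  note L = csubspaceD[OF bops_csub(1)[OF \<iota>]]
  have "cinner (x - app \<iota> p) (app \<iota> u) = 0" if u: "u \<in> L" for u
  proof (rule complex_eqI)
    have "inner (\<i> *\<^sub>C (x - app \<iota> p)) (app \<iota> u) = inner (x - app \<iota> p) (app \<iota> (- (\<i> *\<^sub>C u)))"
      using u inner_i_i[of "x - app \<iota> p" "app \<iota> (- (\<i> *\<^sub>C u))"]
      by (simp add: L bops_uminus[OF \<iota>] bops_scaleC[OF \<iota>] scaleC_minus_right scaleC_scaleC
          scaleC_minus_one)
    then show "Im (cinner (x - app \<iota> p) (app \<iota> u)) = Im 0"
      using orth[of "- (\<i> *\<^sub>C u)"] u by (simp add: Im_cinner L)
  qed (simp add: Re_cinner orth u)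
  moreover have "q = p"
    if q: "q \<in> L" and orth': "\<forall>u\<in>L. cinner (x - app \<iota> q) (app \<iota> u) = 0" for q
  proof -
    have u: "q - p \<in> L" using p q by (simp add: L)
    have "inner (x - app \<iota> q) (app \<iota> (q - p)) = 0"
      using orth' u by (metis Re_cinner zero_complex.sel(1))
    with orth[OF u] have "inner (app \<iota> (q - p)) (app \<iota> (q - p)) = 0"
      using p q by (simp add: bops_diff[OF \<iota>] inner_diff_left)
    then show "q = p" using iso[OF u] by simp
  qed
  ultimately have "(THE p. p \<in> L \<and> (\<forall>u\<in>L. cinner (x - app \<iota> p) (app \<iota> u) = 0)) = p"
    using p by (intro the_equality conjI ballI) blast+
  then show ?thesis using x by (simp add: proj_onto_def bops_src[OF \<iota>] bops_tgt[OF \<iota>])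
qed

text \<open>With \<open>a k\<close> and \<open>b k\<close> the squared norms of the two entries of component \<open>k\<close>, this passes from
  the bracketing by components to the bracketing on which the rotations of even index act.\<close>

lemma sum_regroup_pairs:
  fixes a b :: "nat \<Rightarrow> real"
  shows "(\<Sum>k=1..n + 1. a k + b k) = a 1 + (\<Sum>k=1..n. b k + a (k + 1)) + b (n + 1)"
  by (induction n) simp_all

lemma mk_op_cong: "(\<And>x. x \<in> A \<Longrightarrow> f x = g x) \<Longrightarrow> mk_op A B f = mk_op A B g"
  by (simp add: mk_op_def fun_eq_iff)

lemma op_comp_assoc:
  assumes "T \<in> bounded_ops B C" "U \<in> bounded_ops A B"
  shows "S \<circ>\<^sub>o (T \<circ>\<^sub>o U) = S \<circ>\<^sub>o T \<circ>\<^sub>o U"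
  unfolding op_comp_def[of S] op_comp_def[of _ U]
  using assms by (auto intro!: mk_op_cong simp: bops_src bops_in op_comp_def)

definition last_vec :: "nat \<Rightarrow> 'a \<Rightarrow> 'a::complex_inner ell2" where
  "last_vec N h = fin_seq N (\<lambda>k. if k = N then h else 0)"

lemma coord_last_vec: "0 < N \<Longrightarrow> coord (last_vec N h) k = (if k = N then h else 0)"
  by (simp add: last_vec_def coord_fin_seq)

lemma norm_last_vec:
  assumes "0 < N"
  shows "norm (last_vec N h) = norm h"
proof -
  have "(norm (last_vec N h))\<^sup>2 = (\<Sum>k=1..N. if k = N then (norm h)\<^sup>2 else 0)"
    unfolding last_vec_def norm_fin_seq by (intro sum.cong) auto
  also have "\<dots> = (norm h)\<^sup>2" using assms by simp
  finally show ?thesis by (simp add: power2_eq_iff_nonneg)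
qed

lemma inner_last_vec:
  assumes "0 < N"
  shows "inner x (last_vec N h) = inner (coord x N) h"
proof -
  have "inner x (last_vec N h) = (\<Sum>k\<in>{N}. inner (coord x k) (coord (last_vec N h) k))"
    unfolding inner_ell2_def by (rule suminf_finite) (simp_all add: coord_last_vec assms)
  then show ?thesis by (simp add: coord_last_vec assms)
qed

text \<open>This lemma and the next treat an isometry \<open>f\<close> of \<open>L\<close> into the last summand of a finite
  orthogonal sum, so that one argument covers all four embeddings: \<open>f\<close> is the identity for those of
  \<open>\<H>\<^sub>n\<^sub>+\<^sub>1\<close> and of its counterpart, and \<open>y \<mapsto> (0, y)\<close> for those of the defect spaces
  of \<open>\<Gamma>\<^sub>2\<^sub>n\<^sub>+\<^sub>1*\<close> and \<open>\<Gamma>\<^sub>2\<^sub>n\<^sub>+\<^sub>1\<close>.\<close>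

lemma last_embedding_bounded:
  assumes N: "0 < N" and L: "csubspace L" "closed L"
    and H: "\<And>k. k \<in> {1..N} \<Longrightarrow> csubspace (H k)" "\<And>k. k \<in> {1..N} \<Longrightarrow> closed (H k)"
    and into: "\<And>u. u \<in> L \<Longrightarrow> f u \<in> H N" and norm: "\<And>u. u \<in> L \<Longrightarrow> norm (f u) = norm u"
    and add: "\<And>u v. u \<in> L \<Longrightarrow> v \<in> L \<Longrightarrow> f (u + v) = f u + f v"
    and scale: "\<And>c u. u \<in> L \<Longrightarrow> f (c *\<^sub>C u) = c *\<^sub>C f u"
  shows "mk_op L (hsum N H) (\<lambda>u. last_vec N (f u)) \<in> bounded_ops L (hsum N H)"
proof (rule mk_op_bounded[OF L, where C = 1])
  show "csubspace (hsum N H)" by (rule hsum_csubspace[OF H(1)])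
  show "closed (hsum N H)" by (rule hsum_closed[OF H(2)])
  fix u v c assume u: "u \<in> L"
  show "last_vec N (f u) \<in> hsum N H"
    unfolding last_vec_def using into[OF u] H(1)
    by (intro fin_seq_in_hsum) (simp add: csubspace_zero)
  show "last_vec N (f (u + v)) = last_vec N (f u) + last_vec N (f v)"
    if "v \<in> L" by (simp add: ell2_eq_iff coord_last_vec N add u that)
  show "last_vec N (f (c *\<^sub>C u)) = c *\<^sub>C last_vec N (f u)"
    by (simp add: ell2_eq_iff coord_last_vec N scale u)
  show "norm (last_vec N (f u)) \<le> 1 * norm u"
    by (simp add: norm_last_vec N norm u)
qed

lemma last_projection:
  assumes N: "0 < N" and \<iota>: "\<iota> = mk_op L (hsum N H) (\<lambda>u. last_vec N (f u))"
    and b\<iota>: "\<iota> \<in> bounded_ops L (hsum N H)"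
    and norm: "\<And>u. u \<in> L \<Longrightarrow> norm (f u) = norm u"
    and q: "\<And>v. v \<in> H N \<Longrightarrow> q v \<in> L"
      "\<And>v u. v \<in> H N \<Longrightarrow> u \<in> L \<Longrightarrow> inner (v - f (q v)) (f u) = 0"
    and q_lin: "\<And>v w. q (v + w) = q v + q w" "\<And>c v. q (c *\<^sub>C v) = c *\<^sub>C q v"
      "\<And>v. norm (q v) \<le> norm v"
  shows "proj_onto \<iota> = mk_op (hsum N H) L (\<lambda>x. q (coord x N))"
    and "proj_onto \<iota> \<in> bounded_ops (hsum N H) L"
proof -
  have eq: "app (proj_onto \<iota>) x = q (coord x N)" if x: "x \<in> hsum N H" for x
  proof (rule proj_onto_eqI[OF b\<iota> _ x])
    have c: "coord x N \<in> H N" by (rule hsum_coord[OF x]) (use N in simp)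
    show p: "q (coord x N) \<in> L" by (rule q(1)[OF c])
    fix u assume u: "u \<in> L"
    show "norm (app \<iota> u) = norm u" using u by (simp add: \<iota> norm_last_vec N norm)
    show "inner (x - app \<iota> (q (coord x N))) (app \<iota> u) = 0"
      using u p q(2)[OF c u] by (simp add: \<iota> inner_last_vec coord_last_vec N)
  qed
  have "proj_onto \<iota> = mk_op (hsum N H) L (app (proj_onto \<iota>))"
    unfolding proj_onto_def bops_src[OF b\<iota>] bops_tgt[OF b\<iota>] by (rule mk_op_cong) simp
  also have "\<dots> = mk_op (hsum N H) L (\<lambda>x. q (coord x N))"
    by (rule mk_op_cong) (rule eq)
  finally show *: "proj_onto \<iota> = mk_op (hsum N H) L (\<lambda>x. q (coord x N))" .
  show "proj_onto \<iota> \<in> bounded_ops (hsum N H) L"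
    unfolding *
  proof (rule mk_op_bounded[where C = 1])
    fix x assume "x \<in> hsum N H"
    then show "q (coord x N) \<in> L" using hsum_coord[of x N H N] q(1) N by simp
    show "norm (q (coord x N)) \<le> 1 * norm x"
      using order_trans[OF q_lin(3) norm_coord_le] by simp
  qed (use bops_csub[OF b\<iota>] bops_closed[OF b\<iota>] q_lin in auto)
qed

context
  fixes \<Gamma> :: "nat \<Rightarrow> ('m::chilbert_space, 'n::chilbert_space) oper" and n :: nat
  assumes choice: "choice_sequence (2*n + 1) \<Gamma>"
begin

lemma choice_step:
  assumes "1 \<le> k" "k \<le> 2*n + 1"
  shows "\<Gamma> k \<in> contractions (defect_space (\<Gamma> (k - 1))) (defect_space (adj (\<Gamma> (k - 1))))"
  using choice assms by (simp add: choice_sequence_def)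

lemma choice_contraction:
  assumes "k \<le> 2*n + 1"
  obtains A B where "\<Gamma> k \<in> contractions A B"
proof (cases "k = 0")
  case True
  then show thesis using that choice by (auto simp: choice_sequence_def)
next
  case False
  then show thesis using that choice_step[of k] assms by auto
qed

lemma defect_spaces_closed_csubspace:
  assumes "k \<le> 2*n + 1"
  shows "csubspace (defect_space (\<Gamma> k))" "closed (defect_space (\<Gamma> k))"
    "csubspace (defect_space (adj (\<Gamma> k)))" "closed (defect_space (adj (\<Gamma> k)))"
proof -
  obtain A B where T: "\<Gamma> k \<in> contractions A B" using choice_contraction[OF assms] .
  note T' = adj_contraction[OF T]
  show "csubspace (defect_space (\<Gamma> k))" "closed (defect_space (\<Gamma> k))"
    "csubspace (defect_space (adj (\<Gamma> k)))" "closed (defect_space (adj (\<Gamma> k)))"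
    by (fact defect_space_csubspace[OF T] defect_space_closed[OF T]
        defect_space_csubspace[OF T'] defect_space_closed[OF T'])+
qed

lemma Hsp_sub:
  assumes "k \<in> {1..n + 1}"
  shows "csubspace (Hsp \<Gamma> k)" "closed (Hsp \<Gamma> k)" "csubspace (Hsp' \<Gamma> k)" "closed (Hsp' \<Gamma> k)"
  using assms unfolding Hsp_def Hsp'_def
  by (auto intro!: csubspace_Times closed_Times defect_spaces_closed_csubspace)

lemma Ksp_sub:
  shows "csubspace (Ksp \<Gamma> n)" "closed (Ksp \<Gamma> n)" "csubspace (Ksp' \<Gamma> n)" "closed (Ksp' \<Gamma> n)"
  unfolding Ksp_def Ksp'_def by (intro hsum_csubspace hsum_closed Hsp_sub; assumption)+

lemma rotation_odd:
  assumes k: "k \<in> {1..n + 1}"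
  shows "rotation (\<Gamma> (2*k - 1)) \<in> contractions (Hsp \<Gamma> k) (Hsp' \<Gamma> k)"
proof -
  have "2*k - 1 - 1 = 2*k - 2" by simp
  then show ?thesis
    using rotation_contraction[OF choice_step[of "2*k - 1"]] k unfolding Hsp_def Hsp'_def by auto
qed

lemma rotation_even:
  assumes k: "k \<in> {1..n}"
  shows "rotation (\<Gamma> (2*k)) \<in>
    contractions (defect_space (\<Gamma> (2*k - 1)) \<times> defect_space (adj (\<Gamma> (2*k))))
      (defect_space (adj (\<Gamma> (2*k - 1))) \<times> defect_space (\<Gamma> (2*k)))"
  using rotation_contraction[OF choice_step[of "2*k"]] k by auto

lemma Ksp_coord: "x \<in> Ksp \<Gamma> n \<Longrightarrow> k \<in> {1..n + 1} \<Longrightarrow> coord x k \<in> Hsp \<Gamma> k"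
  unfolding Ksp_def by (rule hsum_coord)

lemma Ksp'_coord: "x \<in> Ksp' \<Gamma> n \<Longrightarrow> k \<in> {1..n + 1} \<Longrightarrow> coord x k \<in> Hsp' \<Gamma> k"
  unfolding Ksp'_def by (rule hsum_coord)

lemma Vop_contraction: "Vop \<Gamma> n \<in> contractions (Ksp \<Gamma> n) (Ksp' \<Gamma> n)"
  unfolding Vop_def Ksp'_def
proof (rule hsum_contractionI[OF Ksp_sub(1,2)])
  fix x y c k assume x: "x \<in> Ksp \<Gamma> n" and k: "k \<in> {1..n + 1}"
  note bJ = contr_bounded[OF rotation_odd[OF k]]
  let ?J = "app (rotation (\<Gamma> (2*k - 1)))"
  show "?J (coord x k) \<in> Hsp' \<Gamma> k"
    by (rule bops_in[OF bJ Ksp_coord[OF x k]])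
  show "?J (coord (x + y) k) = ?J (coord x k) + ?J (coord y k)" if y: "y \<in> Ksp \<Gamma> n"
    using bops_add[OF bJ Ksp_coord[OF x k] Ksp_coord[OF y k]] by simp
  show "?J (coord (c *\<^sub>C x) k) = c *\<^sub>C ?J (coord x k)"
    using bops_scaleC[OF bJ Ksp_coord[OF x k], of c] by simp
next
  fix x assume x: "x \<in> Ksp \<Gamma> n"
  have "(\<Sum>k=1..n + 1. (norm (app (rotation (\<Gamma> (2*k - 1))) (coord x k)))\<^sup>2)
      \<le> (\<Sum>k=1..n + 1. (norm (coord x k))\<^sup>2)"
    by (intro sum_mono power_mono contr_norm[OF rotation_odd] Ksp_coord[OF x]) auto
  also have "\<dots> = (norm x)\<^sup>2" using norm_hsum x unfolding Ksp_def by metis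
  finally show "(\<Sum>k=1..n + 1. (norm (app (rotation (\<Gamma> (2*k - 1))) (coord x k)))\<^sup>2) \<le> (norm x)\<^sup>2" .
qed (use Hsp_sub in auto)

text \<open>Each rotation of even index acts on the second entry of one component and the first entry of the
  next; after regrouping the squared norms accordingly, the estimate is made block by block, with
  \<open>-\<Gamma>\<^sub>0*\<close> acting on the first entry and \<open>G\<close> on the last one.\<close>

lemma Wop_contraction:
  assumes G: "G \<in> contractions (defect_space (\<Gamma> (2*n + 1))) (defect_space (adj (\<Gamma> (2*n + 1))))"
  shows "Wop \<Gamma> n G \<in> contractions (Ksp' \<Gamma> n) (Ksp \<Gamma> n)"
proof -
  define arg where "arg x k = (snd (coord x k), fst (coord x (k + 1)))" for x :: "('n \<times> 'm) ell2" and k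
  define J where "J x k = app (rotation (\<Gamma> (2*k))) (arg x k)" for x k
  define f where "f x k =
    (if k = 1 then - app (adj (\<Gamma> 0)) (fst (coord x 1)) else snd (J x (k - 1)),
     if k = n + 1 then app G (snd (coord x (n + 1))) else fst (J x k))" for x k
  have \<Gamma>0: "\<Gamma> 0 \<in> contractions UNIV UNIV" using choice by (simp add: choice_sequence_def)
  note c0 = adj_contraction[OF \<Gamma>0]
  note b0 = contr_bounded[OF c0] and bG = contr_bounded[OF G]
  have fst1: "fst (coord x 1) \<in> defect_space (adj (\<Gamma> 0))"
    and sndn: "snd (coord x (n + 1)) \<in> defect_space (\<Gamma> (2*n + 1))" if "x \<in> Ksp' \<Gamma> n" for x
    using Ksp'_coord[OF that, of 1] Ksp'_coord[OF that, of "n + 1"] by (auto simp: Hsp'_def)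
  have arg: "arg x k \<in> defect_space (\<Gamma> (2*k - 1)) \<times> defect_space (adj (\<Gamma> (2*k)))"
    if "x \<in> Ksp' \<Gamma> n" "k \<in> {1..n}" for x k
    using Ksp'_coord[OF that(1), of k] Ksp'_coord[OF that(1), of "k + 1"] that(2)
    by (auto simp: Hsp'_def arg_def)
  have J_in: "J x k \<in> defect_space (adj (\<Gamma> (2*k - 1))) \<times> defect_space (\<Gamma> (2*k))"
    and J_norm: "norm (J x k) \<le> norm (arg x k)"
    and J_scale: "J (c *\<^sub>C x) k = c *\<^sub>C J x k"
    if x: "x \<in> Ksp' \<Gamma> n" and k: "k \<in> {1..n}" for x k c
    using bops_in[OF contr_bounded[OF rotation_even[OF k]] arg[OF that]]
      contr_norm[OF rotation_even[OF k] arg[OF that]]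
      bops_scaleC[OF contr_bounded[OF rotation_even[OF k]] arg[OF that], of c]
    by (simp_all add: J_def arg_def scaleC_prod_def)
  have J_add: "J (x + y) k = J x k + J y k"
    if x: "x \<in> Ksp' \<Gamma> n" and y: "y \<in> Ksp' \<Gamma> n" and k: "k \<in> {1..n}" for x y k
    using bops_add[OF contr_bounded[OF rotation_even[OF k]] arg[OF x k] arg[OF y k]]
    by (simp add: J_def arg_def)
  have "mk_op (Ksp' \<Gamma> n) (hsum (n + 1) (Hsp \<Gamma>)) (\<lambda>x. fin_seq (n + 1) (f x))
      \<in> contractions (Ksp' \<Gamma> n) (hsum (n + 1) (Hsp \<Gamma>))"
  proof (rule hsum_contractionI[OF Ksp_sub(3,4)])
    fix x y c k assume x: "x \<in> Ksp' \<Gamma> n" and k: "k \<in> {1..n + 1}"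
    note D0 = defect_spaces_closed_csubspace[OF le0]
    have k1: "k - 1 \<in> {1..n}" if "k \<noteq> 1" using k that by auto
    show "f x k \<in> Hsp \<Gamma> k"
    proof -
      have "fst (f x k) \<in> defect_space (\<Gamma> (2*k - 2))"
      proof (cases "k = 1")
        case True
        then show ?thesis using adj_maps_defect_space[OF \<Gamma>0 fst1[OF x]]
          by (simp add: f_def csubspace_uminus[OF D0(1)])
      next
        case False
        then have "2 * (k - 1) = 2*k - 2" by simp
        then show ?thesis using J_in[OF x k1[OF False]] False by (auto simp: f_def)
      qed
      moreover have "snd (f x k) \<in> defect_space (adj (\<Gamma> (2*k - 1)))"
      proof (cases "k = n + 1")
        case True
        then show ?thesis using bops_in[OF bG sndn[OF x]] by (simp add: f_def)
      next
        case False
        then show ?thesis using J_in[OF x, of k] k by (auto simp: f_def)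
      qed
      ultimately show ?thesis by (simp add: Hsp_def mem_Times_iff)
    qed
    show "f (x + y) k = f x k + f y k" if y: "y \<in> Ksp' \<Gamma> n"
      using k J_add[OF x y, of k] J_add[OF x y k1] bops_add[OF bG sndn[OF x] sndn[OF y]]
        bops_add[OF b0]
      by (cases "k = 1"; cases "k = n + 1") (auto simp: f_def)
    show "f (c *\<^sub>C x) k = c *\<^sub>C f x k"
      using k J_scale[OF x, of k] J_scale[OF x k1] bops_scaleC[OF bG sndn[OF x]] bops_scaleC[OF b0]
      by (cases "k = 1"; cases "k = n + 1") (auto simp: f_def scaleC_prod_def scaleC_minus_right)
  next
    fix x assume x: "x \<in> Ksp' \<Gamma> n"
    have "(\<Sum>k=1..n + 1. (norm (f x k))\<^sup>2) =
        (\<Sum>k=1..n + 1. (norm (fst (f x k)))\<^sup>2 + (norm (snd (f x k)))\<^sup>2)"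
      by (intro sum.cong refl norm_prod_sq)
    also have "\<dots> = (norm (fst (f x 1)))\<^sup>2
        + (\<Sum>k=1..n. (norm (snd (f x k)))\<^sup>2 + (norm (fst (f x (k + 1))))\<^sup>2)
        + (norm (snd (f x (n + 1))))\<^sup>2"
      by (rule sum_regroup_pairs)
    also have "\<dots> \<le> (norm (fst (coord x 1)))\<^sup>2
        + (\<Sum>k=1..n. (norm (snd (coord x k)))\<^sup>2 + (norm (fst (coord x (k + 1))))\<^sup>2)
        + (norm (snd (coord x (n + 1))))\<^sup>2"
    proof (rule add_mono[OF add_mono[OF _ sum_mono]])
      show "(norm (fst (f x 1)))\<^sup>2 \<le> (norm (fst (coord x 1)))\<^sup>2"
        using contr_norm[OF c0, of "fst (coord x 1)"] by (simp add: f_def)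
      show "(norm (snd (f x (n + 1))))\<^sup>2 \<le> (norm (snd (coord x (n + 1))))\<^sup>2"
        using contr_norm[OF G sndn[OF x]] by (simp add: f_def)
      fix k assume k: "k \<in> {1..n}"
      have "(norm (snd (f x k)))\<^sup>2 + (norm (fst (f x (k + 1))))\<^sup>2 = (norm (J x k))\<^sup>2"
        using k by (simp add: f_def norm_prod_sq)
      also have "\<dots> \<le> (norm (arg x k))\<^sup>2" by (intro power_mono J_norm x k) simp
      finally show "(norm (snd (f x k)))\<^sup>2 + (norm (fst (f x (k + 1))))\<^sup>2
          \<le> (norm (snd (coord x k)))\<^sup>2 + (norm (fst (coord x (k + 1))))\<^sup>2"
        by (simp add: arg_def norm_Pair_sq)
    qed
    also have "\<dots> = (\<Sum>k=1..n + 1. (norm (fst (coord x k)))\<^sup>2 + (norm (snd (coord x k)))\<^sup>2)"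
      by (rule sum_regroup_pairs[symmetric])
    also have "\<dots> = (\<Sum>k=1..n + 1. (norm (coord x k))\<^sup>2)"
      by (intro sum.cong refl norm_prod_sq[symmetric])
    also have "\<dots> = (norm x)\<^sup>2" using norm_hsum x unfolding Ksp'_def by metis
    finally show "(\<Sum>k=1..n + 1. (norm (f x k))\<^sup>2) \<le> (norm x)\<^sup>2" .
  qed (use Hsp_sub in auto)
  moreover have "Wop \<Gamma> n G = mk_op (Ksp' \<Gamma> n) (Ksp \<Gamma> n) (\<lambda>x. fin_seq (n + 1) (f x))"
    unfolding Wop_def Let_def f_def J_def arg_def ..
  ultimately show ?thesis by (simp add: Ksp_def)
qed



lemma last_Hsp:
  "Hsp \<Gamma> (n + 1) = defect_space (\<Gamma> (2*n)) \<times> defect_space (adj (\<Gamma> (2*n + 1)))"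
  "Hsp' \<Gamma> (n + 1) = defect_space (adj (\<Gamma> (2*n))) \<times> defect_space (\<Gamma> (2*n + 1))"
  by (simp_all add: Hsp_def Hsp'_def)

lemma emb_eqs:
  shows emb_H_eq: "emb_H \<Gamma> n = mk_op (Hsp \<Gamma> (n + 1)) (hsum (n + 1) (Hsp \<Gamma>)) (last_vec (n + 1))"
    and emb_H'_eq: "emb_H' \<Gamma> n = mk_op (Hsp' \<Gamma> (n + 1)) (hsum (n + 1) (Hsp' \<Gamma>)) (last_vec (n + 1))"
    and emb_D_star_eq: "emb_D_star \<Gamma> n = mk_op (defect_space (adj (\<Gamma> (2*n + 1))))
      (hsum (n + 1) (Hsp \<Gamma>)) (\<lambda>y. last_vec (n + 1) (0, y))"
    and emb_D_eq: "emb_D \<Gamma> n = mk_op (defect_space (\<Gamma> (2*n + 1)))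
      (hsum (n + 1) (Hsp' \<Gamma>)) (\<lambda>y. last_vec (n + 1) (0, y))"
proof -
  show H: "emb_H \<Gamma> n = mk_op (Hsp \<Gamma> (n + 1)) (hsum (n + 1) (Hsp \<Gamma>)) (last_vec (n + 1))"
    and H': "emb_H' \<Gamma> n = mk_op (Hsp' \<Gamma> (n + 1)) (hsum (n + 1) (Hsp' \<Gamma>)) (last_vec (n + 1))"
    by (simp_all add: emb_H_def emb_H'_def Ksp_def Ksp'_def last_vec_def[abs_def])
  have "0 \<in> defect_space (\<Gamma> (2*n))" "0 \<in> defect_space (adj (\<Gamma> (2*n)))"
    by (simp_all add: csubspace_zero defect_spaces_closed_csubspace)
  then show "emb_D_star \<Gamma> n = mk_op (defect_space (adj (\<Gamma> (2*n + 1))))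
      (hsum (n + 1) (Hsp \<Gamma>)) (\<lambda>y. last_vec (n + 1) (0, y))"
    "emb_D \<Gamma> n = mk_op (defect_space (\<Gamma> (2*n + 1)))
      (hsum (n + 1) (Hsp' \<Gamma>)) (\<lambda>y. last_vec (n + 1) (0, y))"
    unfolding emb_D_star_def emb_D_def H H' Ksp_def Ksp'_def last_Hsp
    by (auto intro!: mk_op_cong)
qed

lemma embeddings_bounded:
  shows emb_H_bounded: "emb_H \<Gamma> n \<in> bounded_ops (Hsp \<Gamma> (n + 1)) (Ksp \<Gamma> n)"
    and emb_H'_bounded: "emb_H' \<Gamma> n \<in> bounded_ops (Hsp' \<Gamma> (n + 1)) (Ksp' \<Gamma> n)"
    and emb_D_star_bounded:
      "emb_D_star \<Gamma> n \<in> bounded_ops (defect_space (adj (\<Gamma> (2*n + 1)))) (Ksp \<Gamma> n)"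
    and emb_D_bounded: "emb_D \<Gamma> n \<in> bounded_ops (defect_space (\<Gamma> (2*n + 1))) (Ksp' \<Gamma> n)"
proof -
  have pos: "0 < n + 1" and m: "n + 1 \<in> {1..n + 1}" by simp_all
  note D = defect_spaces_closed_csubspace[OF order_refl]
  have z: "(0, y) \<in> Hsp \<Gamma> (n + 1)" if "y \<in> defect_space (adj (\<Gamma> (2*n + 1)))" for y
    using that csubspace_zero[OF defect_spaces_closed_csubspace(1), of "2*n"] unfolding last_Hsp by simp
  have z': "(0, y) \<in> Hsp' \<Gamma> (n + 1)" if "y \<in> defect_space (\<Gamma> (2*n + 1))" for y
    using that csubspace_zero[OF defect_spaces_closed_csubspace(3), of "2*n"] unfolding last_Hsp by simp
  show "emb_H \<Gamma> n \<in> bounded_ops (Hsp \<Gamma> (n + 1)) (Ksp \<Gamma> n)"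
    unfolding emb_H_eq Ksp_def
    by (rule last_embedding_bounded[OF pos Hsp_sub(1,2)[OF m] Hsp_sub(1,2)]) simp_all
  show "emb_H' \<Gamma> n \<in> bounded_ops (Hsp' \<Gamma> (n + 1)) (Ksp' \<Gamma> n)"
    unfolding emb_H'_eq Ksp'_def
    by (rule last_embedding_bounded[OF pos Hsp_sub(3,4)[OF m] Hsp_sub(3,4)]) simp_all
  show "emb_D_star \<Gamma> n \<in> bounded_ops (defect_space (adj (\<Gamma> (2*n + 1)))) (Ksp \<Gamma> n)"
    unfolding emb_D_star_eq Ksp_def
    by (rule last_embedding_bounded[where f = "Pair 0", OF pos D(3,4) Hsp_sub(1,2)])
       (use z in \<open>simp_all add: norm_Pair scaleC_prod_def\<close>)
  show "emb_D \<Gamma> n \<in> bounded_ops (defect_space (\<Gamma> (2*n + 1))) (Ksp' \<Gamma> n)"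
    unfolding emb_D_eq Ksp'_def
    by (rule last_embedding_bounded[where f = "Pair 0", OF pos D(1,2) Hsp_sub(3,4)])
       (use z' in \<open>simp_all add: norm_Pair scaleC_prod_def\<close>)
qed

lemma proj_H:
  shows proj_H_bounded: "proj_onto (emb_H \<Gamma> n) \<in> bounded_ops (Ksp \<Gamma> n) (Hsp \<Gamma> (n + 1))"
    and proj_H_app: "x \<in> Ksp \<Gamma> n \<Longrightarrow> app (proj_onto (emb_H \<Gamma> n)) x = coord x (n + 1)"
proof -
  note p = last_projection[OF _ emb_H_eq emb_H_bounded[unfolded Ksp_def], where q = "\<lambda>v. v"]
  show "proj_onto (emb_H \<Gamma> n) \<in> bounded_ops (Ksp \<Gamma> n) (Hsp \<Gamma> (n + 1))"
    unfolding Ksp_def by (rule p(2)) simp_all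
  have "proj_onto (emb_H \<Gamma> n) = mk_op (Ksp \<Gamma> n) (Hsp \<Gamma> (n + 1)) (\<lambda>x. coord x (n + 1))"
    unfolding Ksp_def by (rule p(1)) simp_all
  then show "x \<in> Ksp \<Gamma> n \<Longrightarrow> app (proj_onto (emb_H \<Gamma> n)) x = coord x (n + 1)" by simp
qed

lemma proj_D:
  shows proj_D_bounded: "proj_onto (emb_D \<Gamma> n) \<in> bounded_ops (Ksp' \<Gamma> n) (defect_space (\<Gamma> (2*n + 1)))"
    and proj_D_app: "x \<in> Ksp' \<Gamma> n \<Longrightarrow> app (proj_onto (emb_D \<Gamma> n)) x = snd (coord x (n + 1))"
proof -
  note p = last_projection[OF _ emb_D_eq emb_D_bounded[unfolded Ksp'_def], where q = snd]
  have sndH: "snd v \<in> defect_space (\<Gamma> (2*n + 1))" if "v \<in> Hsp' \<Gamma> (n + 1)" for v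
    using that unfolding last_Hsp by auto
  show "proj_onto (emb_D \<Gamma> n) \<in> bounded_ops (Ksp' \<Gamma> n) (defect_space (\<Gamma> (2*n + 1)))"
    unfolding Ksp'_def
    by (rule p(2)[OF _ _ sndH]) (simp_all add: norm_Pair inner_prod_def scaleC_prod_def norm_prod_def real_le_rsqrt)
  have "proj_onto (emb_D \<Gamma> n) =
      mk_op (Ksp' \<Gamma> n) (defect_space (\<Gamma> (2*n + 1))) (\<lambda>x. snd (coord x (n + 1)))"
    unfolding Ksp'_def
    by (rule p(1)[OF _ _ sndH]) (simp_all add: norm_Pair inner_prod_def scaleC_prod_def norm_prod_def real_le_rsqrt)
  then show "x \<in> Ksp' \<Gamma> n \<Longrightarrow> app (proj_onto (emb_D \<Gamma> n)) x = snd (coord x (n + 1))" by simp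
qed


lemma Vop_coord: "x \<in> Ksp \<Gamma> n \<Longrightarrow> k \<in> {1..n + 1} \<Longrightarrow>
    coord (app (Vop \<Gamma> n) x) k = app (rotation (\<Gamma> (2*k - 1))) (coord x k)"
  by (simp add: Vop_def coord_fin_seq)

text \<open>Only the last entry of the value depends on \<open>G\<close>, and for the parameter \<open>0\<close> this entry is \<open>0\<close>.\<close>

lemma Wop_split:
  assumes y: "y \<in> Ksp' \<Gamma> n"
    and G: "G \<in> contractions (defect_space (\<Gamma> (2*n + 1))) (defect_space (adj (\<Gamma> (2*n + 1))))"
  shows "app (Wop \<Gamma> n G) y =
    app (Wop \<Gamma> n (op_zero (defect_space (\<Gamma> (2*n + 1))) (defect_space (adj (\<Gamma> (2*n + 1)))))) y
      + app (emb_D_star \<Gamma> n) (app G (snd (coord y (n + 1))))"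
proof -
  have s: "snd (coord y (n + 1)) \<in> defect_space (\<Gamma> (2*n + 1))"
    using Ksp'_coord[OF y, of "n + 1"] unfolding last_Hsp by auto
  have "app (emb_D_star \<Gamma> n) (app G (snd (coord y (n + 1)))) =
      last_vec (n + 1) (0, app G (snd (coord y (n + 1))))"
    using bops_in[OF contr_bounded[OF G] s] by (simp add: emb_D_star_eq)
  then show ?thesis
    using s y by (simp add: Wop_def Let_def ell2_eq_iff coord_fin_seq coord_last_vec)
qed

text \<open>With \<open>T = \<Gamma>\<^sub>2\<^sub>n\<^sub>+\<^sub>1\<close>, a vector of \<open>\<DD>\<^bsub>T*\<^esub>\<close> sits in the second entry of the last component, so the last rotation
  acts on it through its second column, and all other rotations are applied to \<open>0\<close>.\<close>

lemma Vop_emb_D_star: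
  assumes y: "y \<in> defect_space (adj (\<Gamma> (2*n + 1)))"
  shows "app (Vop \<Gamma> n) (app (emb_D_star \<Gamma> n) y) = app (emb_H' \<Gamma> n) (app (defect_col (\<Gamma> (2*n + 1))) y)"
proof -
  have T: "\<Gamma> (2*n + 1) \<in> contractions (defect_space (\<Gamma> (2*n))) (defect_space (adj (\<Gamma> (2*n))))"
    using choice_step[of "2*n + 1"] by simp
  have e: "app (emb_D_star \<Gamma> n) y = last_vec (n + 1) (0, y)" using y by (simp add: emb_D_star_eq)
  have K: "last_vec (n + 1) (0, y) \<in> Ksp \<Gamma> n" using bops_in[OF emb_D_star_bounded y] by (simp add: e)
  have h: "app (emb_H' \<Gamma> n) (app (defect_col (\<Gamma> (2*n + 1))) y) =
      last_vec (n + 1) (app (defect_col (\<Gamma> (2*n + 1))) y)"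
    using bops_in[OF defect_col_bounded[OF T] y] unfolding emb_H'_eq last_Hsp by simp
  have "coord (app (Vop \<Gamma> n) (last_vec (n + 1) (0, y))) k =
      coord (last_vec (n + 1) (app (defect_col (\<Gamma> (2*n + 1))) y)) k" for k
  proof (cases "k \<in> {1..n + 1}")
    case True
    have "app (rotation (\<Gamma> (2*k - 1))) 0 = 0"
      by (rule bops_zero[OF contr_bounded[OF rotation_odd[OF True]]])
    then show ?thesis
      using Vop_coord[OF K True] defect_col_app[OF T y] by (auto simp: coord_last_vec)
  next
    case False
    then show ?thesis using K by (auto simp: Vop_def coord_fin_seq coord_last_vec)
  qed
  then show ?thesis unfolding e h ell2_eq_iff by blast
qed

context
  fixes G :: "('m, 'n) oper" and z :: complex
  assumes G: "G \<in> contractions (defect_space (\<Gamma> (2*n + 1))) (defect_space (adj (\<Gamma> (2*n + 1))))"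
    and z: "cmod z < 1"
begin

abbreviation (input) \<Gamma>\<^sub>l where "\<Gamma>\<^sub>l \<equiv> \<Gamma> (2*n + 1)"
abbreviation (input) O\<^sub>l where "O\<^sub>l \<equiv> op_zero (defect_space \<Gamma>\<^sub>l) (defect_space (adj \<Gamma>\<^sub>l))"

lemma last_contraction: "\<Gamma>\<^sub>l \<in> contractions (defect_space (\<Gamma> (2*n))) (defect_space (adj (\<Gamma> (2*n))))"
  using choice_step[of "2*n + 1"] by simp

lemma zero_contraction: "O\<^sub>l \<in> contractions (defect_space \<Gamma>\<^sub>l) (defect_space (adj \<Gamma>\<^sub>l))"
  using op_zero_bounded defect_spaces_closed_csubspace[OF order_refl] by (simp add: contractions_def)

lemma Sop_contractions:
  assumes "X \<in> contractions (defect_space \<Gamma>\<^sub>l) (defect_space (adj \<Gamma>\<^sub>l))"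
  shows "Sop \<Gamma> n X \<in> contractions (Ksp \<Gamma> n) (Ksp \<Gamma> n)"
    and "Sop' \<Gamma> n X \<in> contractions (Ksp' \<Gamma> n) (Ksp' \<Gamma> n)"
  unfolding Sop_def Sop'_def
  by (rule op_comp_contraction Wop_contraction[OF assms] Vop_contraction)+

lemma row_bounded: "defect_row \<Gamma>\<^sub>l \<in> bounded_ops (Hsp \<Gamma> (n + 1)) (defect_space \<Gamma>\<^sub>l)"
  unfolding last_Hsp by (rule defect_row_bounded[OF last_contraction])

lemma col_bounded: "defect_col \<Gamma>\<^sub>l \<in> bounded_ops (defect_space (adj \<Gamma>\<^sub>l)) (Hsp' \<Gamma> (n + 1))"
  unfolding last_Hsp by (rule defect_col_bounded[OF last_contraction])

text \<open>The last entry of \<open>V x\<close>, on which \<open>G\<close> acts, is the second row of the last rotation applied to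
  the last component of \<open>x\<close>.\<close>

lemma Sop_perturbation:
  "op_id (Ksp \<Gamma> n) -\<^sub>o z *\<^sub>o Sop \<Gamma> n G = op_id (Ksp \<Gamma> n) -\<^sub>o z *\<^sub>o Sop \<Gamma> n O\<^sub>l -\<^sub>o
    z *\<^sub>o (emb_D_star \<Gamma> n \<circ>\<^sub>o (G \<circ>\<^sub>o defect_row \<Gamma>\<^sub>l \<circ>\<^sub>o proj_onto (emb_H \<Gamma> n)))"
proof (rule bops_eqI)
  note bG = contr_bounded[OF G] and bV = contr_bounded[OF Vop_contraction]
  note bS = contr_bounded[OF Sop_contractions(1)[OF G]]
    and bS0 = contr_bounded[OF Sop_contractions(1)[OF zero_contraction]]
  note bW0 = contr_bounded[OF Wop_contraction[OF zero_contraction]]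
  show "op_id (Ksp \<Gamma> n) -\<^sub>o z *\<^sub>o Sop \<Gamma> n G \<in> bounded_ops (Ksp \<Gamma> n) (Ksp \<Gamma> n)"
    by (rule bounded_ops_intros bS Ksp_sub)+
  show "op_id (Ksp \<Gamma> n) -\<^sub>o z *\<^sub>o Sop \<Gamma> n O\<^sub>l -\<^sub>o
    z *\<^sub>o (emb_D_star \<Gamma> n \<circ>\<^sub>o (G \<circ>\<^sub>o defect_row \<Gamma>\<^sub>l \<circ>\<^sub>o proj_onto (emb_H \<Gamma> n)))
      \<in> bounded_ops (Ksp \<Gamma> n) (Ksp \<Gamma> n)"
    by (rule bounded_ops_intros bS0 Ksp_sub emb_D_star_bounded bG row_bounded proj_H_bounded)+
  fix x assume x: "x \<in> Ksp \<Gamma> n"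
  have h: "coord x (n + 1) \<in> Hsp \<Gamma> (n + 1)" by (rule Ksp_coord[OF x]) simp
  note c = h[unfolded last_Hsp]
  have "snd (coord (app (Vop \<Gamma> n) x) (n + 1)) = app (defect_row \<Gamma>\<^sub>l) (coord x (n + 1))"
    using Vop_coord[OF x, of "n + 1"]
      defect_row_app[of _ \<Gamma>\<^sub>l, unfolded bops_src[OF contr_bounded[OF last_contraction]], OF c] by simp
  then show "app (op_id (Ksp \<Gamma> n) -\<^sub>o z *\<^sub>o Sop \<Gamma> n G) x =
      app (op_id (Ksp \<Gamma> n) -\<^sub>o z *\<^sub>o Sop \<Gamma> n O\<^sub>l -\<^sub>o
        z *\<^sub>o (emb_D_star \<Gamma> n \<circ>\<^sub>o (G \<circ>\<^sub>o defect_row \<Gamma>\<^sub>l \<circ>\<^sub>o proj_onto (emb_H \<Gamma> n)))) x"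
    using x h Wop_split[OF bops_in[OF bV x] G]
    by (simp add: Sop_def bops_src[OF bV] bops_src[OF row_bounded, simplified] bops_src[OF proj_H_bounded] proj_H_app scaleC_add_right)
qed

text \<open>Here \<open>G\<close> acts on the last entry of the argument, and \<open>V\<close> then applies the second
  column of the last rotation to the result.\<close>

lemma Sop'_perturbation:
  "op_id (Ksp' \<Gamma> n) -\<^sub>o z *\<^sub>o Sop' \<Gamma> n G = op_id (Ksp' \<Gamma> n) -\<^sub>o z *\<^sub>o Sop' \<Gamma> n O\<^sub>l -\<^sub>o
    z *\<^sub>o ((emb_H' \<Gamma> n \<circ>\<^sub>o defect_col \<Gamma>\<^sub>l \<circ>\<^sub>o G) \<circ>\<^sub>o proj_onto (emb_D \<Gamma> n))"
proof (rule bops_eqI)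
  note bG = contr_bounded[OF G] and bV = contr_bounded[OF Vop_contraction]
  note bS = contr_bounded[OF Sop_contractions(2)[OF G]]
    and bS0 = contr_bounded[OF Sop_contractions(2)[OF zero_contraction]]
  note bW = contr_bounded[OF Wop_contraction[OF G]]
    and bW0 = contr_bounded[OF Wop_contraction[OF zero_contraction]]
  show "op_id (Ksp' \<Gamma> n) -\<^sub>o z *\<^sub>o Sop' \<Gamma> n G \<in> bounded_ops (Ksp' \<Gamma> n) (Ksp' \<Gamma> n)"
    by (rule bounded_ops_intros bS Ksp_sub)+
  show "op_id (Ksp' \<Gamma> n) -\<^sub>o z *\<^sub>o Sop' \<Gamma> n O\<^sub>l -\<^sub>o
    z *\<^sub>o ((emb_H' \<Gamma> n \<circ>\<^sub>o defect_col \<Gamma>\<^sub>l \<circ>\<^sub>o G) \<circ>\<^sub>o proj_onto (emb_D \<Gamma> n))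
      \<in> bounded_ops (Ksp' \<Gamma> n) (Ksp' \<Gamma> n)"
    by (rule bounded_ops_intros bS0 Ksp_sub emb_H'_bounded col_bounded bG proj_D_bounded)+
  fix x assume x: "x \<in> Ksp' \<Gamma> n"
  have s: "snd (coord x (n + 1)) \<in> defect_space \<Gamma>\<^sub>l"
    using Ksp'_coord[OF x, of "n + 1"] unfolding last_Hsp by auto
  note Gs = bops_in[OF bG s]
  have "app (Vop \<Gamma> n) (app (Wop \<Gamma> n G) x) = app (Vop \<Gamma> n) (app (Wop \<Gamma> n O\<^sub>l) x)
      + app (emb_H' \<Gamma> n) (app (defect_col \<Gamma>\<^sub>l) (app G (snd (coord x (n + 1)))))"
    unfolding Wop_split[OF x G] Vop_emb_D_star[OF Gs, symmetric]
    by (rule bops_add[OF bV bops_in[OF bW0 x] bops_in[OF emb_D_star_bounded Gs]])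
  then show "app (op_id (Ksp' \<Gamma> n) -\<^sub>o z *\<^sub>o Sop' \<Gamma> n G) x =
      app (op_id (Ksp' \<Gamma> n) -\<^sub>o z *\<^sub>o Sop' \<Gamma> n O\<^sub>l -\<^sub>o
        z *\<^sub>o ((emb_H' \<Gamma> n \<circ>\<^sub>o defect_col \<Gamma>\<^sub>l \<circ>\<^sub>o G) \<circ>\<^sub>o proj_onto (emb_D \<Gamma> n))) x"
    using x s Gs by (simp add: Sop'_def bops_src[OF bW] bops_src[OF bW0, simplified] bops_src[OF bG]
        bops_src[OF col_bounded, simplified] bops_src[OF proj_D_bounded] proj_D_app scaleC_add_right)
qed


lemma Sop_resolvents_exist:
  assumes "X \<in> contractions (defect_space \<Gamma>\<^sub>l) (defect_space (adj \<Gamma>\<^sub>l))"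
  shows "op_invertible (op_id (Ksp \<Gamma> n) -\<^sub>o z *\<^sub>o Sop \<Gamma> n X)"
    and "op_invertible (op_id (Ksp' \<Gamma> n) -\<^sub>o z *\<^sub>o Sop' \<Gamma> n X)"
  using id_minus_contraction_invertible[OF Sop_contractions(1)[OF assms] z]
    id_minus_contraction_invertible[OF Sop_contractions(2)[OF assms] z] .

lemma Sop_resolvent:
  defines "A0 \<equiv> op_id (Ksp \<Gamma> n) -\<^sub>o z *\<^sub>o Sop \<Gamma> n O\<^sub>l"
  defines "B \<equiv> op_id (defect_space (adj \<Gamma>\<^sub>l)) -\<^sub>o z *\<^sub>o (G \<circ>\<^sub>o defect_row \<Gamma>\<^sub>l \<circ>\<^sub>o
    (proj_onto (emb_H \<Gamma> n) \<circ>\<^sub>o op_inv A0 \<circ>\<^sub>o emb_D_star \<Gamma> n))"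
  shows "op_invertible B"
    and "op_inv (op_id (Ksp \<Gamma> n) -\<^sub>o z *\<^sub>o Sop \<Gamma> n G) = op_inv A0 +\<^sub>o
      z *\<^sub>o ((op_inv A0 \<circ>\<^sub>o emb_D_star \<Gamma> n) \<circ>\<^sub>o op_inv B \<circ>\<^sub>o
        (G \<circ>\<^sub>o defect_row \<Gamma>\<^sub>l \<circ>\<^sub>o proj_onto (emb_H \<Gamma> n) \<circ>\<^sub>o op_inv A0))"
proof -
  let ?P = "proj_onto (emb_H \<Gamma> n)" and ?E = "emb_D_star \<Gamma> n"
  note bS0 = contr_bounded[OF Sop_contractions(1)[OF zero_contraction]]
  have bA0: "A0 \<in> bounded_ops (Ksp \<Gamma> n) (Ksp \<Gamma> n)"
    unfolding A0_def by (rule bounded_ops_intros bS0 Ksp_sub)+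
  have iA0: "op_invertible A0"
    unfolding A0_def by (rule Sop_resolvents_exist(1)[OF zero_contraction])
  have R0: "op_inv A0 \<in> bounded_ops (Ksp \<Gamma> n) (Ksp \<Gamma> n)" by (rule op_invertibleD(1)[OF iA0 bA0])
  have bF: "G \<circ>\<^sub>o defect_row \<Gamma>\<^sub>l \<circ>\<^sub>o ?P \<in> bounded_ops (Ksp \<Gamma> n) (defect_space (adj \<Gamma>\<^sub>l))"
    by (rule op_comp_bounded contr_bounded[OF G] row_bounded proj_H_bounded)+
  have "G \<circ>\<^sub>o defect_row \<Gamma>\<^sub>l \<circ>\<^sub>o (?P \<circ>\<^sub>o op_inv A0 \<circ>\<^sub>o ?E) = G \<circ>\<^sub>o defect_row \<Gamma>\<^sub>l \<circ>\<^sub>o ?P \<circ>\<^sub>o op_inv A0 \<circ>\<^sub>o ?E"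
    by (simp only: op_comp_assoc[OF op_comp_bounded[OF proj_H_bounded R0] emb_D_star_bounded]
        op_comp_assoc[OF proj_H_bounded R0])
  then have B: "B = op_id (defect_space (adj \<Gamma>\<^sub>l)) -\<^sub>o
      z *\<^sub>o (G \<circ>\<^sub>o defect_row \<Gamma>\<^sub>l \<circ>\<^sub>o ?P \<circ>\<^sub>o op_inv A0 \<circ>\<^sub>o ?E)"
    by (simp only: B_def)
  note pert = inverse_of_perturbation[OF bA0 iA0 emb_D_star_bounded bF
      Sop_resolvents_exist(1)[OF G] Sop_perturbation[folded A0_def], folded B]
  show "op_invertible B" by (rule pert(1))
  show "op_inv (op_id (Ksp \<Gamma> n) -\<^sub>o z *\<^sub>o Sop \<Gamma> n G) = op_inv A0 +\<^sub>o
      z *\<^sub>o ((op_inv A0 \<circ>\<^sub>o ?E) \<circ>\<^sub>o op_inv B \<circ>\<^sub>o (G \<circ>\<^sub>o defect_row \<Gamma>\<^sub>l \<circ>\<^sub>o ?P \<circ>\<^sub>o op_inv A0))"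
    by (rule pert(2))
qed

lemma Sop'_resolvent:
  defines "A0 \<equiv> op_id (Ksp' \<Gamma> n) -\<^sub>o z *\<^sub>o Sop' \<Gamma> n O\<^sub>l"
  defines "B \<equiv> op_id (defect_space \<Gamma>\<^sub>l) -\<^sub>o z *\<^sub>o
    ((proj_onto (emb_D \<Gamma> n) \<circ>\<^sub>o op_inv A0 \<circ>\<^sub>o emb_H' \<Gamma> n) \<circ>\<^sub>o defect_col \<Gamma>\<^sub>l \<circ>\<^sub>o G)"
  shows "op_invertible B"
    and "op_inv (op_id (Ksp' \<Gamma> n) -\<^sub>o z *\<^sub>o Sop' \<Gamma> n G) = op_inv A0 +\<^sub>o
      z *\<^sub>o ((op_inv A0 \<circ>\<^sub>o emb_H' \<Gamma> n) \<circ>\<^sub>o defect_col \<Gamma>\<^sub>l \<circ>\<^sub>o G \<circ>\<^sub>o op_inv B \<circ>\<^sub>o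
        (proj_onto (emb_D \<Gamma> n) \<circ>\<^sub>o op_inv A0))"
proof -
  let ?P = "proj_onto (emb_D \<Gamma> n)" and ?E = "emb_H' \<Gamma> n"
  note bS0 = contr_bounded[OF Sop_contractions(2)[OF zero_contraction]] and bG = contr_bounded[OF G]
  have bA0: "A0 \<in> bounded_ops (Ksp' \<Gamma> n) (Ksp' \<Gamma> n)"
    unfolding A0_def by (rule bounded_ops_intros bS0 Ksp_sub)+
  have iA0: "op_invertible A0"
    unfolding A0_def by (rule Sop_resolvents_exist(2)[OF zero_contraction])
  have R0: "op_inv A0 \<in> bounded_ops (Ksp' \<Gamma> n) (Ksp' \<Gamma> n)" by (rule op_invertibleD(1)[OF iA0 bA0])
  have bEc: "?E \<circ>\<^sub>o defect_col \<Gamma>\<^sub>l \<in> bounded_ops (defect_space (adj \<Gamma>\<^sub>l)) (Ksp' \<Gamma> n)"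
    by (rule op_comp_bounded emb_H'_bounded col_bounded)+
  have bE: "?E \<circ>\<^sub>o defect_col \<Gamma>\<^sub>l \<circ>\<^sub>o G \<in> bounded_ops (defect_space \<Gamma>\<^sub>l) (Ksp' \<Gamma> n)"
    by (rule op_comp_bounded[OF bEc bG])
  have assoc: "S \<circ>\<^sub>o (?E \<circ>\<^sub>o defect_col \<Gamma>\<^sub>l \<circ>\<^sub>o G) = S \<circ>\<^sub>o ?E \<circ>\<^sub>o defect_col \<Gamma>\<^sub>l \<circ>\<^sub>o G"
    for S :: "(('n \<times> 'm) ell2, 'x::complex_inner) oper"
    by (simp only: op_comp_assoc[OF bEc bG] op_comp_assoc[OF emb_H'_bounded col_bounded])
  note pert = inverse_of_perturbation[OF bA0 iA0 bE proj_D_bounded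
      Sop_resolvents_exist(2)[OF G] Sop'_perturbation[folded A0_def], unfolded assoc, folded B_def]
  show "op_invertible B" by (rule pert(1))
  show "op_inv (op_id (Ksp' \<Gamma> n) -\<^sub>o z *\<^sub>o Sop' \<Gamma> n G) = op_inv A0 +\<^sub>o
      z *\<^sub>o ((op_inv A0 \<circ>\<^sub>o ?E) \<circ>\<^sub>o defect_col \<Gamma>\<^sub>l \<circ>\<^sub>o G \<circ>\<^sub>o op_inv B \<circ>\<^sub>o (?P \<circ>\<^sub>o op_inv A0))"
    by (rule pert(2))
qed

end

end

theorem proposition4p3:
  fixes \<Gamma> :: "nat \<Rightarrow> ('m::{chilbert_space, second_countable_topology},
                     'n::{chilbert_space, second_countable_topology}) oper"
    and G :: "('m, 'n) oper" and n :: nat and z :: complex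
  assumes "choice_sequence (2*n + 1) \<Gamma>"
    and "defect_space (\<Gamma> (2*n + 1)) \<noteq> {0}"
    and "defect_space (adj (\<Gamma> (2*n + 1))) \<noteq> {0}"
    and "G \<in> contractions (defect_space (\<Gamma> (2*n + 1))) (defect_space (adj (\<Gamma> (2*n + 1))))"
    and "cmod z < 1"
  shows
    "let T = \<Gamma> (2*n + 1);
         D = defect_space T;
         D\<^sub>s = defect_space (adj T);
         O\<^sub>0 = op_zero D D\<^sub>s;
         A = op_id (Ksp \<Gamma> n) -\<^sub>o z *\<^sub>o Sop \<Gamma> n G;
         A\<^sub>0 = op_id (Ksp \<Gamma> n) -\<^sub>o z *\<^sub>o Sop \<Gamma> n O\<^sub>0;
         P\<^sub>H = proj_onto (emb_H \<Gamma> n);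
         B = op_id D\<^sub>s -\<^sub>o z *\<^sub>o (G \<circ>\<^sub>o defect_row T \<circ>\<^sub>o (P\<^sub>H \<circ>\<^sub>o op_inv A\<^sub>0 \<circ>\<^sub>o emb_D_star \<Gamma> n));
         A' = op_id (Ksp' \<Gamma> n) -\<^sub>o z *\<^sub>o Sop' \<Gamma> n G;
         A\<^sub>0' = op_id (Ksp' \<Gamma> n) -\<^sub>o z *\<^sub>o Sop' \<Gamma> n O\<^sub>0;
         P\<^sub>D = proj_onto (emb_D \<Gamma> n);
         B' = op_id D -\<^sub>o z *\<^sub>o ((P\<^sub>D \<circ>\<^sub>o op_inv A\<^sub>0' \<circ>\<^sub>o emb_H' \<Gamma> n) \<circ>\<^sub>o defect_col T \<circ>\<^sub>o G)
     in op_invertible A \<and> op_invertible A\<^sub>0 \<and> op_invertible B \<and>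
        op_inv A = op_inv A\<^sub>0 +\<^sub>o
          z *\<^sub>o ((op_inv A\<^sub>0 \<circ>\<^sub>o emb_D_star \<Gamma> n) \<circ>\<^sub>o op_inv B \<circ>\<^sub>o
                (G \<circ>\<^sub>o defect_row T \<circ>\<^sub>o P\<^sub>H \<circ>\<^sub>o op_inv A\<^sub>0)) \<and>
        op_invertible A' \<and> op_invertible A\<^sub>0' \<and> op_invertible B' \<and>
        op_inv A' = op_inv A\<^sub>0' +\<^sub>o
          z *\<^sub>o ((op_inv A\<^sub>0' \<circ>\<^sub>o emb_H' \<Gamma> n) \<circ>\<^sub>o defect_col T \<circ>\<^sub>o G \<circ>\<^sub>o op_inv B' \<circ>\<^sub>o
                (P\<^sub>D \<circ>\<^sub>o op_inv A\<^sub>0'))"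
  using Sop_resolvents_exist[OF assms(1,4,5) assms(4)]
    Sop_resolvents_exist[OF assms(1,4,5) zero_contraction[OF assms(1,4,5)]]
    Sop_resolvent[OF assms(1,4,5)] Sop'_resolvent[OF assms(1,4,5)]
  unfolding Let_def by (intro conjI)

end
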